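(* Let $q\ge 2$ be an integer and let $\mathcal{G}$ be a geometrically finite, asymptotically $(q+1)$-regular graph of groups with vertex set $\mathcal{V}$ and adjacency operator $A$. For $\mu\in\mathbb{C}^\times$ put $z(\mu)=\frac{\mu+\mu^{-1}}{2}$. Let $o$ be an arbitrary base point in the compact core of $\mathcal{G}$. Then the resolvent $$R_{\mathcal{G}}(\mu)=\Big(\frac{A}{2\sqrt q}-z(\mu)\Big)^{-1}:\ell^2(\mathcal{V})\to\ell^2(\mathcal{V})$$ is defined whenever $|z(\mu)|$ is sufficiently large compared with $\frac{\|A\|}{2\sqrt q}$, and is holomorphic in that range. Moreover, for every real $N\ge 0$, starting from the region of large $|\mu|$, it admits a finitely meromorphic continuation as a family of operators $$R_{\mathcal{G}}(\mu):q^{-N d(o,\cdot)}\ell^2(\mathcal{V})\to q^{N d(o,\cdot)}\ell^2(\mathcal{V})$$ to the domain $\{\mu\in\mathbb{C}^\times: |\mu|>q^{\frac12-N}\}$.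
   Context: A graph of groups $\mathcal{G}$ consists of a connected, locally finite graph with countable vertex set $\mathcal{V}$ and edge set $\mathcal{E}$ (loops and multiple edges allowed), finite groups $G_v$ ($v\in\mathcal{V}$) and $G_e$ ($e\in\mathcal{E}$), and for each oriented edge $\vec e$ (every edge, including a loop, has two orientations; $\vec e$ has origin $o(\vec e)$ and terminus $t(\vec e)$) a monomorphism $G_e\hookrightarrow G_{t(\vec e)}$. Put $\mathcal{S}(v)=|G_v|$, $\mathcal{S}(e)=|G_e|$. The degree of $v$ is $\deg(v)=\sum_{\vec e: t(\vec e)=v}\mathcal{S}(v)/\mathcal{S}(e)$. A graph of groups with boundary may in addition have half-edges ("prongs") $h$ emanating from a vertex $v$, with a group $G_h$ and a monomorphism $G_h\hookrightarrow G_v$; prongs are counted in the degree. Cutting an edge replaces it by a prong at each of its two endpoints. An orbifold funnel is a graph of groups with boundary whose underlying graph is a locally finite rooted tree with root $o$, with one prong $h$ emanating from $o$, such that $G_o=G_h$ and $G_v=G_{\{v,w\}}\le G_w$ whenever $\{v,w\}$ is an edge with $w$ closer to $o$ than $v$. A cusp is a graph of groups with boundary whose underlying graph is a ray with vertices $0,1,2,\dots$, with one prong emanating from the root $0$, such that $G_i=G_{\{i,i+1\}}$ for all $i\ge 0$. $\mathcal{G}$ is geometrically finite and asymptotically $(q+1)$-regular if it can be cut along finitely many edges into finitely many pieces: one finite graph of groups with boundary (the compact core $\mathcal{L}$, not necessarily $(q+1)$-regular), and the rest either orbifold funnels or cusps all of whose vertices have degree $q+1$. Such a decomposition is fixed.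 $A$ acts on functions $f:\mathcal{V}\to\mathbb{C}$ by $Af(v)=\sum_{\vec e:t(\vec e)=v}\frac{\mathcal{S}(v)}{\mathcal{S}(e)}f(o(\vec e))$. $\ell^2(\mathcal{V})=\{f:\sum_v|f(v)|^2/\mathcal{S}(v)<\infty\}$ and, for $\rho:\mathcal{V}\to\mathbb{R}_+$, $\rho\,\ell^2(\mathcal{V})=\{f:\sum_v|f(v)|^2/(\rho(v)^2\mathcal{S}(v))<\infty\}$ with the corresponding norm. $d$ is the path distance in the underlying graph. A family $A(\mu)\in\mathcal{L}(X,Y)$ of bounded operators between Banach spaces, $\mu\in\Omega\subseteq\mathbb{C}$, is finitely meromorphic if near each $\mu_0\in\Omega$ it has an operator-norm convergent Laurent expansion $\sum_{j\ge -J}A_j(\mu-\mu_0)^j$ with $A_{-J},\dots,A_{-1}$ of finite rank. *)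

theory Defs
  imports
    "HOL-Analysis.Analysis"
    "HOL-Algebra.Coset"
    "Graph_Theory.Digraph_Component"
    "Graph_Theory.Arc_Walk"
    "Graph_Theory.Bidirected_Digraph"
begin

section \<open>Graphs of groups with boundary\<close>

text \<open>
  The arcs of \<open>ugraph\<close> are the oriented edges (both orientations of every edge, exchanged by
  \<open>erev\<close>); \<open>tail\<close> and \<open>head\<close> are origin and terminus. A prong is represented like an oriented
  edge pointing to the vertex \<open>head h\<close> it emanates from, but it is not an arc, and its \<open>tail\<close> has
  no meaning. Edge groups and their monomorphisms into the group of the terminus are indexed by
  arcs and prongs alike.
\<close>

record ('v, 'e, 'g, 'h) gog =
  ugraph :: "('v, 'e) pre_digraph"
  erev :: "'e \<Rightarrow> 'e"
  prongs :: "'e set"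
  vgroup :: "'v \<Rightarrow> 'g monoid"
  egroup :: "'e \<Rightarrow> 'h monoid"
  emb :: "'e \<Rightarrow> 'h \<Rightarrow> 'g"

definition vertices :: "('v, 'e, 'g, 'h) gog \<Rightarrow> 'v set" where
  "vertices G = verts (ugraph G)"

definition oedges :: "('v, 'e, 'g, 'h) gog \<Rightarrow> 'e set" where
  "oedges G = arcs (ugraph G)"

definition org :: "('v, 'e, 'g, 'h) gog \<Rightarrow> 'e \<Rightarrow> 'v" where
  "org G = tail (ugraph G)"

definition ter :: "('v, 'e, 'g, 'h) gog \<Rightarrow> 'e \<Rightarrow> 'v" where
  "ter G = head (ugraph G)"

text \<open>
  \<open>bidirected_digraph\<close> makes \<open>erev\<close> a fixed-point free involution of the arcs, so that a loop
  also consists of two arcs.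
\<close>

locale graph_of_groups_with_boundary =
  fixes G :: "('v, 'e, 'g, 'h) gog"
  assumes bidirected: "bidirected_digraph (ugraph G) (erev G)"
    and connected: "Digraph_Component.connected (ugraph G)"
    and countable_vertices: "countable (vertices G)"
    and locally_finite: "\<And>v. v \<in> vertices G \<Longrightarrow> finite {e \<in> oedges G \<union> prongs G. ter G e = v}"
    and prongs_not_edges: "prongs G \<inter> oedges G = {}"
    and ter_prong: "\<And>h. h \<in> prongs G \<Longrightarrow> ter G h \<in> vertices G"
    and vgroup_group: "\<And>v. v \<in> vertices G \<Longrightarrow> group (vgroup G v)"
    and vgroup_finite: "\<And>v. v \<in> vertices G \<Longrightarrow> finite (carrier (vgroup G v))"
    and egroup_group: "\<And>e. e \<in> oedges G \<union> prongs G \<Longrightarrow> group (egroup G e)"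
    and egroup_finite: "\<And>e. e \<in> oedges G \<union> prongs G \<Longrightarrow> finite (carrier (egroup G e))"
    and egroup_erev: "\<And>e. e \<in> oedges G \<Longrightarrow> egroup G (erev G e) = egroup G e"
    and emb_mon: "\<And>e. e \<in> oedges G \<union> prongs G \<Longrightarrow> emb G e \<in> mon (egroup G e) (vgroup G (ter G e))"

locale graph_of_groups = graph_of_groups_with_boundary +
  assumes no_prongs: "prongs G = {}"

definition Sv :: "('v, 'e, 'g, 'h) gog \<Rightarrow> 'v \<Rightarrow> real" where
  "Sv G v = real (order (vgroup G v))"

definition Se :: "('v, 'e, 'g, 'h) gog \<Rightarrow> 'e \<Rightarrow> real" where
  "Se G e = real (order (egroup G e))"

definition deg :: "('v, 'e, 'g, 'h) gog \<Rightarrow> 'v \<Rightarrow> real" where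
  "deg G v = (\<Sum>e | e \<in> oedges G \<union> prongs G \<and> ter G e = v. Sv G v / Se G e)"

definition gdist :: "('v, 'e, 'g, 'h) gog \<Rightarrow> 'v \<Rightarrow> 'v \<Rightarrow> nat" where
  "gdist G u v = (LEAST n. \<exists>p. pre_digraph.awalk (ugraph G) u p v \<and> length p = n)"


section \<open>Cutting, funnels, cusps\<close>

text \<open>
  \<open>C\<close> is a set of oriented edges closed under reversal. The edge consisting of \<open>e\<close> and
  \<open>erev G e\<close> leaves the prong \<open>e\<close> at the terminus of \<open>e\<close> and the prong \<open>erev G e\<close> at its origin.
  Outside the arcs, \<open>erev\<close> is the identity by the convention of \<open>bidirected_digraph\<close>.
\<close>

definition cut_along :: "('v, 'e, 'g, 'h) gog \<Rightarrow> 'e set \<Rightarrow> ('v, 'e, 'g, 'h) gog" where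
  "cut_along G C = G\<lparr>ugraph := \<lparr>verts = vertices G, arcs = oedges G - C, tail = org G, head = ter G\<rparr>,
     erev := (\<lambda>e. if e \<in> C then e else erev G e),
     prongs := prongs G \<union> C\<rparr>"

definition restrict_to :: "('v, 'e, 'g, 'h) gog \<Rightarrow> ('v, 'e) pre_digraph \<Rightarrow> ('v, 'e, 'g, 'h) gog" where
  "restrict_to G H = G\<lparr>ugraph := H,
     erev := (\<lambda>e. if e \<in> arcs H then erev G e else e),
     prongs := {h \<in> prongs G. ter G h \<in> verts H}\<rparr>"

definition pieces :: "('v, 'e, 'g, 'h) gog \<Rightarrow> 'e set \<Rightarrow> ('v, 'e, 'g, 'h) gog set" where
  "pieces G C = restrict_to (cut_along G C) ` pre_digraph.sccs (ugraph (cut_along G C))"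

text \<open>
  In a bidirected graph every edge gives the library cycle \<open>[e, erev G e]\<close>, so the library's
  \<open>tree\<close> does not apply. All other library cycles (loops, pairs of parallel edges, closed paths
  through at least three vertices) are circuits of the undirected graph.
\<close>

definition is_tree :: "('v, 'e, 'g, 'h) gog \<Rightarrow> bool" where
  "is_tree G \<longleftrightarrow> Digraph_Component.connected (ugraph G) \<and>
     (\<forall>p. pre_digraph.cycle (ugraph G) p \<longrightarrow> (\<exists>e \<in> oedges G. p = [e, erev G e]))"

text \<open>
  An equality of groups such as \<open>G_v = G_e\<close> means that the given monomorphism is an isomorphism.
\<close>

definition orbifold_funnel :: "('v, 'e, 'g, 'h) gog \<Rightarrow> bool" where
  "orbifold_funnel P \<longleftrightarrow> graph_of_groups_with_boundary P \<and> is_tree P \<and>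
     (\<exists>root \<in> vertices P. \<exists>h. prongs P = {h} \<and> ter P h = root \<and>
        emb P h \<in> iso (egroup P h) (vgroup P root) \<and>
        (\<forall>e \<in> oedges P. gdist P root (org P e) < gdist P root (ter P e) \<longrightarrow>
           emb P e \<in> iso (egroup P e) (vgroup P (ter P e))))"

definition cusp :: "('v, 'e, 'g, 'h) gog \<Rightarrow> bool" where
  "cusp P \<longleftrightarrow> graph_of_groups_with_boundary P \<and>
     (\<exists>(x :: nat \<Rightarrow> 'v) (\<epsilon> :: nat \<Rightarrow> 'e) h.
        bij_betw x UNIV (vertices P) \<and>
        oedges P = range \<epsilon> \<union> erev P ` range \<epsilon> \<and>
        (\<forall>i. org P (\<epsilon> i) = x i \<and> ter P (\<epsilon> i) = x (Suc i)) \<and>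
        prongs P = {h} \<and> ter P h = x 0 \<and>
        (\<forall>i. emb P (erev P (\<epsilon> i)) \<in> iso (egroup P (erev P (\<epsilon> i))) (vgroup P (x i))))"

text \<open>
  The decomposition exhibiting \<open>G\<close> as geometrically finite and asymptotically
  \<open>(q + 1)\<close>-regular, with cut edges \<open>C\<close> and compact core \<open>L\<close>.
\<close>

definition gf_decomposition ::
    "nat \<Rightarrow> ('v, 'e, 'g, 'h) gog \<Rightarrow> 'e set \<Rightarrow> ('v, 'e, 'g, 'h) gog \<Rightarrow> bool" where
  "gf_decomposition q G C L \<longleftrightarrow>
     C \<subseteq> oedges G \<and> erev G ` C = C \<and> finite C \<and>
     finite (pieces G C) \<and>
     L \<in> pieces G C \<and> graph_of_groups_with_boundary L \<and> finite (vertices L) \<and> finite (oedges L) \<and>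
     (\<forall>P \<in> pieces G C - {L}. (orbifold_funnel P \<or> cusp P) \<and>
        (\<forall>v \<in> vertices P. deg P v = real q + 1))"


section \<open>Weighted sequence spaces and operators\<close>

text \<open>Functions on the vertex set are represented as functions vanishing off the vertex set.\<close>

record 'v fun_space =
  elems :: "('v \<Rightarrow> complex) set"
  fnorm :: "('v \<Rightarrow> complex) \<Rightarrow> real"

definition weighted_l2 :: "('v, 'e, 'g, 'h) gog \<Rightarrow> ('v \<Rightarrow> real) \<Rightarrow> 'v fun_space" where
  "weighted_l2 G \<rho> = \<lparr>
     elems = {f. (\<forall>v. v \<notin> vertices G \<longrightarrow> f v = 0) \<and>
       (\<lambda>v. (cmod (f v))\<^sup>2 / ((\<rho> v)\<^sup>2 * Sv G v)) summable_on vertices G},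
     fnorm = (\<lambda>f. sqrt (\<Sum>\<^sub>\<infinity>v\<in>vertices G. (cmod (f v))\<^sup>2 / ((\<rho> v)\<^sup>2 * Sv G v)))\<rparr>"

definition l2 :: "('v, 'e, 'g, 'h) gog \<Rightarrow> 'v fun_space" where
  "l2 G = weighted_l2 G (\<lambda>_. 1)"

text \<open>Operators \<open>X \<rightarrow> Y\<close> are only considered on \<open>elems X\<close>; their values elsewhere are irrelevant.\<close>

type_synonym 'v operator = "('v \<Rightarrow> complex) \<Rightarrow> ('v \<Rightarrow> complex)"

definition bounded_operator :: "'v fun_space \<Rightarrow> 'v fun_space \<Rightarrow> 'v operator \<Rightarrow> bool" where
  "bounded_operator X Y T \<longleftrightarrow>
     (\<forall>f \<in> elems X. T f \<in> elems Y) \<and>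
     (\<forall>f \<in> elems X. \<forall>g \<in> elems X. T (\<lambda>v. f v + g v) = (\<lambda>v. T f v + T g v)) \<and>
     (\<forall>f \<in> elems X. \<forall>c. T (\<lambda>v. c * f v) = (\<lambda>v. c * T f v)) \<and>
     (\<exists>B. \<forall>f \<in> elems X. fnorm Y (T f) \<le> B * fnorm X f)"

definition opnorm :: "'v fun_space \<Rightarrow> 'v fun_space \<Rightarrow> 'v operator \<Rightarrow> real" where
  "opnorm X Y T = Sup {fnorm Y (T f) | f. f \<in> elems X \<and> fnorm X f \<le> 1}"

definition finite_rank :: "'v fun_space \<Rightarrow> 'v operator \<Rightarrow> bool" where
  "finite_rank X T \<longleftrightarrow> (\<exists>B. finite B \<and>
     (\<forall>f \<in> elems X. \<exists>c. T f = (\<lambda>v. \<Sum>b\<in>B. c b * b v)))"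

definition holomorphic_family ::
    "'v fun_space \<Rightarrow> 'v fun_space \<Rightarrow> complex set \<Rightarrow> (complex \<Rightarrow> 'v operator) \<Rightarrow> bool" where
  "holomorphic_family X Y \<Omega> F \<longleftrightarrow>
     (\<forall>\<mu>\<in>\<Omega>. bounded_operator X Y (F \<mu>)) \<and>
     (\<forall>\<mu>\<^sub>0\<in>\<Omega>. \<exists>D. bounded_operator X Y D \<and>
        ((\<lambda>\<mu>. opnorm X Y (\<lambda>f v. (F \<mu> f v - F \<mu>\<^sub>0 f v) / (\<mu> - \<mu>\<^sub>0) - D f v)) \<longlongrightarrow> 0)
          (at \<mu>\<^sub>0 within \<Omega>))"

text \<open>
  \<open>J\<close> is the pole order at \<open>\<mu>\<^sub>0\<close>: unless \<open>J = 0\<close>, the coefficient \<open>A (- J)\<close> does not vanish.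
  The value \<open>F \<mu>\<^sub>0\<close> is unconstrained if \<open>\<mu>\<^sub>0\<close> is a pole, and it is \<open>A 0\<close> otherwise.
\<close>

definition finitely_meromorphic ::
    "'v fun_space \<Rightarrow> 'v fun_space \<Rightarrow> complex set \<Rightarrow> (complex \<Rightarrow> 'v operator) \<Rightarrow> bool" where
  "finitely_meromorphic X Y \<Omega> F \<longleftrightarrow>
     (\<forall>\<mu>\<^sub>0\<in>\<Omega>. \<exists>(J :: nat) (A :: int \<Rightarrow> 'v operator) r.
        r > 0 \<and>
        (\<forall>j \<ge> - int J. bounded_operator X Y (A j)) \<and>
        (\<forall>j. - int J \<le> j \<and> j < 0 \<longrightarrow> finite_rank X (A j)) \<and>
        (J = 0 \<or> (\<exists>f \<in> elems X. A (- int J) f \<noteq> (\<lambda>_. 0))) \<and>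
        (\<forall>\<mu>\<in>\<Omega>. dist \<mu> \<mu>\<^sub>0 < r \<and> (\<mu> \<noteq> \<mu>\<^sub>0 \<or> J = 0) \<longrightarrow>
           bounded_operator X Y (F \<mu>) \<and>
           (\<lambda>n. opnorm X Y (\<lambda>f v. F \<mu> f v -
              (\<Sum>j\<in>{- int J..int n}. (\<mu> - \<mu>\<^sub>0) powi j * A j f v))) \<longlonglongrightarrow> 0))"


section \<open>The adjacency operator and its resolvent\<close>

definition adjacency :: "('v, 'e, 'g, 'h) gog \<Rightarrow> 'v operator" where
  "adjacency G f v =
     (\<Sum>e | e \<in> oedges G \<and> ter G e = v. of_real (Sv G v / Se G e) * f (org G e))"

definition z :: "complex \<Rightarrow> complex" where
  "z \<mu> = (\<mu> + inverse \<mu>) / 2"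

definition shifted_adjacency :: "nat \<Rightarrow> ('v, 'e, 'g, 'h) gog \<Rightarrow> complex \<Rightarrow> 'v operator" where
  "shifted_adjacency q G \<mu> f = (\<lambda>v. adjacency G f v / of_real (2 * sqrt (real q)) - z \<mu> * f v)"

definition resolvent :: "nat \<Rightarrow> ('v, 'e, 'g, 'h) gog \<Rightarrow> complex \<Rightarrow> 'v operator" where
  "resolvent q G \<mu> = the_inv_into (elems (l2 G)) (shifted_adjacency q G \<mu>)"

definition resolvent_defined :: "nat \<Rightarrow> ('v, 'e, 'g, 'h) gog \<Rightarrow> complex \<Rightarrow> bool" where
  "resolvent_defined q G \<mu> \<longleftrightarrow>
     bij_betw (shifted_adjacency q G \<mu>) (elems (l2 G)) (elems (l2 G)) \<and>
     bounded_operator (l2 G) (l2 G) (resolvent q G \<mu>)"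

end

theory Submission
  imports Defs "HOL-Complex_Analysis.Complex_Analysis" "Jordan_Normal_Form.Determinant"
begin

text \<open>
  On an end write \<open>A = U + P\<close>, where \<open>U\<close> collects the contributions of the neighbours farther from
  the core and \<open>P\<close> that of the one closer to it. In funnels and in cusps alike, regularity of
  degree \<open>q + 1\<close> means \<open>U P = q\<close>, so that with \<open>t = 1 / (sqrt q * \<mu>)\<close>
  \<open>A / (2 sqrt q) - z \<mu> = - (\<mu> / 2) (1 - t U) (1 - t P)\<close>.
  On the space weighted by \<open>q powr (- N d)\<close> the norm of \<open>U\<close> is at most \<open>q powr (1/2 - N)\<close>, and so is that
  of \<open>P\<close> on the space weighted by \<open>q powr (N d)\<close>. Hence both factors are inverted by Neumann series for
  \<open>cmod \<mu> > q powr (- N)\<close>. Eliminating the ends leaves on the finite core a matrix whose entries are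
  Laurent polynomials in \<open>\<mu>\<close>; its inverse is rational, which gives the poles and their finite rank.
  Convergence of Laurent expansions in operator norm is reduced by duality to Cauchy estimates for
  scalar functions.
\<close>


section \<open>Weighted sequence spaces\<close>

text \<open>The order of the two factors is forced. \<open>U P\<close> is scalar, whereas
  \<open>P U\<close> sums over siblings and vanishes at the roots of the ends. The inverse on the
  ends is therefore the inverse of \<open>1 - t P\<close> applied after that of
  \<open>1 - t U\<close>: the first series to act converges on the decaying space, the second on the
  growing one, with the inclusion of one space into the other between them. That the core
  determinant is not identically zero cannot be read off its entries. It comes from one point where
  \<open>|z|\<close> is large: there \<open>A / (2 sqrt q) - z\<close> is injective on
  \<open>l2\<close>, and a kernel vector of the core matrix would extend over the ends to an
  \<open>l2\<close> function in the kernel. The order \<open>m\<close> of a zero of the determinant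
  may exceed the order of the pole, while the notion of a finitely meromorphic family asks for the
  exact order and for the right value at a removable point. Hence \<open>(\<mu> - \<xi>) ^ m\<close>
  times the inverse is expanded first, the pole order is found from its coefficients, and the family
  is given a limit as its value at the zeros of the determinant.\<close>

definition wsp :: "'v set \<Rightarrow> ('v \<Rightarrow> real) \<Rightarrow> 'v fun_space" where
  "wsp V w = \<lparr>
     elems = {f. (\<forall>v. v \<notin> V \<longrightarrow> f v = 0) \<and> (\<lambda>v. (cmod (f v))\<^sup>2 / w v) summable_on V},
     fnorm = (\<lambda>f. sqrt (\<Sum>\<^sub>\<infinity>v\<in>V. (cmod (f v))\<^sup>2 / w v))\<rparr>"

lemma weighted_l2_eq_wsp: "weighted_l2 G \<rho> = wsp (vertices G) (\<lambda>v. (\<rho> v)\<^sup>2 * Sv G v)"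
  by (simp add: weighted_l2_def wsp_def)

lemma l2_eq_wsp: "l2 G = wsp (vertices G) (Sv G)"
  by (simp add: l2_def weighted_l2_eq_wsp)

text \<open>Norm of the restriction to a finite set of vertices. Written through
  \<open>L2_set\<close>, it inherits the triangle and Cauchy-Schwarz inequalities, and estimates
  made on all finite sets replace manipulations of infinite sums.\<close>

definition lnorm :: "('v \<Rightarrow> real) \<Rightarrow> 'v set \<Rightarrow> ('v \<Rightarrow> complex) \<Rightarrow> real" where
  "lnorm w F f = L2_set (\<lambda>v. cmod (f v) / sqrt (w v)) F"

lemma lnorm_nonneg: "0 \<le> lnorm w F f"
  by (simp add: lnorm_def)

lemma lnorm_add: "lnorm w F (\<lambda>v. f v + g v) \<le> lnorm w F f + lnorm w F g"
proof -
  \<comment> \<open>The real \<open>sqrt\<close> is odd, so a negative weight would make the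
    quotients negative and block monotonicity. Only squares enter \<open>L2_set\<close>, hence
    \<open>w v\<close> may be exchanged for its absolute value.\<close>
  have sq: "(sqrt x)\<^sup>2 = \<bar>x\<bar>" for x :: real
    by (cases "0 \<le> x") (auto simp: real_sqrt_minus[of "- x", symmetric] power2_eq_square abs_if)
  have "lnorm w F (\<lambda>v. f v + g v) = L2_set (\<lambda>v. cmod (f v + g v) / sqrt \<bar>w v\<bar>) F"
    unfolding lnorm_def L2_set_def
    by (intro arg_cong[where f=sqrt] sum.cong) (auto simp: power_divide sq)
  also have "\<dots> \<le> L2_set (\<lambda>v. cmod (f v) / sqrt \<bar>w v\<bar> + cmod (g v) / sqrt \<bar>w v\<bar>) F"
    by (intro L2_set_mono) (auto simp: add_divide_distrib[symmetric] intro!: divide_right_mono norm_triangle_ineq)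
  also have "\<dots> \<le> L2_set (\<lambda>v. cmod (f v) / sqrt \<bar>w v\<bar>) F + L2_set (\<lambda>v. cmod (g v) / sqrt \<bar>w v\<bar>) F"
    by (rule L2_set_triangle_ineq)
  also have "\<dots> = lnorm w F f + lnorm w F g"
    unfolding lnorm_def L2_set_def
    by (intro arg_cong2[where f="(+)"] arg_cong[where f=sqrt] sum.cong)
      (auto simp: power_divide sq)
  finally show ?thesis .
qed

lemma lnorm_scale: "lnorm w F (\<lambda>v. c * f v) = cmod c * lnorm w F f"
  unfolding lnorm_def by (simp add: norm_mult L2_set_right_distrib)

lemma lnorm_tendsto:
  assumes "\<And>v. v \<in> F \<Longrightarrow> ((\<lambda>i. f i v) \<longlongrightarrow> g v) Fl"
  shows "((\<lambda>i. lnorm w F (f i)) \<longlongrightarrow> lnorm w F g) Fl"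
  unfolding lnorm_def L2_set_def divide_inverse
  by (intro tendsto_intros assms)

locale weighted_space =
  fixes V :: "'v set" and w :: "'v \<Rightarrow> real"
  assumes weight_pos: "v \<in> V \<Longrightarrow> 0 < w v"
begin

lemma lnorm_square:
  assumes "F \<subseteq> V"
  shows "(lnorm w F f)\<^sup>2 = (\<Sum>v\<in>F. (cmod (f v))\<^sup>2 / w v)"
proof -
  have "(lnorm w F f)\<^sup>2 = (\<Sum>v\<in>F. (cmod (f v) / sqrt (w v))\<^sup>2)"
    unfolding lnorm_def L2_set_def by (simp add: sum_nonneg)
  also have "\<dots> = (\<Sum>v\<in>F. (cmod (f v))\<^sup>2 / w v)"
    using assms weight_pos by (intro sum.cong) (auto simp: power_divide less_imp_le subset_eq)
  finally show ?thesis .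
qed

lemma term_nonneg: "v \<in> V \<Longrightarrow> 0 \<le> (cmod (f v))\<^sup>2 / w v"
  using weight_pos by (simp add: less_imp_le)

lemma lnorm_le_fnorm:
  assumes "f \<in> elems (wsp V w)" "finite F" "F \<subseteq> V"
  shows "lnorm w F f \<le> fnorm (wsp V w) f"
proof -
  have "(lnorm w F f)\<^sup>2 \<le> (\<Sum>\<^sub>\<infinity>v\<in>V. (cmod (f v))\<^sup>2 / w v)"
    unfolding lnorm_square[OF assms(3)]
    using assms weight_pos by (intro finite_sum_le_infsum) (auto simp: wsp_def less_imp_le)
  then have "sqrt ((lnorm w F f)\<^sup>2) \<le> fnorm (wsp V w) f"
    unfolding wsp_def by (simp del: real_sqrt_abs)
  then show ?thesis by (simp add: lnorm_nonneg)
qed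

text \<open>Nonnegative terms with bounded partial sums are summable, and the bound survives in the
  limit. Membership and norm bounds are thereby reduced to estimates on finite sets.\<close>

lemma elems_bound:
  assumes "\<And>v. v \<notin> V \<Longrightarrow> f v = 0" and "\<And>F. finite F \<Longrightarrow> F \<subseteq> V \<Longrightarrow> lnorm w F f \<le> B"
  shows "f \<in> elems (wsp V w)" and "fnorm (wsp V w) f \<le> B"
proof -
  have B: "0 \<le> B" using assms(2)[of "{}"] by (simp add: lnorm_def)
  have le: "(\<Sum>v\<in>F. (cmod (f v))\<^sup>2 / w v) \<le> B\<^sup>2" if "finite F" "F \<subseteq> V" for F
    using assms(2)[OF that] lnorm_square[OF that(2), of f] lnorm_nonneg[of w F f]
    by (metis power_mono)
  have sm: "(\<lambda>v. (cmod (f v))\<^sup>2 / w v) summable_on V"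
    using le term_nonneg by (intro nonneg_bounded_partial_sums_imp_summable_on[where C = "B\<^sup>2"])
      (auto simp: eventually_finite_subsets_at_top intro!: exI[of _ "{}"])
  then show "f \<in> elems (wsp V w)"
    using assms(1) by (simp add: wsp_def)
  have "(\<Sum>\<^sub>\<infinity>v\<in>V. (cmod (f v))\<^sup>2 / w v) \<le> B\<^sup>2"
    by (rule infsum_le_finite_sums[OF sm]) (use le in auto)
  then show "fnorm (wsp V w) f \<le> B"
    using B by (simp add: wsp_def real_le_lsqrt infsum_nonneg term_nonneg)
qed

lemma elems_off: "f \<in> elems (wsp V w) \<Longrightarrow> v \<notin> V \<Longrightarrow> f v = 0"
  by (simp add: wsp_def)

lemma fnorm_nonneg: "0 \<le> fnorm (wsp V w) f"
  by (simp add: wsp_def infsum_nonneg term_nonneg)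

lemma elems_zero: "(\<lambda>_. 0) \<in> elems (wsp V w)"
  by (simp add: wsp_def)

lemma fnorm_zero: "fnorm (wsp V w) (\<lambda>_. 0) = 0"
  by (simp add: wsp_def)

lemma elems_add:
  assumes "f \<in> elems (wsp V w)" "g \<in> elems (wsp V w)"
  shows "(\<lambda>v. f v + g v) \<in> elems (wsp V w)"
    and "fnorm (wsp V w) (\<lambda>v. f v + g v) \<le> fnorm (wsp V w) f + fnorm (wsp V w) g"
proof -
  have *: "lnorm w F (\<lambda>v. f v + g v) \<le> fnorm (wsp V w) f + fnorm (wsp V w) g"
    if "finite F" "F \<subseteq> V" for F
    using lnorm_add[of w F f g] lnorm_le_fnorm[OF assms(1) that] lnorm_le_fnorm[OF assms(2) that]
    by linarith
  show "(\<lambda>v. f v + g v) \<in> elems (wsp V w)"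
    by (rule elems_bound(1)[OF _ *]) (use elems_off[OF assms(1)] elems_off[OF assms(2)] in auto)
  show "fnorm (wsp V w) (\<lambda>v. f v + g v) \<le> fnorm (wsp V w) f + fnorm (wsp V w) g"
    by (rule elems_bound(2)[OF _ *]) (use elems_off[OF assms(1)] elems_off[OF assms(2)] in auto)
qed

lemma elems_scale:
  assumes "f \<in> elems (wsp V w)"
  shows "(\<lambda>v. c * f v) \<in> elems (wsp V w)"
    and "fnorm (wsp V w) (\<lambda>v. c * f v) = cmod c * fnorm (wsp V w) f"
proof -
  have 1: "(\<lambda>v. d * g v) \<in> elems (wsp V w)"
    and 2: "fnorm (wsp V w) (\<lambda>v. d * g v) \<le> cmod d * fnorm (wsp V w) g"
    if "g \<in> elems (wsp V w)" for d g
  proof -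
    have *: "lnorm w F (\<lambda>v. d * g v) \<le> cmod d * fnorm (wsp V w) g"
      if "finite F" "F \<subseteq> V" for F
      using lnorm_le_fnorm[OF \<open>g \<in> _\<close> that] by (simp add: lnorm_scale mult_left_mono)
    show "(\<lambda>v. d * g v) \<in> elems (wsp V w)"
      by (rule elems_bound(1)[OF _ *]) (use elems_off[OF that] in auto)
    show "fnorm (wsp V w) (\<lambda>v. d * g v) \<le> cmod d * fnorm (wsp V w) g"
      by (rule elems_bound(2)[OF _ *]) (use elems_off[OF that] in auto)
  qed
  show "(\<lambda>v. c * f v) \<in> elems (wsp V w)" by (rule 1[OF assms])
  show "fnorm (wsp V w) (\<lambda>v. c * f v) = cmod c * fnorm (wsp V w) f"
  proof (cases "c = 0")
    case False
    \<comment> \<open>The reverse inequality is the inequality already shown, applied to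
      \<open>c * f\<close> with the factor \<open>inverse c\<close>.\<close>
    have "fnorm (wsp V w) f \<le> cmod (inverse c) * fnorm (wsp V w) (\<lambda>v. c * f v)"
      using 2[OF 1[OF assms], of "inverse c" c] False by (simp add: mult.assoc[symmetric])
    then show ?thesis
      using 2[OF assms, of c] False by (intro antisym) (simp_all add: norm_inverse norm_divide field_simps)
  qed (simp add: fnorm_zero)
qed

lemma elems_diff:
  assumes "f \<in> elems (wsp V w)" "g \<in> elems (wsp V w)"
  shows "(\<lambda>v. f v - g v) \<in> elems (wsp V w)"
    and "fnorm (wsp V w) (\<lambda>v. f v - g v) \<le> fnorm (wsp V w) f + fnorm (wsp V w) g"
  using elems_add[OF assms(1) elems_scale(1)[OF assms(2), of "-1"]]
    elems_scale(2)[OF assms(2), of "-1"] by simp_all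

lemma elems_sum:
  assumes "finite I" "\<And>i. i \<in> I \<Longrightarrow> f i \<in> elems (wsp V w)"
  shows "(\<lambda>v. \<Sum>i\<in>I. f i v) \<in> elems (wsp V w)"
    and "fnorm (wsp V w) (\<lambda>v. \<Sum>i\<in>I. f i v) \<le> (\<Sum>i\<in>I. fnorm (wsp V w) (f i))"
proof -
  have "(\<lambda>v. \<Sum>i\<in>I. f i v) \<in> elems (wsp V w) \<and>
    fnorm (wsp V w) (\<lambda>v. \<Sum>i\<in>I. f i v) \<le> (\<Sum>i\<in>I. fnorm (wsp V w) (f i))"
    using assms
  proof (induction I rule: finite_induct)
    case empty
    then show ?case by (simp add: elems_zero fnorm_zero)
  next
    case (insert x I)
    then show ?case
      using elems_add[of "f x" "\<lambda>v. \<Sum>i\<in>I. f i v"] by fastforce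
  qed
  then show "(\<lambda>v. \<Sum>i\<in>I. f i v) \<in> elems (wsp V w)"
    and "fnorm (wsp V w) (\<lambda>v. \<Sum>i\<in>I. f i v) \<le> (\<Sum>i\<in>I. fnorm (wsp V w) (f i))"
    by simp_all
qed

text \<open>Point evaluations are continuous. This bounds the functionals through which the finite
  core sees a function.\<close>

lemma cmod_le_fnorm:
  assumes "f \<in> elems (wsp V w)" "v \<in> V"
  shows "cmod (f v) \<le> sqrt (w v) * fnorm (wsp V w) f"
proof -
  have "cmod (f v) / sqrt (w v) \<le> fnorm (wsp V w) f"
    using lnorm_le_fnorm[OF assms(1), of "{v}"] assms(2) weight_pos[OF assms(2)]
    unfolding lnorm_def L2_set_def by (simp del: real_sqrt_divide add: power_divide real_sqrt_divide)
  then show ?thesis using weight_pos[OF assms(2)] by (simp add: field_simps)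
qed

lemma finite_support_elems:
  assumes "finite F" "F \<subseteq> V" "\<And>v. v \<notin> F \<Longrightarrow> f v = 0"
  shows "f \<in> elems (wsp V w)" and "fnorm (wsp V w) f \<le> (\<Sum>v\<in>F. cmod (f v) / sqrt (w v))"
proof -
  have *: "lnorm w F' f \<le> (\<Sum>v\<in>F. cmod (f v) / sqrt (w v))" if "finite F'" "F' \<subseteq> V" for F'
  proof -
    have "lnorm w F' f \<le> (\<Sum>v\<in>F'. cmod (f v) / sqrt (w v))"
      unfolding lnorm_def using weight_pos that by (intro L2_set_le_sum) (auto simp: less_imp_le subset_eq)
    also have "\<dots> \<le> (\<Sum>v\<in>F. cmod (f v) / sqrt (w v))"
    proof -
      have "(\<Sum>v\<in>F'. cmod (f v) / sqrt (w v)) = (\<Sum>v\<in>F' \<inter> F. cmod (f v) / sqrt (w v))"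
        using assms that by (intro sum.mono_neutral_right) auto
      also have "\<dots> \<le> (\<Sum>v\<in>F. cmod (f v) / sqrt (w v))"
        using assms weight_pos by (intro sum_mono2) (auto simp: less_imp_le subset_eq)
      finally show ?thesis .
    qed
    finally show ?thesis .
  qed
  show "f \<in> elems (wsp V w)" and "fnorm (wsp V w) f \<le> (\<Sum>v\<in>F. cmod (f v) / sqrt (w v))"
    by (rule elems_bound[OF _ *]; use assms in blast)+
qed

text \<open>This stands in for completeness.\<close>

lemma elems_limit:
  assumes "\<And>v. v \<notin> V \<Longrightarrow> f v = 0" and "\<And>v. v \<in> V \<Longrightarrow> (\<lambda>n. g n v) \<longlonglongrightarrow> f v"
    and "\<And>n. g n \<in> elems (wsp V w)" and "\<And>n. fnorm (wsp V w) (g n) \<le> B"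
  shows "f \<in> elems (wsp V w)" and "fnorm (wsp V w) f \<le> B"
proof -
  have *: "lnorm w F f \<le> B" if "finite F" "F \<subseteq> V" for F
  proof (rule LIMSEQ_le_const2)
    show "(\<lambda>n. lnorm w F (g n)) \<longlonglongrightarrow> lnorm w F f"
      using that assms(2) by (intro lnorm_tendsto) auto
    show "\<exists>N. \<forall>n\<ge>N. lnorm w F (g n) \<le> B"
      using lnorm_le_fnorm[OF assms(3) that] assms(4) by (meson order_trans)
  qed
  show "f \<in> elems (wsp V w)" and "fnorm (wsp V w) f \<le> B"
    by (rule elems_bound[OF _ *]; use assms in blast)+
qed

end

section \<open>Cauchy estimates for vector-valued functions by duality\<close>

lemma lnorm_inner_le:
  assumes "finite F" "\<And>v. v \<in> F \<Longrightarrow> 0 < w v"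
  shows "cmod (\<Sum>v\<in>F. cnj (c v) * f v / of_real (w v)) \<le> lnorm w F c * lnorm w F f"
proof -
  have "cmod (\<Sum>v\<in>F. cnj (c v) * f v / of_real (w v)) \<le> (\<Sum>v\<in>F. cmod (cnj (c v) * f v / of_real (w v)))"
    by (rule norm_sum)
  also have "\<dots> = (\<Sum>v\<in>F. \<bar>cmod (c v) / sqrt (w v)\<bar> * \<bar>cmod (f v) / sqrt (w v)\<bar>)"
    using assms(2) by (intro sum.cong) (auto simp: norm_mult norm_divide less_imp_le)
  also have "\<dots> \<le> lnorm w F c * lnorm w F f"
    unfolding lnorm_def by (rule L2_set_mult_ineq)
  finally show ?thesis .
qed

lemma lnorm_inner_self:
  assumes "finite F" "\<And>v. v \<in> F \<Longrightarrow> 0 < w v"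
  shows "(\<Sum>v\<in>F. cnj (c v) * c v / of_real (w v)) = of_real ((lnorm w F c)\<^sup>2)"
proof -
  have "(lnorm w F c)\<^sup>2 = (\<Sum>v\<in>F. (cmod (c v))\<^sup>2 / w v)"
    using weighted_space.lnorm_square[of F w F c] assms(2) by (simp add: weighted_space_def)
  moreover have "cnj (c v) * c v = of_real ((cmod (c v))\<^sup>2)" for v
    by (metis complex_norm_square mult.commute)
  ultimately show ?thesis by simp
qed

text \<open>Cauchy's inequality bounds the coefficient of order \<open>j\<close> by
  \<open>K / r ^ j\<close>, so the tail is dominated by a geometric series with ratio
  \<open>dist \<mu> \<xi> / r\<close>. The bound sees \<open>h\<close> only through
  \<open>K\<close>, which later makes it uniform over the unit ball of a space.\<close>

lemma taylor_remainder_le: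
  assumes "open S" "cball \<xi> r \<subseteq> S" "h holomorphic_on S" "0 < r"
    and "\<And>\<mu>. \<mu> \<in> cball \<xi> r \<Longrightarrow> cmod (h \<mu>) \<le> K" and "dist \<mu> \<xi> < r"
  shows "cmod (h \<mu> - (\<Sum>j<n. (\<mu> - \<xi>) ^ j * ((deriv ^^ j) h \<xi> / fact j)))
    \<le> K * ((dist \<mu> \<xi> / r) ^ n / (1 - dist \<mu> \<xi> / r))"
proof -
  define t where "t = dist \<mu> \<xi> / r"
  define c where "c = (\<lambda>j. (\<mu> - \<xi>) ^ j * ((deriv ^^ j) h \<xi> / fact j))"
  have t: "0 \<le> t" "t < 1" using assms by (auto simp: t_def)
  have hol: "h holomorphic_on ball \<xi> r"
    using assms(2,3) ball_subset_cball by (meson holomorphic_on_subset)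
  have "(\<lambda>j. (deriv ^^ j) h \<xi> / fact j * (\<mu> - \<xi>) ^ j) sums h \<mu>"
    by (rule holomorphic_power_series[OF hol]) (use assms(6) in \<open>simp add: dist_commute\<close>)
  then have s: "c sums h \<mu>" by (simp add: c_def mult.commute)
  have cb: "cmod (c j) \<le> K * t ^ j" for j
  proof -
    have "cmod ((deriv ^^ j) h \<xi>) \<le> fact j * K / r ^ j"
      by (rule Cauchy_inequality[OF hol])
        (use assms in \<open>auto intro!: continuous_on_subset[OF holomorphic_on_imp_continuous_on[OF assms(3)]]
          simp: dist_norm norm_minus_commute\<close>)
    then have "cmod ((deriv ^^ j) h \<xi>) / fact j \<le> K / r ^ j"
      by (simp add: field_simps)
    then have "dist \<mu> \<xi> ^ j * (cmod ((deriv ^^ j) h \<xi>) / fact j) \<le> dist \<mu> \<xi> ^ j * (K / r ^ j)"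
      by (rule mult_left_mono) simp
    then have "cmod (c j) \<le> dist \<mu> \<xi> ^ j * (K / r ^ j)"
      by (simp add: c_def norm_mult norm_divide norm_power dist_norm)
    then show ?thesis by (simp add: t_def power_divide field_simps)
  qed
  have gs: "(\<lambda>j. K * t ^ (j + n)) sums (K * (t ^ n / (1 - t)))"
    using sums_mult[OF geometric_sums[of t], of "K * t ^ n"] t by (simp add: power_add mult_ac)
  have "(\<lambda>j. c (j + n)) sums (h \<mu> - (\<Sum>j<n. c j))"
    using s by (rule sums_split_initial_segment)
  then have "h \<mu> - (\<Sum>j<n. c j) = (\<Sum>j. c (j + n))" by (simp add: sums_iff)
  also have "cmod \<dots> \<le> (\<Sum>j. K * t ^ (j + n))"
    by (rule norm_suminf_le[OF cb sums_summable[OF gs]])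
  also have "\<dots> = K * (t ^ n / (1 - t))" using gs by (simp add: sums_iff)
  finally show ?thesis by (simp add: c_def t_def)
qed

text \<open>Pairing with the remainder itself reduces the vector-valued estimate to the scalar one.\<close>

lemma taylor_remainder_lnorm_le:
  fixes \<phi> :: "complex \<Rightarrow> 'v \<Rightarrow> complex"
  assumes "open S" "cball \<xi> r \<subseteq> S" "0 < r"
    and hol: "\<And>v. v \<in> F \<Longrightarrow> (\<lambda>\<mu>. \<phi> \<mu> v) holomorphic_on S"
    and F: "finite F" "\<And>v. v \<in> F \<Longrightarrow> 0 < w v"
    and K: "\<And>\<mu>. \<mu> \<in> cball \<xi> r \<Longrightarrow> lnorm w F (\<phi> \<mu>) \<le> K" and "dist \<mu> \<xi> < r"
  shows "lnorm w F (\<lambda>v. \<phi> \<mu> v - (\<Sum>j<n. (\<mu> - \<xi>) ^ j * ((deriv ^^ j) (\<lambda>\<nu>. \<phi> \<nu> v) \<xi> / fact j)))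
    \<le> K * ((dist \<mu> \<xi> / r) ^ n / (1 - dist \<mu> \<xi> / r))"
proof -
  define c where "c = (\<lambda>v. \<phi> \<mu> v - (\<Sum>j<n. (\<mu> - \<xi>) ^ j * ((deriv ^^ j) (\<lambda>\<nu>. \<phi> \<nu> v) \<xi> / fact j)))"
  \<comment> \<open>The vector \<open>c\<close> is frozen at the one point \<open>\<mu>\<close>;
    therefore \<open>h\<close> is holomorphic in \<open>\<nu>\<close> although conjugates of
    \<open>c\<close> occur in it.\<close>
  define h where "h = (\<lambda>\<nu>. \<Sum>v\<in>F. cnj (c v) / of_real (w v) * \<phi> \<nu> v)"
  have \<xi>: "\<xi> \<in> S" using assms(2,3) by auto
  have hh: "h holomorphic_on S"
    unfolding h_def by (intro holomorphic_intros hol)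
  have hd: "(deriv ^^ j) h \<xi> = (\<Sum>v\<in>F. cnj (c v) / of_real (w v) * (deriv ^^ j) (\<lambda>\<nu>. \<phi> \<nu> v) \<xi>)" for j
    unfolding h_def using F(1) hol
  proof (induction F rule: finite_induct)
    case empty
    show ?case by (simp add: higher_deriv_const)
  next
    case (insert x F)
    have "(deriv ^^ j) (\<lambda>\<nu>. cnj (c x) / of_real (w x) * \<phi> \<nu> x + (\<Sum>v\<in>F. cnj (c v) / of_real (w v) * \<phi> \<nu> v)) \<xi>
      = (deriv ^^ j) (\<lambda>\<nu>. cnj (c x) / of_real (w x) * \<phi> \<nu> x) \<xi>
        + (deriv ^^ j) (\<lambda>\<nu>. \<Sum>v\<in>F. cnj (c v) / of_real (w v) * \<phi> \<nu> v) \<xi>"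
      by (rule higher_deriv_add[OF _ _ assms(1) \<xi>]) (intro holomorphic_intros insert.prems; simp)+
    also have "(deriv ^^ j) (\<lambda>\<nu>. cnj (c x) / of_real (w x) * \<phi> \<nu> x) \<xi>
      = cnj (c x) / of_real (w x) * (deriv ^^ j) (\<lambda>\<nu>. \<phi> \<nu> x) \<xi>"
      by (rule higher_deriv_cmult[OF _ \<xi> assms(1)]) (simp add: insert.prems)
    finally show ?case
      using insert by simp
  qed
  have hb: "cmod (h \<nu>) \<le> lnorm w F c * K" if "\<nu> \<in> cball \<xi> r" for \<nu>
  proof -
    have "cmod (h \<nu>) \<le> lnorm w F c * lnorm w F (\<phi> \<nu>)"
      using lnorm_inner_le[OF F, where c = c and f = "\<phi> \<nu>"] by (simp add: h_def)
    also have "\<dots> \<le> lnorm w F c * K" by (intro mult_left_mono K that lnorm_nonneg)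
    finally show ?thesis .
  qed
  have "h \<mu> - (\<Sum>j<n. (\<mu> - \<xi>) ^ j * ((deriv ^^ j) h \<xi> / fact j))
    = (\<Sum>v\<in>F. cnj (c v) / of_real (w v) * c v)"
  proof -
    define k where "k = (\<lambda>v. cnj (c v) / complex_of_real (w v))"
    define e where "e = (\<lambda>j v. (\<mu> - \<xi>) ^ j * ((deriv ^^ j) (\<lambda>\<nu>. \<phi> \<nu> v) \<xi> / fact j))"
    have "(\<Sum>j<n. (\<mu> - \<xi>) ^ j * ((deriv ^^ j) h \<xi> / fact j)) = (\<Sum>j<n. \<Sum>v\<in>F. k v * e j v)"
      unfolding hd by (simp add: k_def e_def sum_divide_distrib sum_distrib_left mult_ac)
    also have "\<dots> = (\<Sum>v\<in>F. k v * (\<Sum>j<n. e j v))"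
      by (subst sum.swap) (simp add: sum_distrib_left)
    finally have "h \<mu> - (\<Sum>j<n. (\<mu> - \<xi>) ^ j * ((deriv ^^ j) h \<xi> / fact j))
      = (\<Sum>v\<in>F. k v * (\<phi> \<mu> v - (\<Sum>j<n. e j v)))"
      by (simp add: h_def k_def right_diff_distrib sum_subtractf)
    then show ?thesis by (simp add: c_def e_def k_def)
  qed
  also have "\<dots> = of_real ((lnorm w F c)\<^sup>2)"
    using lnorm_inner_self[OF F] by simp
  finally have "(lnorm w F c)\<^sup>2 = cmod (h \<mu> - (\<Sum>j<n. (\<mu> - \<xi>) ^ j * ((deriv ^^ j) h \<xi> / fact j)))"
    by (simp del: of_real_power)
  also have "\<dots> \<le> lnorm w F c * K * ((dist \<mu> \<xi> / r) ^ n / (1 - dist \<mu> \<xi> / r))"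
    by (rule taylor_remainder_le[OF assms(1,2) hh assms(3) hb assms(8)])
  finally have *: "lnorm w F c * lnorm w F c \<le> lnorm w F c * (K * ((dist \<mu> \<xi> / r) ^ n / (1 - dist \<mu> \<xi> / r)))"
    by (simp add: power2_eq_square mult_ac)
  \<comment> \<open>What remains is to cancel a factor \<open>lnorm w F c\<close>. If it vanishes,
    the claim reduces to nonnegativity of the bound, which is where the sign of \<open>K\<close>
    enters.\<close>
  have "0 \<le> K" using K[of \<xi>] lnorm_nonneg[of w F "\<phi> \<xi>"] assms(3) by (meson centre_in_cball less_imp_le order_trans)
  then have "0 \<le> K * ((dist \<mu> \<xi> / r) ^ n / (1 - dist \<mu> \<xi> / r))"
    using assms(3,8) by (intro mult_nonneg_nonneg divide_nonneg_nonneg) auto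
  then show ?thesis
    using * lnorm_nonneg[of w F c] unfolding c_def[symmetric]
    by (cases "lnorm w F c = 0") (simp, metis mult_le_cancel_left_pos order_le_less)
qed


section \<open>Holomorphic families of operators\<close>

text \<open>The constant is an explicit argument because one bound has to serve all parameters
  \<open>\<mu>\<close> of a neighbourhood.\<close>

definition bop :: "'v fun_space \<Rightarrow> 'v fun_space \<Rightarrow> 'v operator \<Rightarrow> real \<Rightarrow> bool" where
  "bop X Y T B \<longleftrightarrow>
     (\<forall>f \<in> elems X. T f \<in> elems Y \<and> fnorm Y (T f) \<le> B * fnorm X f) \<and>
     (\<forall>f \<in> elems X. \<forall>g \<in> elems X. T (\<lambda>v. f v + g v) = (\<lambda>v. T f v + T g v)) \<and>
     (\<forall>f \<in> elems X. \<forall>c. T (\<lambda>v. c * f v) = (\<lambda>v. c * T f v))"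

lemma bounded_operator_iff_bop: "bounded_operator X Y T \<longleftrightarrow> (\<exists>B. bop X Y T B)"
  unfolding bounded_operator_def bop_def by blast

lemma bopD:
  assumes "bop X Y T B"
  shows "f \<in> elems X \<Longrightarrow> T f \<in> elems Y"
    and "f \<in> elems X \<Longrightarrow> fnorm Y (T f) \<le> B * fnorm X f"
    and "f \<in> elems X \<Longrightarrow> g \<in> elems X \<Longrightarrow> T (\<lambda>v. f v + g v) = (\<lambda>v. T f v + T g v)"
    and "f \<in> elems X \<Longrightarrow> T (\<lambda>v. c * f v) = (\<lambda>v. c * T f v)"
  using assms unfolding bop_def by blast+

text \<open>Spanning families arise with indices that may repeat a vector, while
  \<open>finite_rank\<close> sums over a set of vectors; the coefficients of equal vectors are added
  up.\<close>

lemma finite_rankI: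
  assumes "finite I" "\<And>f. f \<in> elems X \<Longrightarrow> \<exists>c. T f = (\<lambda>v. \<Sum>i\<in>I. c i * b i v)"
  shows "finite_rank X T"
  unfolding finite_rank_def
proof (intro exI[of _ "b ` I"] conjI ballI)
  fix f assume "f \<in> elems X"
  then obtain c where c: "T f = (\<lambda>v. \<Sum>i\<in>I. c i * b i v)" using assms(2) by blast
  have "T f = (\<lambda>v. \<Sum>y\<in>b ` I. (\<Sum>i\<in>{i\<in>I. b i = y}. c i) * y v)"
  proof
    fix v
    have "T f v = (\<Sum>y\<in>b ` I. \<Sum>i\<in>{i\<in>I. b i = y}. c i * b i v)"
      unfolding c by (rule sum.image_gen[OF assms(1)])
    also have "\<dots> = (\<Sum>y\<in>b ` I. (\<Sum>i\<in>{i\<in>I. b i = y}. c i) * y v)"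
      by (intro sum.cong refl) (auto simp: sum_distrib_right)
    finally show "T f v = (\<Sum>y\<in>b ` I. (\<Sum>i\<in>{i\<in>I. b i = y}. c i) * y v)" .
  qed
  then show "\<exists>c. T f = (\<lambda>v. \<Sum>y\<in>b ` I. c y * y v)"
    by (rule exI[of _ "\<lambda>y. \<Sum>i\<in>{i\<in>I. b i = y}. c i"])
qed (use assms in simp)

locale weighted_spaces = X: weighted_space V w + Y: weighted_space V w'
  for V :: "'v set" and w w' :: "'v \<Rightarrow> real"
begin

abbreviation "X \<equiv> wsp V w"
abbreviation "Y \<equiv> wsp V w'"

lemma opnorm_le:
  assumes "0 \<le> K" "\<And>f. f \<in> elems X \<Longrightarrow> fnorm Y (T f) \<le> K * fnorm X f"
  shows "opnorm X Y T \<le> K"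
  unfolding opnorm_def
proof (rule cSup_least)
  show "{fnorm Y (T f) |f. f \<in> elems X \<and> fnorm X f \<le> 1} \<noteq> {}"
    using X.elems_zero X.fnorm_zero by force
  fix x assume "x \<in> {fnorm Y (T f) |f. f \<in> elems X \<and> fnorm X f \<le> 1}"
  then obtain f where f: "f \<in> elems X" "fnorm X f \<le> 1" "x = fnorm Y (T f)" by blast
  have "x \<le> K * fnorm X f" using assms(2) f by simp
  also have "\<dots> \<le> K * 1" using f assms(1) by (intro mult_left_mono) auto
  finally show "x \<le> K" by simp
qed

lemma opnorm_bdd:
  assumes "0 \<le> K" "\<And>f. f \<in> elems X \<Longrightarrow> fnorm Y (T f) \<le> K * fnorm X f"
  shows "bdd_above {fnorm Y (T f) |f. f \<in> elems X \<and> fnorm X f \<le> 1}"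
proof (rule bdd_aboveI[where M = K])
  fix x assume "x \<in> {fnorm Y (T f) |f. f \<in> elems X \<and> fnorm X f \<le> 1}"
  then obtain f where f: "f \<in> elems X" "fnorm X f \<le> 1" "x = fnorm Y (T f)" by blast
  have "x \<le> K * fnorm X f" using assms(2) f by simp
  also have "\<dots> \<le> K * 1" using f assms(1) by (intro mult_left_mono) auto
  finally show "x \<le> K" by simp
qed

text \<open>The supremum of an unbounded set of reals is unspecified, so even nonnegativity requires
  a bound for \<open>T\<close>; given one, the zero function provides a member of the set.\<close>

lemma opnorm_nonneg:
  assumes "0 \<le> K" "\<And>f. f \<in> elems X \<Longrightarrow> fnorm Y (T f) \<le> K * fnorm X f"
  shows "0 \<le> opnorm X Y T"
proof -
  have "fnorm Y (T (\<lambda>_. 0)) \<in> {fnorm Y (T f) |f. f \<in> elems X \<and> fnorm X f \<le> 1}"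
    using X.elems_zero X.fnorm_zero by force
  then have "fnorm Y (T (\<lambda>_. 0)) \<le> opnorm X Y T"
    unfolding opnorm_def by (rule cSup_upper[OF _ opnorm_bdd[OF assms]])
  then show ?thesis using Y.fnorm_nonneg order_trans by blast
qed

lemma bop_nonneg:
  assumes "bop X Y T B"
  shows "bop X Y T \<bar>B\<bar>"
proof -
  have "fnorm Y (T f) \<le> \<bar>B\<bar> * fnorm X f" if "f \<in> elems X" for f
    using bopD(2)[OF assms that] X.fnorm_nonneg[of f]
    by (meson abs_ge_self mult_right_mono order_trans)
  then show ?thesis using assms unfolding bop_def by blast
qed

lemma fnorm_le_opnorm:
  assumes "bop X Y T B" "f \<in> elems X"
  shows "fnorm Y (T f) \<le> opnorm X Y T * fnorm X f"
proof (cases "fnorm X f = 0")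
  \<comment> \<open>A function of norm zero cannot be normalised, but then the bound
    \<open>B * 0\<close> settles the claim.\<close>
  case True
  then show ?thesis using bopD(2)[OF assms] by simp
next
  case False
  define n where "n = fnorm X f"
  have n: "0 < n" using False X.fnorm_nonneg[of f] by (simp add: n_def)
  define g where "g = (\<lambda>v. of_real (1 / n) * f v)"
  have g: "g \<in> elems X" "fnorm X g = 1"
    using X.elems_scale[OF assms(2), of "of_real (1 / n)"] n unfolding g_def
    by (auto simp: n_def norm_divide)
  have "fnorm Y (T g) \<le> opnorm X Y T"
    unfolding opnorm_def
    by (rule cSup_upper[OF _ opnorm_bdd[of "\<bar>B\<bar>"]])
      (use g bop_nonneg[OF assms(1)] bopD(2) in auto)
  moreover have "fnorm Y (T g) = fnorm Y (T f) / n"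
    unfolding g_def bopD(4)[OF assms]
    using Y.elems_scale(2)[OF bopD(1)[OF assms], of "of_real (1 / n)"] n by (simp add: norm_divide)
  ultimately show ?thesis using n by (simp add: n_def field_simps)
qed

lemma opnorm_bop: "bop X Y T B \<Longrightarrow> 0 \<le> opnorm X Y T"
  using opnorm_nonneg[of "\<bar>B\<bar>" T] bop_nonneg bopD(2) by (metis abs_ge_zero)

lemma opnorm_bop_bound: "bop X Y T B \<Longrightarrow> bop X Y T (opnorm X Y T)"
  using fnorm_le_opnorm[of T B] unfolding bop_def by blast

lemma bop_cong:
  assumes "bop X Y T B" "\<And>f. f \<in> elems X \<Longrightarrow> T' f = T f"
  shows "bop X Y T' B"
  using assms X.elems_add(1) X.elems_scale(1) unfolding bop_def by simp

lemma bop_add: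
  assumes "bop X Y T B" "bop X Y T' B'"
  shows "bop X Y (\<lambda>f v. T f v + T' f v) (B + B')"
  unfolding bop_def
proof (intro conjI ballI allI)
  fix f assume f: "f \<in> elems X"
  note mem = bopD(1)[OF assms(1) f] bopD(1)[OF assms(2) f]
  show "(\<lambda>v. T f v + T' f v) \<in> elems Y" by (rule Y.elems_add(1)[OF mem])
  show "fnorm Y (\<lambda>v. T f v + T' f v) \<le> (B + B') * fnorm X f"
    using Y.elems_add(2)[OF mem] bopD(2)[OF assms(1) f] bopD(2)[OF assms(2) f]
    by (simp add: distrib_right)
  show "(\<lambda>v. T (\<lambda>v. c * f v) v + T' (\<lambda>v. c * f v) v) = (\<lambda>v. c * (T f v + T' f v))" for c
    using bopD(4)[OF assms(1) f, of c] bopD(4)[OF assms(2) f, of c] by (simp add: distrib_left)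
  fix g assume g: "g \<in> elems X"
  show "(\<lambda>v. T (\<lambda>v. f v + g v) v + T' (\<lambda>v. f v + g v) v) = (\<lambda>v. T f v + T' f v + (T g v + T' g v))"
    using bopD(3)[OF assms(1) f g] bopD(3)[OF assms(2) f g] by (simp add: add_ac)
qed

lemma bop_scale:
  assumes "bop X Y T B"
  shows "bop X Y (\<lambda>f v. c * T f v) (cmod c * B)"
  unfolding bop_def
proof (intro conjI ballI allI)
  fix f assume f: "f \<in> elems X"
  show "(\<lambda>v. c * T f v) \<in> elems Y" by (rule Y.elems_scale(1)[OF bopD(1)[OF assms f]])
  show "fnorm Y (\<lambda>v. c * T f v) \<le> cmod c * B * fnorm X f"
    using Y.elems_scale(2)[OF bopD(1)[OF assms f], of c] bopD(2)[OF assms f]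
    by (simp add: mult.assoc mult_left_mono)
  show "(\<lambda>v. c * T (\<lambda>v. d * f v) v) = (\<lambda>v. d * (c * T f v))" for d
    using bopD(4)[OF assms f, of d] by (simp add: mult_ac)
  fix g assume g: "g \<in> elems X"
  show "(\<lambda>v. c * T (\<lambda>v. f v + g v) v) = (\<lambda>v. c * T f v + c * T g v)"
    using bopD(3)[OF assms f g] by (simp add: distrib_left)
qed

lemma bop_mono:
  assumes "bop X Y T B" "B \<le> B'"
  shows "bop X Y T B'"
proof -
  have "fnorm Y (T f) \<le> B' * fnorm X f" if "f \<in> elems X" for f
    using bopD(2)[OF assms(1) that] X.fnorm_nonneg[of f] assms(2)
    by (meson mult_right_mono order_trans)
  then show ?thesis using assms unfolding bop_def by blast
qed

lemma bop_zero: "bop X Y (\<lambda>f v. 0) 0"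
  unfolding bop_def using Y.elems_zero Y.fnorm_zero by simp

lemma bop_sum:
  assumes "finite I" "\<And>i. i \<in> I \<Longrightarrow> bop X Y (T i) (B i)"
  shows "bop X Y (\<lambda>f v. \<Sum>i\<in>I. T i f v) (\<Sum>i\<in>I. B i)"
  using assms
proof (induction I rule: finite_induct)
  case empty
  show ?case using bop_zero by simp
next
  case (insert x I)
  then show ?case using bop_add[of "T x" "B x" "\<lambda>f v. \<Sum>i\<in>I. T i f v" "\<Sum>i\<in>I. B i"] by simp
qed

lemma bop_rank_one:
  assumes "\<And>f. f \<in> elems X \<Longrightarrow> cmod (l f) \<le> C * fnorm X f" "0 \<le> C"
    and "\<And>f g. f \<in> elems X \<Longrightarrow> g \<in> elems X \<Longrightarrow> l (\<lambda>v. f v + g v) = l f + l g"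
    and "\<And>f c. f \<in> elems X \<Longrightarrow> l (\<lambda>v. c * f v) = c * l f"
    and "\<phi> \<in> elems Y" "fnorm Y \<phi> \<le> D"
  shows "bop X Y (\<lambda>f v. l f * \<phi> v) (C * D)"
  unfolding bop_def
proof (intro conjI ballI allI)
  fix f assume f: "f \<in> elems X"
  show "(\<lambda>v. l f * \<phi> v) \<in> elems Y" by (rule Y.elems_scale(1)[OF assms(5)])
  have "fnorm Y (\<lambda>v. l f * \<phi> v) = cmod (l f) * fnorm Y \<phi>" by (rule Y.elems_scale(2)[OF assms(5)])
  also have "\<dots> \<le> C * fnorm X f * D"
    using assms(1)[OF f] assms(2,6) X.fnorm_nonneg Y.fnorm_nonneg by (intro mult_mono) auto
  finally show "fnorm Y (\<lambda>v. l f * \<phi> v) \<le> C * D * fnorm X f" by (simp add: mult_ac)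
  show "(\<lambda>v. l (\<lambda>v. c * f v) * \<phi> v) = (\<lambda>v. c * (l f * \<phi> v))" for c
    using assms(4)[OF f] by (simp add: mult_ac)
  fix g assume g: "g \<in> elems X"
  show "(\<lambda>v. l (\<lambda>v. f v + g v) * \<phi> v) = (\<lambda>v. l f * \<phi> v + l g * \<phi> v)"
    using assms(3)[OF f g] by (simp add: distrib_right)
qed

end

text \<open>Coordinatewise holomorphy together with one bound \<open>B\<close> on all of
  \<open>S\<close> is the whole input; differentiability and expansions in operator norm are derived
  from it.\<close>

locale holomorphic_operators = weighted_spaces V w w'
  for V :: "'v set" and w w' :: "'v \<Rightarrow> real" +
  fixes F :: "complex \<Rightarrow> 'v operator" and S :: "complex set" and B :: real and \<xi> :: complex and r :: real
  assumes S: "open S" "cball \<xi> r \<subseteq> S" "0 < r"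
    and op: "\<mu> \<in> S \<Longrightarrow> bop (wsp V w) (wsp V w') (F \<mu>) B"
    and hol: "f \<in> elems (wsp V w) \<Longrightarrow> (\<lambda>\<mu>. F \<mu> f v) holomorphic_on S"
begin

definition coeff :: "nat \<Rightarrow> 'v operator" where
  "coeff j f v = (deriv ^^ j) (\<lambda>\<mu>. F \<mu> f v) \<xi> / fact j"

lemma center_in: "\<xi> \<in> S"
  using S by auto

lemma remainder:
  assumes f: "f \<in> elems X" and "dist \<mu> \<xi> < r"
  shows "(\<lambda>v. F \<mu> f v - (\<Sum>j<n. (\<mu> - \<xi>) ^ j * coeff j f v)) \<in> elems Y"
    and "fnorm Y (\<lambda>v. F \<mu> f v - (\<Sum>j<n. (\<mu> - \<xi>) ^ j * coeff j f v))
      \<le> B * ((dist \<mu> \<xi> / r) ^ n / (1 - dist \<mu> \<xi> / r)) * fnorm X f"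
proof -
  have \<mu>: "\<mu> \<in> S" using assms(2) S(2) by (auto simp: dist_commute)
  have *: "lnorm w' F' (\<lambda>v. F \<mu> f v - (\<Sum>j<n. (\<mu> - \<xi>) ^ j * coeff j f v))
    \<le> B * fnorm X f * ((dist \<mu> \<xi> / r) ^ n / (1 - dist \<mu> \<xi> / r))"
    if F': "finite F'" "F' \<subseteq> V" for F'
    unfolding coeff_def
  proof (rule taylor_remainder_lnorm_le[OF S, where \<phi> = "\<lambda>\<mu>. F \<mu> f"])
    show "lnorm w' F' (F \<mu> f) \<le> B * fnorm X f" if "\<mu> \<in> cball \<xi> r" for \<mu>
      using Y.lnorm_le_fnorm[OF bopD(1)[OF op f] F'] bopD(2)[OF op f] that S(2)
      by (meson order_trans subsetD)
  qed (use hol f F' Y.weight_pos assms(2) in auto)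
  have off: "F \<mu> f v - (\<Sum>j<n. (\<mu> - \<xi>) ^ j * coeff j f v) = 0" if "v \<notin> V" for v
  proof -
    have z: "F \<mu> f v = 0" if "\<mu> \<in> S" for \<mu>
      using Y.elems_off[OF bopD(1)[OF op f] \<open>v \<notin> V\<close>] that .
    have "(deriv ^^ j) (\<lambda>\<mu>. F \<mu> f v) \<xi> = (deriv ^^ j) (\<lambda>\<mu>. 0) \<xi>" for j
      by (rule higher_deriv_transform_within_open[OF hol[OF f] _ S(1) center_in]) (auto simp: z)
    then have "coeff j f v = 0" for j by (simp add: coeff_def)
    then show ?thesis using z[OF \<mu>] by simp
  qed
  show "(\<lambda>v. F \<mu> f v - (\<Sum>j<n. (\<mu> - \<xi>) ^ j * coeff j f v)) \<in> elems Y"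
    by (rule Y.elems_bound(1)[OF off *])
  show "fnorm Y (\<lambda>v. F \<mu> f v - (\<Sum>j<n. (\<mu> - \<xi>) ^ j * coeff j f v))
      \<le> B * ((dist \<mu> \<xi> / r) ^ n / (1 - dist \<mu> \<xi> / r)) * fnorm X f"
    using Y.elems_bound(2)[OF off *] by (simp add: mult_ac)
qed

lemma coeff_0: "coeff 0 f = F \<xi> f"
  by (simp add: coeff_def fun_eq_iff)

text \<open>Two consecutive Taylor remainders at one fixed point different from \<open>\<xi>\<close>
  differ by a nonzero multiple of the coefficient, and both remainders are already bounded.
  Linearity is inherited from \<open>F\<close> by differentiating coordinatewise.\<close>

lemma coeff_bounded: "bounded_operator X Y (coeff j)"
proof -
  define \<mu> where "\<mu> = \<xi> + of_real (r / 2)"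
  define R where "R = (\<lambda>n f v. F \<mu> f v - (\<Sum>j<n. (\<mu> - \<xi>) ^ j * coeff j f v))"
  define K where "K = (\<lambda>n. B * ((dist \<mu> \<xi> / r) ^ n / (1 - dist \<mu> \<xi> / r)))"
  have d: "dist \<mu> \<xi> < r" and ne: "\<mu> \<noteq> \<xi>" using S(3) by (auto simp: \<mu>_def dist_norm)
  have R: "R n f \<in> elems Y" "fnorm Y (R n f) \<le> K n * fnorm X f" if "f \<in> elems X" for n f
    using remainder[OF that d, of n] by (simp_all add: R_def K_def)
  have ce: "coeff j f = (\<lambda>v. inverse ((\<mu> - \<xi>) ^ j) * (R j f v - R (Suc j) f v))" for f
    using ne by (simp add: R_def fun_eq_iff)
  define C where "C = cmod (inverse ((\<mu> - \<xi>) ^ j)) * (K j + K (Suc j))"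
  have "bop X Y (coeff j) C"
    unfolding bop_def
  proof (intro conjI ballI allI)
    fix f assume f: "f \<in> elems X"
    have dm: "(\<lambda>v. R j f v - R (Suc j) f v) \<in> elems Y"
      "fnorm Y (\<lambda>v. R j f v - R (Suc j) f v) \<le> fnorm Y (R j f) + fnorm Y (R (Suc j) f)"
      using Y.elems_diff[OF R(1)[OF f] R(1)[OF f], of j "Suc j"] .
    show "coeff j f \<in> elems Y" unfolding ce by (rule Y.elems_scale(1)[OF dm(1)])
    have "fnorm Y (coeff j f) = cmod (inverse ((\<mu> - \<xi>) ^ j)) * fnorm Y (\<lambda>v. R j f v - R (Suc j) f v)"
      unfolding ce by (rule Y.elems_scale(2)[OF dm(1)])
    also have "\<dots> \<le> cmod (inverse ((\<mu> - \<xi>) ^ j)) * ((K j + K (Suc j)) * fnorm X f)"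
      using dm(2) R(2)[OF f, of j] R(2)[OF f, of "Suc j"]
      by (intro mult_left_mono) (auto simp: distrib_right)
    finally show "fnorm Y (coeff j f) \<le> C * fnorm X f" by (simp add: C_def mult.assoc)
    show "coeff j (\<lambda>v. c * f v) = (\<lambda>v. c * coeff j f v)" for c
    proof
      fix v
      have "(deriv ^^ j) (\<lambda>\<mu>. F \<mu> (\<lambda>v. c * f v) v) \<xi> = (deriv ^^ j) (\<lambda>\<mu>. c * F \<mu> f v) \<xi>"
        by (rule higher_deriv_transform_within_open[OF hol _ S(1) center_in])
          (use bopD(4)[OF op f] X.elems_scale(1)[OF f] hol[OF f] in \<open>auto intro!: holomorphic_intros\<close>)
      also have "\<dots> = c * (deriv ^^ j) (\<lambda>\<mu>. F \<mu> f v) \<xi>"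
        by (rule higher_deriv_cmult[OF hol[OF f] center_in S(1)])
      finally show "coeff j (\<lambda>v. c * f v) v = c * coeff j f v" by (simp add: coeff_def)
    qed
    fix g assume g: "g \<in> elems X"
    show "coeff j (\<lambda>v. f v + g v) = (\<lambda>v. coeff j f v + coeff j g v)"
    proof
      fix v
      have "(deriv ^^ j) (\<lambda>\<mu>. F \<mu> (\<lambda>v. f v + g v) v) \<xi> = (deriv ^^ j) (\<lambda>\<mu>. F \<mu> f v + F \<mu> g v) \<xi>"
        by (rule higher_deriv_transform_within_open[OF hol _ S(1) center_in])
          (use bopD(3)[OF op f g] X.elems_add(1)[OF f g] hol[OF f] hol[OF g] in
            \<open>auto intro!: holomorphic_intros\<close>)
      also have "\<dots> = (deriv ^^ j) (\<lambda>\<mu>. F \<mu> f v) \<xi> + (deriv ^^ j) (\<lambda>\<mu>. F \<mu> g v) \<xi>"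
        by (rule higher_deriv_add[OF hol[OF f] hol[OF g] S(1) center_in])
      finally show "coeff j (\<lambda>v. f v + g v) v = coeff j f v + coeff j g v"
        by (simp add: coeff_def add_divide_distrib)
    qed
  qed
  then show ?thesis by (auto simp: bounded_operator_iff_bop)
qed

text \<open>The remainder of order two divided by \<open>\<mu> - \<xi>\<close> keeps one factor
  \<open>dist \<mu> \<xi>\<close>, uniformly on the unit ball. The derivative is the first Taylor
  coefficient.\<close>

lemma difference_quotient:
  "((\<lambda>\<mu>. opnorm X Y (\<lambda>f v. (F \<mu> f v - F \<xi> f v) / (\<mu> - \<xi>) - coeff 1 f v)) \<longlongrightarrow> 0) (at \<xi> within A)"
proof (rule tendsto_sandwich[where f = "\<lambda>_. 0"])
  define g where "g = (\<lambda>\<mu>. \<bar>B\<bar> * (dist \<mu> \<xi> / r\<^sup>2 / (1 - dist \<mu> \<xi> / r)))"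
  have ev: "\<forall>\<^sub>F \<mu> in at \<xi> within A. dist \<mu> \<xi> < r \<and> \<mu> \<noteq> \<xi>"
    unfolding eventually_at using S(3) by blast
  have bd: "0 \<le> g \<mu> \<and> (\<forall>f\<in>elems X. fnorm Y (\<lambda>v. (F \<mu> f v - F \<xi> f v) / (\<mu> - \<xi>) - coeff 1 f v) \<le> g \<mu> * fnorm X f)"
    if \<mu>: "dist \<mu> \<xi> < r \<and> \<mu> \<noteq> \<xi>" for \<mu>
  proof (intro conjI ballI)
    show "0 \<le> g \<mu>" unfolding g_def using \<mu> S(3)
      by (intro mult_nonneg_nonneg divide_nonneg_nonneg) auto
    fix f assume f: "f \<in> elems X"
    define h where "h = (\<lambda>v. F \<mu> f v - (\<Sum>j<2. (\<mu> - \<xi>) ^ j * coeff j f v))"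
    have h: "h \<in> elems Y" "fnorm Y h \<le> B * ((dist \<mu> \<xi> / r) ^ 2 / (1 - dist \<mu> \<xi> / r)) * fnorm X f"
      using remainder[OF f, of \<mu> 2] \<mu> by (auto simp: h_def)
    have "(\<lambda>v. (F \<mu> f v - F \<xi> f v) / (\<mu> - \<xi>) - coeff 1 f v) = (\<lambda>v. inverse (\<mu> - \<xi>) * h v)"
      using \<mu> by (simp add: h_def fun_eq_iff numeral_2_eq_2 coeff_0 field_simps)
    then have "fnorm Y (\<lambda>v. (F \<mu> f v - F \<xi> f v) / (\<mu> - \<xi>) - coeff 1 f v) = cmod (inverse (\<mu> - \<xi>)) * fnorm Y h"
      using Y.elems_scale(2)[OF h(1)] by simp
    also have "\<dots> \<le> cmod (inverse (\<mu> - \<xi>)) * (\<bar>B\<bar> * ((dist \<mu> \<xi> / r) ^ 2 / (1 - dist \<mu> \<xi> / r)) * fnorm X f)"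
    proof (intro mult_left_mono order_trans[OF h(2)] mult_right_mono)
      show "0 \<le> (dist \<mu> \<xi> / r)\<^sup>2 / (1 - dist \<mu> \<xi> / r)" using \<mu> S(3) by (intro divide_nonneg_nonneg) auto
    qed (auto simp: X.fnorm_nonneg)
    also have "\<dots> = (inverse (dist \<mu> \<xi>) * (dist \<mu> \<xi>)\<^sup>2) * (\<bar>B\<bar> * (1 / r\<^sup>2 / (1 - dist \<mu> \<xi> / r))) * fnorm X f"
      by (simp add: norm_inverse dist_norm power_mult_distrib power_inverse mult_ac divide_inverse)
    also have "inverse (dist \<mu> \<xi>) * (dist \<mu> \<xi>)\<^sup>2 = dist \<mu> \<xi>" using \<mu> by (simp add: power2_eq_square)
    finally show "fnorm Y (\<lambda>v. (F \<mu> f v - F \<xi> f v) / (\<mu> - \<xi>) - coeff 1 f v) \<le> g \<mu> * fnorm X f"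
      by (simp add: g_def mult_ac)
  qed
  show "\<forall>\<^sub>F \<mu> in at \<xi> within A. 0 \<le> opnorm X Y (\<lambda>f v. (F \<mu> f v - F \<xi> f v) / (\<mu> - \<xi>) - coeff 1 f v)"
    using ev by eventually_elim (rule opnorm_nonneg; use bd in blast)
  show "\<forall>\<^sub>F \<mu> in at \<xi> within A. opnorm X Y (\<lambda>f v. (F \<mu> f v - F \<xi> f v) / (\<mu> - \<xi>) - coeff 1 f v) \<le> g \<mu>"
    using ev by eventually_elim (rule opnorm_le; use bd in blast)
  have "(g \<longlongrightarrow> \<bar>B\<bar> * (dist \<xi> \<xi> / r\<^sup>2 / (1 - dist \<xi> \<xi> / r))) (at \<xi> within A)"
    unfolding g_def by (intro tendsto_intros) (use S(3) in auto)
  then show "(g \<longlongrightarrow> 0) (at \<xi> within A)" by simp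
qed simp

text \<open>The pole order is read off the first coefficient of \<open>F = (\<mu> - \<xi>)\<^sup>k R\<close> that does not vanish.\<close>

lemma laurent:
  assumes R: "\<And>\<mu> f. \<mu> \<in> \<Omega> \<Longrightarrow> dist \<mu> \<xi> < r \<Longrightarrow> \<mu> \<noteq> \<xi> \<Longrightarrow> f \<in> elems X \<Longrightarrow>
      F \<mu> f = (\<lambda>v. (\<mu> - \<xi>) ^ k * R \<mu> f v)"
    and rank: "\<And>j. j < k \<Longrightarrow> finite_rank X (coeff j)"
    and removable: "\<And>f. (\<And>j g. j < k \<Longrightarrow> g \<in> elems X \<Longrightarrow> coeff j g = (\<lambda>_. 0)) \<Longrightarrow> f \<in> elems X \<Longrightarrow>
      R \<xi> f = coeff k f"
  shows "\<exists>(J :: nat) (A :: int \<Rightarrow> 'v operator) r.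
        r > 0 \<and>
        (\<forall>j \<ge> - int J. bounded_operator X Y (A j)) \<and>
        (\<forall>j. - int J \<le> j \<and> j < 0 \<longrightarrow> finite_rank X (A j)) \<and>
        (J = 0 \<or> (\<exists>f \<in> elems X. A (- int J) f \<noteq> (\<lambda>_. 0))) \<and>
        (\<forall>\<mu>\<in>\<Omega>. dist \<mu> \<xi> < r \<and> (\<mu> \<noteq> \<xi> \<or> J = 0) \<longrightarrow>
           bounded_operator X Y (R \<mu>) \<and>
           (\<lambda>n. opnorm X Y (\<lambda>f v. R \<mu> f v -
              (\<Sum>j\<in>{- int J..int n}. (\<mu> - \<xi>) powi j * A j f v))) \<longlonglongrightarrow> 0)"
proof -
  define nz where "nz = (\<lambda>j. \<exists>f \<in> elems X. coeff j f \<noteq> (\<lambda>_. 0))"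
  \<comment> \<open>The disjunct \<open>j = k\<close> guarantees a minimum and caps it:
    \<open>J = k - j0\<close> is zero exactly if all coefficients below order \<open>k\<close>
    vanish.\<close>
  define j0 where "j0 = (LEAST j. j = k \<or> nz j)"
  have j0: "j0 = k \<or> nz j0" unfolding j0_def by (rule LeastI[of _ k]) simp
  have j0k: "j0 \<le> k" unfolding j0_def by (rule Least_le) simp
  have below: "coeff j f = (\<lambda>_. 0)" if "j < j0" "f \<in> elems X" for j f
    using not_less_Least[of j "\<lambda>j. j = k \<or> nz j"] that by (auto simp: j0_def nz_def)
  define J where "J = k - j0"
  \<comment> \<open>Division by \<open>(\<mu> - \<xi>) ^ k\<close> shifts the index by
    \<open>k\<close>. Since \<open>J \<le> k\<close>, \<open>nat\<close> truncates nothing in the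
    range that matters.\<close>
  define A where "A = (\<lambda>i. coeff (nat (i + int k)))"
  have kJ: "int k - int J = int j0" using j0k by (simp add: J_def)
  have bA: "bounded_operator X Y (A j)" for j by (simp add: A_def coeff_bounded)
  \<comment> \<open>Coefficients below \<open>j0\<close> vanish, so a Laurent partial sum up to
    \<open>n\<close> is the Taylor partial sum through order \<open>n + k\<close>, divided by the
    power.\<close>
  have sumeq: "(\<Sum>j\<in>{- int J..int n}. (\<mu> - \<xi>) powi j * A j f v)
    = inverse ((\<mu> - \<xi>) ^ k) * (\<Sum>j<Suc (n + k). (\<mu> - \<xi>) ^ j * coeff j f v)"
    if "\<mu> \<noteq> \<xi>" "f \<in> elems X" for \<mu> f v n
  proof -
    have "(\<Sum>j\<in>{- int J..int n}. (\<mu> - \<xi>) powi j * A j f v)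
      = (\<Sum>j\<in>{j0..n + k}. inverse ((\<mu> - \<xi>) ^ k) * ((\<mu> - \<xi>) ^ j * coeff j f v))"
    proof (rule sum.reindex_bij_witness[where i = "\<lambda>j. int j - int k" and j = "\<lambda>i. nat (i + int k)"], goal_cases)
      case (5 i)
      then have i: "i = int (nat (i + int k)) - int k" using kJ by auto
      have "(\<mu> - \<xi>) powi i = (\<mu> - \<xi>) ^ nat (i + int k) * inverse ((\<mu> - \<xi>) ^ k)"
      proof -
        have "(\<mu> - \<xi>) powi (int m - int k) = (\<mu> - \<xi>) ^ m * inverse ((\<mu> - \<xi>) ^ k)" for m
          using that by (simp add: power_int_diff divide_inverse)
        then show ?thesis using i by metis
      qed
      then show ?case by (simp add: A_def)
    qed (use kJ in auto)
    also have "\<dots> = inverse ((\<mu> - \<xi>) ^ k) * (\<Sum>j\<in>{j0..n + k}. (\<mu> - \<xi>) ^ j * coeff j f v)"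
      by (rule sum_distrib_left[symmetric])
    also have "(\<Sum>j\<in>{j0..n + k}. (\<mu> - \<xi>) ^ j * coeff j f v) = (\<Sum>j<Suc (n + k). (\<mu> - \<xi>) ^ j * coeff j f v)"
      by (rule sum.mono_neutral_left) (use below that in auto)
    finally show ?thesis .
  qed
  have main: "bounded_operator X Y (R \<mu>) \<and>
     (\<lambda>n. opnorm X Y (\<lambda>f v. R \<mu> f v - (\<Sum>j\<in>{- int J..int n}. (\<mu> - \<xi>) powi j * A j f v))) \<longlonglongrightarrow> 0"
    if \<mu>: "\<mu> \<in> \<Omega>" "dist \<mu> \<xi> < r" "\<mu> \<noteq> \<xi>" for \<mu>
  proof
    have \<mu>S: "\<mu> \<in> S" using \<mu> S(2) by (auto simp: dist_commute)
    have Req: "R \<mu> f = (\<lambda>v. inverse ((\<mu> - \<xi>) ^ k) * F \<mu> f v)" if "f \<in> elems X" for f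
      using R[OF \<mu> that] \<mu>(3) by (simp add: fun_eq_iff)
    have "bop X Y (R \<mu>) (cmod (inverse ((\<mu> - \<xi>) ^ k)) * B)"
      by (rule bop_cong[OF bop_scale[OF op[OF \<mu>S]] Req])
    then show "bounded_operator X Y (R \<mu>)" by (auto simp: bounded_operator_iff_bop)
    define t where "t = dist \<mu> \<xi> / r"
    have t: "0 \<le> t" "t < 1" using \<mu> S(3) by (auto simp: t_def)
    define K where "K = (\<lambda>n. cmod (inverse ((\<mu> - \<xi>) ^ k)) * (\<bar>B\<bar> * (t ^ Suc (n + k) / (1 - t))))"
    have K0: "0 \<le> K n" for n using t by (simp add: K_def)
    have bd: "fnorm Y (\<lambda>v. R \<mu> f v - (\<Sum>j\<in>{- int J..int n}. (\<mu> - \<xi>) powi j * A j f v)) \<le> K n * fnorm X f"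
      if f: "f \<in> elems X" for f n
    proof -
      define h where "h = (\<lambda>v. F \<mu> f v - (\<Sum>j<Suc (n + k). (\<mu> - \<xi>) ^ j * coeff j f v))"
      have h: "h \<in> elems Y" "fnorm Y h \<le> B * (t ^ Suc (n + k) / (1 - t)) * fnorm X f"
        unfolding h_def t_def by (rule remainder[OF f \<mu>(2)])+
      have "(\<lambda>v. R \<mu> f v - (\<Sum>j\<in>{- int J..int n}. (\<mu> - \<xi>) powi j * A j f v))
        = (\<lambda>v. inverse ((\<mu> - \<xi>) ^ k) * h v)"
        unfolding sumeq[OF \<mu>(3) f] Req[OF f] h_def by (simp add: right_diff_distrib)
      then have "fnorm Y (\<lambda>v. R \<mu> f v - (\<Sum>j\<in>{- int J..int n}. (\<mu> - \<xi>) powi j * A j f v))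
        = cmod (inverse ((\<mu> - \<xi>) ^ k)) * fnorm Y h"
        using Y.elems_scale(2)[OF h(1)] by simp
      also have "\<dots> \<le> cmod (inverse ((\<mu> - \<xi>) ^ k)) * (\<bar>B\<bar> * (t ^ Suc (n + k) / (1 - t)) * fnorm X f)"
        using t by (intro mult_left_mono order_trans[OF h(2)] mult_right_mono) (auto simp: X.fnorm_nonneg)
      finally show ?thesis by (simp add: K_def mult_ac)
    qed
    show "(\<lambda>n. opnorm X Y (\<lambda>f v. R \<mu> f v - (\<Sum>j\<in>{- int J..int n}. (\<mu> - \<xi>) powi j * A j f v))) \<longlonglongrightarrow> 0"
    proof (rule tendsto_sandwich[where f = "\<lambda>_. 0" and h = K])
      show "\<forall>\<^sub>F n in sequentially. 0 \<le> opnorm X Y (\<lambda>f v. R \<mu> f v - (\<Sum>j\<in>{- int J..int n}. (\<mu> - \<xi>) powi j * A j f v))"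
        by (intro always_eventually allI opnorm_nonneg[OF K0]) (rule bd)
      show "\<forall>\<^sub>F n in sequentially. opnorm X Y (\<lambda>f v. R \<mu> f v - (\<Sum>j\<in>{- int J..int n}. (\<mu> - \<xi>) powi j * A j f v)) \<le> K n"
        by (intro always_eventually allI opnorm_le[OF K0]) (rule bd)
      have "(\<lambda>n. cmod (inverse ((\<mu> - \<xi>) ^ k)) * (\<bar>B\<bar> * (t ^ Suc k * t ^ n / (1 - t))))
          \<longlonglongrightarrow> cmod (inverse ((\<mu> - \<xi>) ^ k)) * (\<bar>B\<bar> * (t ^ Suc k * 0 / (1 - t)))"
        using t by (intro tendsto_intros LIMSEQ_power_zero) auto
      then show "K \<longlonglongrightarrow> 0" by (simp add: K_def power_add mult_ac)
    qed simp
  qed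
  have center: "bounded_operator X Y (R \<xi>) \<and>
     (\<lambda>n. opnorm X Y (\<lambda>f v. R \<xi> f v - (\<Sum>j\<in>{- int J..int n}. (\<xi> - \<xi>) powi j * A j f v))) \<longlonglongrightarrow> 0"
    if "J = 0"
  proof
    have "j0 = k" using that j0k by (simp add: J_def)
    then have R\<xi>: "R \<xi> f = coeff k f" if "f \<in> elems X" for f
      using removable[OF _ that] below by blast
    obtain C where "bop X Y (coeff k) C" using coeff_bounded bounded_operator_iff_bop by blast
    then have "bop X Y (R \<xi>) C" by (rule bop_cong[OF _ R\<xi>])
    then show "bounded_operator X Y (R \<xi>)" by (auto simp: bounded_operator_iff_bop)
    have "(\<Sum>j\<in>{- int J..int n}. (\<xi> - \<xi>) powi j * A j f v) = R \<xi> f v" if f: "f \<in> elems X" for n f v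
    proof -
      \<comment> \<open>Without negative exponents only \<open>j = 0\<close> contributes at the
        centre: \<open>0 powi 0\<close> is one and the higher powers vanish.\<close>
      have "(\<Sum>j\<in>{- int J..int n}. (\<xi> - \<xi>) powi j * A j f v) = (\<Sum>j\<in>{0::int}. (\<xi> - \<xi>) powi j * A j f v)"
        by (rule sum.mono_neutral_right) (use \<open>J = 0\<close> in \<open>auto simp: power_int_0_left\<close>)
      then show ?thesis using R\<xi>[OF f] by (simp add: A_def)
    qed
    then have "fnorm Y (\<lambda>v. R \<xi> f v - (\<Sum>j\<in>{- int J..int n}. (\<xi> - \<xi>) powi j * A j f v)) \<le> 0 * fnorm X f"
      if "f \<in> elems X" for f n using that Y.fnorm_zero by simp
    then have "opnorm X Y (\<lambda>f v. R \<xi> f v - (\<Sum>j\<in>{- int J..int n}. (\<xi> - \<xi>) powi j * A j f v)) = 0" for n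
      by (intro antisym opnorm_le[of 0] opnorm_nonneg[of 0]) auto
    then show "(\<lambda>n. opnorm X Y (\<lambda>f v. R \<xi> f v - (\<Sum>j\<in>{- int J..int n}. (\<xi> - \<xi>) powi j * A j f v))) \<longlonglongrightarrow> 0"
      by simp
  qed
  show ?thesis
  proof (intro exI[of _ J] exI[of _ A] exI[of _ r] conjI allI impI ballI)
    show "0 < r" by (rule S(3))
    show "bounded_operator X Y (A j)" for j by (rule bA)
    show "finite_rank X (A j)" if "- int J \<le> j \<and> j < 0" for j
      unfolding A_def using that kJ by (intro rank) auto
    show "J = 0 \<or> (\<exists>f\<in>elems X. A (- int J) f \<noteq> (\<lambda>_. 0))"
    proof (cases "j0 = k")
      case False
      then have "nz j0" using j0 by blast
      moreover have "nat (- int J + int k) = j0" using kJ by simp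
      ultimately show ?thesis by (simp add: A_def nz_def)
    qed (simp add: J_def)
  qed (use main center in blast)+
qed

end


section \<open>Neumann series\<close>

text \<open>The inverse of \<open>1 - a T\<close>, summed vertex by vertex. Coordinatewise
  convergence suffices, because \<open>elems_limit\<close> recovers membership and the norm bound
  from the partial sums.\<close>

definition neumann :: "'v operator \<Rightarrow> complex \<Rightarrow> 'v operator" where
  "neumann T a f v = (\<Sum>n. a ^ n * (T ^^ n) f v)"

lemma (in weighted_spaces) opnorm_cong:
  assumes "\<And>f. f \<in> elems X \<Longrightarrow> T f = T' f"
  shows "opnorm X Y T = opnorm X Y T'"
proof -
  have "{fnorm Y (T f) |f. f \<in> elems X \<and> fnorm X f \<le> 1} = {fnorm Y (T' f) |f. f \<in> elems X \<and> fnorm X f \<le> 1}"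
    using assms by (metis (no_types, lifting))
  then show ?thesis by (simp add: opnorm_def)
qed

text \<open>\<open>pointwise_continuous\<close> allows \<open>T\<close> to be moved into a
  coordinatewise limit. The operators used satisfy it because the value at a vertex depends on
  finitely many vertices.\<close>

locale neumann_operator = weighted_space V w for V :: "'v set" and w +
  fixes T :: "'v operator" and K :: real
  assumes op: "bop (wsp V w) (wsp V w) T K" and K_nonneg: "0 \<le> K"
    and pointwise_continuous: "\<And>g f v. (\<And>v. (\<lambda>n. g n v) \<longlonglongrightarrow> f v) \<Longrightarrow> (\<lambda>n. T (g n) v) \<longlonglongrightarrow> T f v"
begin

sublocale weighted_spaces V w w by unfold_locales

lemma iterate:
  assumes "f \<in> elems X"
  shows "(T ^^ n) f \<in> elems X" and "fnorm X ((T ^^ n) f) \<le> K ^ n * fnorm X f"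
proof -
  have "(T ^^ n) f \<in> elems X \<and> fnorm X ((T ^^ n) f) \<le> K ^ n * fnorm X f"
  proof (induction n)
    case (Suc n)
    have "fnorm X (T ((T ^^ n) f)) \<le> K * fnorm X ((T ^^ n) f)" using bopD(2)[OF op] Suc by blast
    also have "\<dots> \<le> K * (K ^ n * fnorm X f)" using Suc K_nonneg by (intro mult_left_mono) auto
    finally show ?case using bopD(1)[OF op] Suc by (simp add: mult.assoc)
  qed (use assms in simp)
  then show "(T ^^ n) f \<in> elems X" "fnorm X ((T ^^ n) f) \<le> K ^ n * fnorm X f" by blast+
qed

lemma summable_neumann:
  assumes "f \<in> elems X" "cmod a * K < 1"
  shows "summable (\<lambda>n. a ^ n * (T ^^ n) f v)"
proof (cases "v \<in> V")
  case True
  have "norm (a ^ n * (T ^^ n) f v) \<le> sqrt (w v) * fnorm X f * (cmod a * K) ^ n" for n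
  proof -
    have "cmod ((T ^^ n) f v) \<le> sqrt (w v) * (K ^ n * fnorm X f)"
      using cmod_le_fnorm[OF iterate(1)[OF assms(1)] True, of n] iterate(2)[OF assms(1), of n] weight_pos[OF True]
      by (meson mult_left_mono order_trans real_sqrt_ge_zero less_imp_le)
    then have "cmod a ^ n * cmod ((T ^^ n) f v) \<le> cmod a ^ n * (sqrt (w v) * (K ^ n * fnorm X f))"
      by (rule mult_left_mono) simp
    then show ?thesis by (simp add: norm_mult norm_power power_mult_distrib mult_ac)
  qed
  moreover have "summable (\<lambda>n. sqrt (w v) * fnorm X f * (cmod a * K) ^ n)"
    using assms(2) K_nonneg by (intro summable_mult summable_geometric) auto
  ultimately show ?thesis by (rule summable_comparison_test'[where N = 0, rotated])
next
  case False
  then show ?thesis using elems_off[OF iterate(1)[OF assms(1)]] by simp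
qed

text \<open>The partial sums are bounded by a geometric series with ratio \<open>cmod a * K\<close>,
  and \<open>elems_limit\<close> carries the bound to their limit.\<close>

lemma neumann_bop:
  assumes a: "cmod a * K < 1"
  shows "bop X X (neumann T a) (1 / (1 - cmod a * K))"
  unfolding bop_def
proof (intro conjI ballI allI)
  fix f assume f: "f \<in> elems X"
  note s = summable_neumann[OF f a]
  define t where "t = cmod a * K"
  have t: "0 \<le> t" "t < 1" using a K_nonneg by (auto simp: t_def)
  define g where "g = (\<lambda>m v. \<Sum>n<m. a ^ n * (T ^^ n) f v)"
  have g: "g m \<in> elems X" "fnorm X (g m) \<le> 1 / (1 - t) * fnorm X f" for m
  proof -
    have i: "(\<lambda>v. a ^ n * (T ^^ n) f v) \<in> elems X"
      "fnorm X (\<lambda>v. a ^ n * (T ^^ n) f v) \<le> t ^ n * fnorm X f" for n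
    proof -
      show "(\<lambda>v. a ^ n * (T ^^ n) f v) \<in> elems X" by (rule elems_scale(1)[OF iterate(1)[OF f]])
      have "fnorm X (\<lambda>v. a ^ n * (T ^^ n) f v) = cmod a ^ n * fnorm X ((T ^^ n) f)"
        using elems_scale(2)[OF iterate(1)[OF f], of "a ^ n"] by (simp add: norm_power)
      also have "\<dots> \<le> cmod a ^ n * (K ^ n * fnorm X f)"
        by (intro mult_left_mono iterate(2)[OF f]) auto
      finally show "fnorm X (\<lambda>v. a ^ n * (T ^^ n) f v) \<le> t ^ n * fnorm X f"
        by (simp add: t_def power_mult_distrib mult_ac)
    qed
    show "g m \<in> elems X" unfolding g_def by (rule elems_sum(1)) (use i in auto)
    have "fnorm X (g m) \<le> (\<Sum>n<m. fnorm X (\<lambda>v. a ^ n * (T ^^ n) f v))"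
      unfolding g_def by (rule elems_sum(2)) (use i in auto)
    also have "\<dots> \<le> (\<Sum>n<m. t ^ n * fnorm X f)" by (rule sum_mono) (rule i)
    also have "\<dots> = (\<Sum>n<m. t ^ n) * fnorm X f" by (simp add: sum_distrib_right)
    also have "\<dots> \<le> (\<Sum>n. t ^ n) * fnorm X f"
      using t by (intro mult_right_mono sum_le_suminf summable_geometric fnorm_nonneg) auto
    also have "(\<Sum>n. t ^ n) = 1 / (1 - t)" using t by (simp add: suminf_geometric)
    finally show "fnorm X (g m) \<le> 1 / (1 - t) * fnorm X f" .
  qed
  have lim: "(\<lambda>m. g m v) \<longlonglongrightarrow> neumann T a f v" for v
    unfolding g_def neumann_def by (rule summable_LIMSEQ[OF s])
  have off: "neumann T a f v = 0" if "v \<notin> V" for v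
    using elems_off[OF iterate(1)[OF f] that] by (simp add: neumann_def)
  show "neumann T a f \<in> elems X"
    by (rule elems_limit(1)[OF off lim g])
  show "fnorm X (neumann T a f) \<le> 1 / (1 - cmod a * K) * fnorm X f"
    using elems_limit(2)[OF off lim g] by (simp add: t_def)
  show "neumann T a (\<lambda>v. c * f v) = (\<lambda>v. c * neumann T a f v)" for c
  proof
    fix v
    have "(T ^^ n) (\<lambda>v. c * f v) = (\<lambda>v. c * (T ^^ n) f v)" for n
    proof (induction n)
      case (Suc n)
      then show ?case using bopD(4)[OF op iterate(1)[OF f]] by simp
    qed simp
    then have "neumann T a (\<lambda>v. c * f v) v = (\<Sum>n. c * (a ^ n * (T ^^ n) f v))"
      by (simp add: neumann_def mult_ac)
    also have "\<dots> = c * neumann T a f v" unfolding neumann_def by (rule suminf_mult[OF s])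
    finally show "neumann T a (\<lambda>v. c * f v) v = c * neumann T a f v" .
  qed
  fix g assume g: "g \<in> elems X"
  show "neumann T a (\<lambda>v. f v + g v) = (\<lambda>v. neumann T a f v + neumann T a g v)"
  proof
    fix v
    have "(T ^^ n) (\<lambda>v. f v + g v) = (\<lambda>v. (T ^^ n) f v + (T ^^ n) g v)" for n
    proof (induction n)
      case (Suc n)
      then show ?case using bopD(3)[OF op iterate(1)[OF f] iterate(1)[OF g]] by simp
    qed simp
    then have "neumann T a (\<lambda>v. f v + g v) v = (\<Sum>n. a ^ n * (T ^^ n) f v + a ^ n * (T ^^ n) g v)"
      by (simp add: neumann_def distrib_left)
    also have "\<dots> = neumann T a f v + neumann T a g v"
      unfolding neumann_def by (rule suminf_add[OF s summable_neumann[OF g a], symmetric])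
    finally show "neumann T a (\<lambda>v. f v + g v) v = neumann T a f v + neumann T a g v" .
  qed
qed

lemma neumann_right:
  assumes f: "f \<in> elems X" and a: "cmod a * K < 1"
  shows "neumann T a f v = f v + a * neumann T a (T f) v"
proof -
  have "neumann T a f v = (\<Sum>n. a ^ Suc n * (T ^^ Suc n) f v) + a ^ 0 * (T ^^ 0) f v"
    unfolding neumann_def using suminf_split_head[OF summable_neumann[OF f a]] by simp
  also have "(\<Sum>n. a ^ Suc n * (T ^^ Suc n) f v) = (\<Sum>n. a * (a ^ n * (T ^^ n) (T f) v))"
    by (simp only: funpow_Suc_right o_apply power_Suc mult.assoc)
  also have "\<dots> = a * neumann T a (T f) v"
    unfolding neumann_def by (rule suminf_mult[OF summable_neumann[OF bopD(1)[OF op f] a]])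
  finally show ?thesis by simp
qed

text \<open>Unlike \<open>neumann_right\<close>, which only shifts the summation index, this
  identity applies \<open>T\<close> to an infinite sum; the exchange is made on partial sums through
  \<open>pointwise_continuous\<close>.\<close>

lemma neumann_left:
  assumes f: "f \<in> elems X" and a: "cmod a * K < 1"
  shows "neumann T a f v = f v + a * T (neumann T a f) v"
proof -
  define g where "g = (\<lambda>m v. \<Sum>n<m. a ^ n * (T ^^ n) f v)"
  have g: "g m \<in> elems X" and Tg: "T (g m) = (\<lambda>v. \<Sum>n<m. a ^ n * (T ^^ Suc n) f v)" for m
  proof -
    have "g m \<in> elems X \<and> T (g m) = (\<lambda>v. \<Sum>n<m. a ^ n * (T ^^ Suc n) f v)"
    proof (induction m)
      case 0
      have "T (\<lambda>v. 0 * 0) = (\<lambda>v. 0 * T (\<lambda>v. 0) v)" by (rule bopD(4)[OF op elems_zero])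
      then show ?case by (simp add: g_def elems_zero)
    next
      case (Suc m)
      have g': "g (Suc m) = (\<lambda>v. g m v + a ^ m * (T ^^ m) f v)" by (simp add: g_def)
      have m: "(\<lambda>v. a ^ m * (T ^^ m) f v) \<in> elems X" by (rule elems_scale(1)[OF iterate(1)[OF f]])
      show ?case
        unfolding g' using elems_add(1)[OF conjunct1[OF Suc] m] bopD(3)[OF op conjunct1[OF Suc] m]
          bopD(4)[OF op iterate(1)[OF f], of "a ^ m" m] Suc by simp
    qed
    then show "g m \<in> elems X" "T (g m) = (\<lambda>v. \<Sum>n<m. a ^ n * (T ^^ Suc n) f v)" by blast+
  qed
  have lim: "(\<lambda>m. g m v) \<longlonglongrightarrow> neumann T a f v" for v
    unfolding g_def neumann_def by (rule summable_LIMSEQ[OF summable_neumann[OF f a]])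
  have "(\<lambda>m. T (g m) v) \<longlonglongrightarrow> T (neumann T a f) v" by (rule pointwise_continuous[OF lim])
  moreover have "(\<lambda>m. T (g m) v) \<longlonglongrightarrow> neumann T a (T f) v"
    unfolding neumann_def Tg using summable_LIMSEQ[OF summable_neumann[OF bopD(1)[OF op f] a, of v]]
    by (simp only: funpow_Suc_right o_apply)
  ultimately have "T (neumann T a f) v = neumann T a (T f) v" by (rule LIMSEQ_unique)
  then show ?thesis using neumann_right[OF f a] by simp
qed

lemma neumann_holomorphic:
  assumes f: "f \<in> elems X"
  shows "(\<lambda>a. neumann T a f v) holomorphic_on {a. cmod a * K < 1}"
proof -
  have op: "open {a. cmod a * K < 1}" by (intro open_Collect_less continuous_intros)
  have "(\<lambda>a. neumann T a f v) field_differentiable at b" if b: "cmod b * K < 1" for b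
  proof -
    \<comment> \<open>A radius beyond \<open>cmod b\<close> on which the power series still
      converges. For \<open>K = 0\<close> any radius will do, but \<open>1 / K\<close> does not
      express this.\<close>
    obtain r where r: "cmod b < r" "r * K < 1"
    proof (cases "K = 0")
      case True
      then show ?thesis using that[of "cmod b + 1"] by simp
    next
      case False
      then have "cmod b < 1 / K" using b K_nonneg by (simp add: field_simps)
      then obtain r where "cmod b < r" "r < 1 / K" using dense by blast
      then show ?thesis using that False K_nonneg by (simp add: field_simps)
    qed
    have "(\<lambda>a. neumann T a f v) holomorphic_on ball 0 r"
    proof (rule power_series_holomorphic[where a = "\<lambda>n. (T ^^ n) f v"])
      fix a assume "a \<in> ball (0 :: complex) r"
      then have "cmod a * K < 1" using r K_nonneg mult_right_mono[of "cmod a" r K] by auto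
      then show "(\<lambda>n. (T ^^ n) f v * (a - 0) ^ n) sums neumann T a f v"
        using summable_sums[OF summable_neumann[OF f]] by (simp add: neumann_def mult.commute)
    qed
    then show ?thesis using r(1) by (auto simp: holomorphic_on_open field_differentiable_def)
  qed
  then show ?thesis using op by (auto simp: holomorphic_on_open field_differentiable_def)
qed

lemma neumann_compose_holomorphic:
  assumes f: "f \<in> elems X" and h: "h holomorphic_on S" "\<And>\<mu>. \<mu> \<in> S \<Longrightarrow> cmod (h \<mu>) * K < 1"
  shows "(\<lambda>\<mu>. neumann T (h \<mu>) f v) holomorphic_on S"
  using holomorphic_on_compose_gen[OF h(1) neumann_holomorphic[OF f], of v] h(2) by (auto simp: o_def)

section \<open>The resolvent outside a disc\<close>

context
  fixes c :: real
  assumes c: "0 \<le> c"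
begin

text \<open>The expansion at infinity of the inverse of
  \<open>c T - \<zeta> = - \<zeta> (1 - (c / \<zeta>) T)\<close>, valid for
  \<open>cmod \<zeta> > c * K\<close>.\<close>

definition outer_resolvent :: "complex \<Rightarrow> 'v operator" where
  "outer_resolvent \<zeta> f = (\<lambda>v. - inverse \<zeta> * neumann T (of_real c / \<zeta>) f v)"

lemma outer_small: "c * K < cmod \<zeta> \<Longrightarrow> cmod (of_real c / \<zeta>) * K < 1 \<and> \<zeta> \<noteq> 0"
proof -
  assume *: "c * K < cmod \<zeta>"
  then have p: "0 < cmod \<zeta>" using mult_nonneg_nonneg[OF c K_nonneg] by linarith
  then have "cmod (of_real c / \<zeta>) * K = c * K / cmod \<zeta>" using c by (simp add: norm_divide)
  then show "cmod (of_real c / \<zeta>) * K < 1 \<and> \<zeta> \<noteq> 0" using * p by auto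
qed

text \<open>The intermediate radius \<open>d\<close> makes the bound independent of
  \<open>\<zeta>\<close>, as required for a holomorphic family.\<close>

lemma outer_resolvent_bop:
  assumes "d < cmod \<zeta>" "c * K < d"
  shows "bop X X (outer_resolvent \<zeta>) (1 / d * (1 / (1 - c * K / d)))"
proof -
  have d: "0 < d" using assms mult_nonneg_nonneg[OF c K_nonneg] by linarith
  have z: "cmod (of_real c / \<zeta>) * K < 1" using outer_small assms by force
  have "c * K / cmod \<zeta> \<le> c * K / d"
    using assms d mult_nonneg_nonneg[OF c K_nonneg] by (intro divide_left_mono mult_pos_pos) auto
  then have "cmod (of_real c / \<zeta>) * K \<le> c * K / d" using c by (simp add: norm_divide)
  moreover have "c * K / d < 1" using assms d by simp
  ultimately have "1 / (1 - cmod (of_real c / \<zeta>) * K) \<le> 1 / (1 - c * K / d)"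
    by (intro divide_left_mono) auto
  moreover have "cmod (- inverse \<zeta>) \<le> 1 / d"
    using assms d by (simp add: norm_inverse norm_divide inverse_eq_divide divide_le_eq_1 frac_le)
  moreover have "0 \<le> 1 / (1 - cmod (of_real c / \<zeta>) * K)" using z by simp
  ultimately have "cmod (- inverse \<zeta>) * (1 / (1 - cmod (of_real c / \<zeta>) * K)) \<le> 1 / d * (1 / (1 - c * K / d))"
    using d by (intro mult_mono) auto
  then show ?thesis
    using bop_mono[OF bop_scale[OF neumann_bop[OF z], of "- inverse \<zeta>"]]
    unfolding outer_resolvent_def[abs_def] by blast
qed

context
  fixes \<zeta>
  assumes \<zeta>: "c * K < cmod \<zeta>"
begin

lemma outer_resolvent_elems: "f \<in> elems X \<Longrightarrow> outer_resolvent \<zeta> f \<in> elems X"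
  unfolding outer_resolvent_def by (rule elems_scale(1)[OF bopD(1)[OF neumann_bop]]) (use outer_small[OF \<zeta>] in auto)

lemma shifted_outer_resolvent:
  assumes f: "f \<in> elems X"
  shows "(\<lambda>v. of_real c * T (outer_resolvent \<zeta> f) v - \<zeta> * outer_resolvent \<zeta> f v) = f"
proof
  fix v
  have z: "cmod (of_real c / \<zeta>) * K < 1" "\<zeta> \<noteq> 0" using outer_small[OF \<zeta>] by auto
  have "T (outer_resolvent \<zeta> f) = (\<lambda>v. - inverse \<zeta> * T (neumann T (of_real c / \<zeta>) f) v)"
    unfolding outer_resolvent_def by (rule bopD(4)[OF op bopD(1)[OF neumann_bop[OF z(1)] f]])
  then have "of_real c * T (outer_resolvent \<zeta> f) v - \<zeta> * outer_resolvent \<zeta> f v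
    = neumann T (of_real c / \<zeta>) f v - of_real c / \<zeta> * T (neumann T (of_real c / \<zeta>) f) v"
    using z(2) by (simp add: outer_resolvent_def divide_inverse)
  also have "\<dots> = f v" using neumann_left[OF f z(1), of v] by simp
  finally show "of_real c * T (outer_resolvent \<zeta> f) v - \<zeta> * outer_resolvent \<zeta> f v = f v" .
qed

lemma outer_resolvent_shifted:
  assumes f: "f \<in> elems X"
  shows "(\<lambda>v. of_real c * T f v - \<zeta> * f v) \<in> elems X"
    and "outer_resolvent \<zeta> (\<lambda>v. of_real c * T f v - \<zeta> * f v) = f"
proof -
  have z: "cmod (of_real c / \<zeta>) * K < 1" "\<zeta> \<noteq> 0" using outer_small[OF \<zeta>] by auto
  note N = neumann_bop[OF z(1)]
  have Tf: "T f \<in> elems X" by (rule bopD(1)[OF op f])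
  have eq: "(\<lambda>v. of_real c * T f v - \<zeta> * f v) = (\<lambda>v. of_real c * T f v + (- \<zeta>) * f v)" by simp
  show "(\<lambda>v. of_real c * T f v - \<zeta> * f v) \<in> elems X"
    unfolding eq by (intro elems_add(1) elems_scale(1) Tf f)
  have "neumann T (of_real c / \<zeta>) (\<lambda>v. of_real c * T f v + (- \<zeta>) * f v)
    = (\<lambda>v. neumann T (of_real c / \<zeta>) (\<lambda>v. of_real c * T f v) v + neumann T (of_real c / \<zeta>) (\<lambda>v. (- \<zeta>) * f v) v)"
    by (rule bopD(3)[OF N elems_scale(1)[OF Tf] elems_scale(1)[OF f]])
  also have "\<dots> = (\<lambda>v. of_real c * neumann T (of_real c / \<zeta>) (T f) v + (- \<zeta>) * neumann T (of_real c / \<zeta>) f v)"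
    by (simp only: bopD(4)[OF N Tf] bopD(4)[OF N f])
  finally show "outer_resolvent \<zeta> (\<lambda>v. of_real c * T f v - \<zeta> * f v) = f"
    using neumann_right[OF f z(1)] z(2) unfolding outer_resolvent_def eq
    by (simp add: fun_eq_iff field_simps)
qed

lemma shifted_bij: "bij_betw (\<lambda>f v. of_real c * T f v - \<zeta> * f v) (elems X) (elems X)"
  by (rule bij_betw_byWitness[where f' = "outer_resolvent \<zeta>"])
    (use shifted_outer_resolvent outer_resolvent_shifted outer_resolvent_elems in auto)

lemma the_inv_into_shifted:
  assumes "f \<in> elems X"
  shows "the_inv_into (elems X) (\<lambda>f v. of_real c * T f v - \<zeta> * f v) f = outer_resolvent \<zeta> f"
  by (rule the_inv_into_f_eq[OF bij_betw_imp_inj_on[OF shifted_bij]])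
    (auto intro: shifted_outer_resolvent outer_resolvent_elems assms)

end

lemma z_holomorphic: "z holomorphic_on {\<mu>. \<mu> \<noteq> 0}"
  unfolding z_def[abs_def] by (intro holomorphic_intros) auto

lemma open_z_outside: "open {\<mu>. \<mu> \<noteq> 0 \<and> d < cmod (z \<mu>)}"
proof -
  have "open {\<mu> :: complex. \<mu> \<noteq> 0}" by (rule open_Collect_neq) auto
  moreover have "continuous_on {\<mu>. \<mu> \<noteq> 0} (\<lambda>\<mu>. cmod (z \<mu>))"
    by (intro continuous_on_norm holomorphic_on_imp_continuous_on z_holomorphic)
  ultimately have "open ((\<lambda>\<mu>. cmod (z \<mu>)) -` {d<..} \<inter> {\<mu>. \<mu> \<noteq> 0})"
    by (simp add: continuous_on_open_vimage)
  moreover have "(\<lambda>\<mu>. cmod (z \<mu>)) -` {d<..} \<inter> {\<mu>. \<mu> \<noteq> 0} = {\<mu>. \<mu> \<noteq> 0 \<and> d < cmod (z \<mu>)}"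
    by auto
  ultimately show ?thesis by simp
qed

lemma outer_resolvent_holomorphic_family:
  assumes R: "\<And>\<mu> f. \<mu> \<noteq> 0 \<Longrightarrow> c * K < cmod (z \<mu>) \<Longrightarrow> f \<in> elems X \<Longrightarrow> R \<mu> f = outer_resolvent (z \<mu>) f"
  shows "holomorphic_family X X {\<mu>. \<mu> \<noteq> 0 \<and> c * K < cmod (z \<mu>)} R"
  unfolding holomorphic_family_def
proof (intro conjI ballI)
  let ?\<Omega> = "{\<mu>. \<mu> \<noteq> 0 \<and> c * K < cmod (z \<mu>)}"
  fix \<xi> assume \<xi>: "\<xi> \<in> ?\<Omega>"
  \<comment> \<open>The bounds degenerate as \<open>cmod (z \<mu>)\<close> approaches
    \<open>c * K\<close>; the gap up to \<open>d\<close> gives a neighbourhood of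
    \<open>\<xi>\<close> with a single bound.\<close>
  then obtain d where d: "c * K < d" "d < cmod (z \<xi>)" using dense[of "c * K"] by auto
  define B where "B = 1 / d * (1 / (1 - c * K / d))"
  have "bop X X (R \<xi>) B"
    using bop_cong[OF outer_resolvent_bop[OF d(2,1)] R] \<xi> unfolding B_def by auto
  then show "bounded_operator X X (R \<xi>)" by (auto simp: bounded_operator_iff_bop)
  define S where "S = {\<mu>. \<mu> \<noteq> 0 \<and> d < cmod (z \<mu>)}"
  have "open S" unfolding S_def by (rule open_z_outside)
  moreover have "\<xi> \<in> S" using \<xi> d by (simp add: S_def)
  ultimately obtain r where r: "r > 0" "cball \<xi> r \<subseteq> S" using open_contains_cball by blast
  interpret H: holomorphic_operators V w w "\<lambda>\<mu>. outer_resolvent (z \<mu>)" S B \<xi> r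
  proof unfold_locales
    show "bop X X (outer_resolvent (z \<mu>)) B" if "\<mu> \<in> S" for \<mu>
      unfolding B_def by (rule outer_resolvent_bop) (use that d in \<open>auto simp: S_def\<close>)
    show "(\<lambda>\<mu>. outer_resolvent (z \<mu>) f v) holomorphic_on S" if "f \<in> elems X" for f v
    proof -
      have zh: "z holomorphic_on S" by (rule holomorphic_on_subset[OF z_holomorphic]) (auto simp: S_def)
      have sm: "cmod (of_real c / z \<mu>) * K < 1 \<and> z \<mu> \<noteq> 0" if "\<mu> \<in> S" for \<mu>
        using that d outer_small[of "z \<mu>"] by (auto simp: S_def)
      have "(\<lambda>\<mu>. neumann T (of_real c / z \<mu>) f v) holomorphic_on S"
        by (rule neumann_compose_holomorphic[OF that]) (use zh sm in \<open>auto intro!: holomorphic_intros\<close>)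
      then show ?thesis
        unfolding outer_resolvent_def by (intro holomorphic_intros zh) (use sm in auto)
    qed
  qed (use r \<open>open S\<close> in auto)
  have "((\<lambda>\<mu>. opnorm X X (\<lambda>f v. (R \<mu> f v - R \<xi> f v) / (\<mu> - \<xi>) - H.coeff 1 f v)) \<longlongrightarrow> 0) (at \<xi> within ?\<Omega>)"
  proof (rule Lim_transform_eventually[OF H.difference_quotient[where A = "?\<Omega>"]])
    have "\<forall>\<^sub>F \<mu> in at \<xi> within ?\<Omega>. \<mu> \<in> ?\<Omega>" by (simp add: eventually_at_filter)
    then show "\<forall>\<^sub>F \<mu> in at \<xi> within ?\<Omega>. opnorm X X (\<lambda>f v. (outer_resolvent (z \<mu>) f v - outer_resolvent (z \<xi>) f v) / (\<mu> - \<xi>) - H.coeff 1 f v)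
      = opnorm X X (\<lambda>f v. (R \<mu> f v - R \<xi> f v) / (\<mu> - \<xi>) - H.coeff 1 f v)"
      by eventually_elim (intro opnorm_cong, use R \<xi> in auto)
  qed
  then show "\<exists>D. bounded_operator X X D \<and>
      ((\<lambda>\<mu>. opnorm X X (\<lambda>f v. (R \<mu> f v - R \<xi> f v) / (\<mu> - \<xi>) - D f v)) \<longlongrightarrow> 0) (at \<xi> within ?\<Omega>)"
    using H.coeff_bounded by blast
qed

end

end

section \<open>Determinants over polynomials and removable singularities\<close>

text \<open>Cramer's rule over the polynomial ring, transported to \<open>L\<close> by an
  enumeration: \<open>D\<close> is the adjugate and \<open>d\<close> the determinant. As evaluation
  at \<open>x\<close> is a ring homomorphism, \<open>poly d x\<close> is the determinant of the
  evaluated matrix, which is nonzero if that matrix has trivial kernel.\<close>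

lemma adjugate_on_finite_set:
  fixes M :: "'v \<Rightarrow> 'v \<Rightarrow> complex poly"
  assumes "finite L"
  obtains D d where
    "\<And>i j. i \<in> L \<Longrightarrow> j \<in> L \<Longrightarrow> (\<Sum>k\<in>L. M i k * D k j) = (if i = j then d else 0)"
    "\<And>x. (\<And>c. (\<And>i. i \<in> L \<Longrightarrow> (\<Sum>k\<in>L. poly (M i k) x * c k) = 0) \<Longrightarrow> \<forall>k\<in>L. c k = 0) \<Longrightarrow>
      poly d x \<noteq> 0"
proof -
  define n where "n = card L"
  obtain f where f: "bij_betw f {0..<n} L"
    using ex_bij_betw_nat_finite[OF assms] by (auto simp: n_def)
  define g where "g = the_inv_into {0..<n} f"
  have g: "i \<in> L \<Longrightarrow> g i < n \<and> f (g i) = i" for i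
    using f_the_inv_into_f_bij_betw[OF f] the_inv_into_into[of f "{0..<n}" i "{0..<n}"] f
    by (auto simp: g_def bij_betw_def)
  have gf: "k < n \<Longrightarrow> g (f k) = k" for k
    using the_inv_into_f_f[of f "{0..<n}" k] f by (auto simp: g_def bij_betw_def)
  define A where "A = mat n n (\<lambda>(i, j). M (f i) (f j))"
  have A: "A \<in> carrier_mat n n" by (simp add: A_def)
  define d where "d = Determinant.det A"
  define D where "D = (\<lambda>i j. adj_mat A $$ (g i, g j))"
  have reindex: "(\<Sum>k\<in>L. h k) = (\<Sum>k<n. h (f k))" for h :: "'v \<Rightarrow> 'a :: comm_monoid_add"
    using sum.reindex_bij_betw[OF f, of h] by (simp add: atLeast0LessThan)
  show thesis
  proof (rule that[of D d])
    fix i j assume ij: "i \<in> L" "j \<in> L"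
    have "(\<Sum>k\<in>L. M i k * D k j) = (\<Sum>k<n. A $$ (g i, k) * adj_mat A $$ (k, g j))"
      unfolding reindex using ij g gf by (intro sum.cong) (auto simp: A_def D_def)
    also have "\<dots> = (A * adj_mat A) $$ (g i, g j)"
      using ij g adj_mat(1)[OF A] A by (auto simp: scalar_prod_def atLeast0LessThan)
    also have "\<dots> = (if i = j then d else 0)"
      unfolding adj_mat(2)[OF A] using ij g by (auto simp: d_def) (metis g)+
    finally show "(\<Sum>k\<in>L. M i k * D k j) = (if i = j then d else 0)" .
  next
    fix x
    assume inj: "\<And>c. (\<And>i. i \<in> L \<Longrightarrow> (\<Sum>k\<in>L. poly (M i k) x * c k) = 0) \<Longrightarrow> \<forall>k\<in>L. c k = 0"
    interpret h: comm_ring_hom "\<lambda>p. poly p x"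
      by unfold_locales auto
    define Ax where "Ax = map_mat (\<lambda>p. poly p x) A"
    have Ax: "Ax \<in> carrier_mat n n" by (simp add: Ax_def A)
    have "Determinant.det Ax \<noteq> 0"
    proof
      assume "Determinant.det Ax = 0"
      then obtain v where v: "v \<in> carrier_vec n" "v \<noteq> 0\<^sub>v n" "Ax *\<^sub>v v = 0\<^sub>v n"
        using det_0_iff_vec_prod_zero_field[OF Ax] by blast
      have "\<forall>k\<in>L. vec_index v (g k) = 0"
      proof (rule inj)
        fix i assume i: "i \<in> L"
        have "(\<Sum>k\<in>L. poly (M i k) x * vec_index v (g k)) = (\<Sum>k<n. Ax $$ (g i, k) * vec_index v k)"
          unfolding reindex using i g gf by (intro sum.cong) (auto simp: Ax_def A_def)
        also have "\<dots> = vec_index (Ax *\<^sub>v v) (g i)"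
          using i g Ax v(1) by (auto simp: scalar_prod_def atLeast0LessThan)
        also have "\<dots> = 0" using v(3) i g by simp
        finally show "(\<Sum>k\<in>L. poly (M i k) x * vec_index v (g k)) = 0" .
      qed
      then have "vec_index v k = 0" if "k < n" for k
      proof -
        have "f k \<in> L" using f that by (auto simp: bij_betw_def)
        then show ?thesis using \<open>\<forall>k\<in>L. vec_index v (g k) = 0\<close> gf[OF that] by force
      qed
      then have "v = 0\<^sub>v n" using v(1) by (intro eq_vecI) auto
      then show False using v(2) by blast
    qed
    then show "poly d x \<noteq> 0" by (simp add: Ax_def d_def h.hom_det)
  qed
qed

text \<open>The remainder of order \<open>Suc k\<close>, divided by the power of order
  \<open>k\<close>, tends to zero. This identifies a value defined as a limit at a removable
  singularity with a Taylor coefficient.\<close>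

lemma taylor_quotient_limit:
  assumes "open S" "\<xi> \<in> S" "h holomorphic_on S" "\<And>j. j < k \<Longrightarrow> (deriv ^^ j) h \<xi> = 0"
  shows "((\<lambda>\<mu>. h \<mu> / (\<mu> - \<xi>) ^ k) \<longlongrightarrow> (deriv ^^ k) h \<xi> / fact k) (at \<xi>)"
proof -
  obtain r where r: "0 < r" "cball \<xi> r \<subseteq> S" using assms(1,2) open_contains_cball by blast
  have "compact (h ` cball \<xi> r)"
    by (intro compact_continuous_image compact_cball
      continuous_on_subset[OF holomorphic_on_imp_continuous_on[OF assms(3)] r(2)])
  then obtain K where K: "\<And>\<mu>. \<mu> \<in> cball \<xi> r \<Longrightarrow> cmod (h \<mu>) \<le> K"
  proof -
    obtain a where "\<forall>x \<in> h ` cball \<xi> r. cmod x \<le> a"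
      using compact_imp_bounded[OF \<open>compact _\<close>] unfolding bounded_iff by blast
    then show thesis using that by blast
  qed
  define e where "e = (\<lambda>\<mu>. K / r ^ k * (dist \<mu> \<xi> / r / (1 - dist \<mu> \<xi> / r)))"
  have bd: "dist (h \<mu> / (\<mu> - \<xi>) ^ k) ((deriv ^^ k) h \<xi> / fact k) \<le> e \<mu>"
    if \<mu>: "dist \<mu> \<xi> < r" "\<mu> \<noteq> \<xi>" for \<mu>
  proof -
    define c where "c = (deriv ^^ k) h \<xi> / fact k"
    have "(\<Sum>j<Suc k. (\<mu> - \<xi>) ^ j * ((deriv ^^ j) h \<xi> / fact j)) = (\<mu> - \<xi>) ^ k * c"
      using assms(4) by (simp add: c_def)
    then have *: "cmod (h \<mu> - (\<mu> - \<xi>) ^ k * c) \<le> K * ((dist \<mu> \<xi> / r) ^ Suc k / (1 - dist \<mu> \<xi> / r))"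
      using taylor_remainder_le[OF assms(1) r(2) assms(3) r(1) K \<mu>(1), of "Suc k"] by simp
    have "h \<mu> / (\<mu> - \<xi>) ^ k - c = (h \<mu> - (\<mu> - \<xi>) ^ k * c) / (\<mu> - \<xi>) ^ k"
      using \<mu> by (simp add: field_simps)
    then have "dist (h \<mu> / (\<mu> - \<xi>) ^ k) c = cmod (h \<mu> - (\<mu> - \<xi>) ^ k * c) / dist \<mu> \<xi> ^ k"
      by (simp add: dist_norm norm_divide norm_power)
    also have "\<dots> \<le> K * ((dist \<mu> \<xi> / r) ^ Suc k / (1 - dist \<mu> \<xi> / r)) / dist \<mu> \<xi> ^ k"
      using * by (rule divide_right_mono) simp
    also have "\<dots> = e \<mu>" using \<mu> by (simp add: e_def power_divide)
    finally show ?thesis by (simp add: c_def)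
  qed
  have "(e \<longlongrightarrow> K / r ^ k * (dist \<xi> \<xi> / r / (1 - dist \<xi> \<xi> / r))) (at \<xi>)"
    unfolding e_def by (intro tendsto_intros) (use r in auto)
  then have e0: "(e \<longlongrightarrow> 0) (at \<xi>)" by simp
  have "\<forall>\<^sub>F \<mu> in at \<xi>. dist \<mu> \<xi> < r \<and> \<mu> \<noteq> \<xi>" unfolding eventually_at by (intro exI[of _ r]) (use r(1) in auto)
  then have "\<forall>\<^sub>F \<mu> in at \<xi>. dist (h \<mu> / (\<mu> - \<xi>) ^ k) ((deriv ^^ k) h \<xi> / fact k) \<le> e \<mu>"
    by (rule eventually_mono) (simp add: bd)
  then have "((\<lambda>\<mu>. dist (h \<mu> / (\<mu> - \<xi>) ^ k) ((deriv ^^ k) h \<xi> / fact k)) \<longlongrightarrow> 0) (at \<xi>)"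
    by (intro tendsto_sandwich[OF _ _ tendsto_const e0]) simp_all
  then show ?thesis by (subst tendsto_dist_iff)
qed

text \<open>Every term of Leibniz' rule contains a derivative of \<open>(\<mu> - \<xi>) ^ k\<close>
  of order below \<open>k\<close>. For this reason the ends contribute nothing to the singular
  coefficients.\<close>

lemma higher_deriv_power_mult_zero:
  assumes "open S" "\<xi> \<in> S" "h holomorphic_on S" "j < k"
  shows "(deriv ^^ j) (\<lambda>\<mu>. (\<mu> - \<xi>) ^ k * h \<mu>) \<xi> = 0"
proof -
  have "(deriv ^^ j) (\<lambda>\<mu>. (\<mu> - \<xi>) ^ k * h \<mu>) \<xi> =
    (\<Sum>i = 0..j. of_nat (j choose i) * (deriv ^^ i) (\<lambda>\<mu>. (\<mu> - \<xi>) ^ k) \<xi> * (deriv ^^ (j - i)) h \<xi>)"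
    by (rule higher_deriv_mult[OF _ assms(3,1,2)]) (intro holomorphic_intros)
  also have "\<dots> = 0"
    using assms(4) by (intro sum.neutral) (simp add: higher_deriv_power)
  finally show ?thesis .
qed


section \<open>Ends over a finite core\<close>

text \<open>Finitely many nonzero rows, each of finite support, form a finite sum of rank one
  operators. This handles every entry of the adjacency operator that touches the core.\<close>

lemma (in weighted_spaces) bop_finite_kernel:
  assumes "finite J" "J \<subseteq> V" "\<And>j. j \<in> J \<Longrightarrow> finite (I j) \<and> I j \<subseteq> V"
  shows "\<exists>B. bop X Y (\<lambda>f v. if v \<in> J then \<Sum>x\<in>I v. k v x * f x else 0) B"
proof -
  define C where "C = (\<lambda>j. \<Sum>x\<in>I j. cmod (k j x) * sqrt (w x))"
  define \<delta> :: "'v \<Rightarrow> 'v \<Rightarrow> complex" where "\<delta> = (\<lambda>j v. if v = j then 1 else (0 :: complex))"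
  have \<delta>: "\<delta> j \<in> elems Y" if "j \<in> J" for j
    using Y.finite_support_elems(1)[of "{j}" "\<delta> j"] that assms(2) by (auto simp: \<delta>_def)
  have "bop X Y (\<lambda>f v. (\<Sum>x\<in>I j. k j x * f x) * \<delta> j v) (C j * fnorm Y (\<delta> j))" if j: "j \<in> J" for j
  proof (rule bop_rank_one)
    fix f assume f: "f \<in> elems X"
    have "cmod (\<Sum>x\<in>I j. k j x * f x) \<le> (\<Sum>x\<in>I j. cmod (k j x) * (sqrt (w x) * fnorm X f))"
      using assms(3)[OF j] X.cmod_le_fnorm[OF f]
      by (intro sum_norm_le) (auto simp: norm_mult subset_eq intro!: mult_left_mono)
    then show "cmod (\<Sum>x\<in>I j. k j x * f x) \<le> C j * fnorm X f"
      by (simp add: C_def sum_distrib_right mult.assoc)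
    show "(\<Sum>x\<in>I j. k j x * (c * f x)) = c * (\<Sum>x\<in>I j. k j x * f x)" for c
      by (simp add: sum_distrib_left mult_ac)
  next
    show "0 \<le> C j" unfolding C_def using assms(3)[OF j] X.weight_pos
      by (intro sum_nonneg mult_nonneg_nonneg) (auto simp: less_imp_le subset_eq)
  qed (auto simp: \<delta>[OF j] distrib_left sum.distrib)
  then have "bop X Y (\<lambda>f v. \<Sum>j\<in>J. (\<Sum>x\<in>I j. k j x * f x) * \<delta> j v) (\<Sum>j\<in>J. C j * fnorm Y (\<delta> j))"
    by (rule bop_sum[OF assms(1)])
  moreover have "(\<Sum>j\<in>J. (\<Sum>x\<in>I j. k j x * f x) * \<delta> j v) = (if v \<in> J then \<Sum>x\<in>I v. k v x * f x else 0)" for f v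
    using assms(1) by (simp add: \<delta>_def if_distrib[where f = "(*) _"] sum.delta cong: if_cong)
  ultimately show ?thesis by auto
qed

text \<open>
  The geometry seen by the adjacency operator: outside the finite core \<open>L\<close> every vertex \<open>u\<close> has
  one neighbour \<open>par u\<close> closer to the base point, and its other neighbours are its children. For a
  graph of groups, \<open>S\<close> and \<open>s\<close> are the orders of \<open>G_u\<close> and of the group of the edge joining \<open>u\<close>
  to \<open>par u\<close>. For funnels and cusps alike, being \<open>(q + 1)\<close>-regular amounts to \<open>regular\<close>.
\<close>

locale ended_space =
  fixes V L :: "'v set" and S s :: "'v \<Rightarrow> real" and par :: "'v \<Rightarrow> 'v" and lev :: "'v \<Rightarrow> nat"
    and a :: "'v \<Rightarrow> 'v \<Rightarrow> real" and q :: nat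
  assumes q_pos: "0 < q"
    and finite_core: "finite L" and core: "L \<subseteq> V"
    and S_pos: "v \<in> V \<Longrightarrow> 0 < S v" and s_pos: "v \<in> V - L \<Longrightarrow> 0 < s v"
    and par_in: "v \<in> V - L \<Longrightarrow> par v \<in> V"
    and lev_par: "v \<in> V - L \<Longrightarrow> lev v = Suc (lev (par v))"
    and finite_children: "v \<in> V \<Longrightarrow> finite {u \<in> V - L. par u = v}"
    and regular: "v \<in> V - L \<Longrightarrow> (\<Sum>u | u \<in> V - L \<and> par u = v. S v * S u / (s u)\<^sup>2) = real q"
begin

definition ch :: "'v \<Rightarrow> 'v set" where
  "ch v = {u \<in> V - L. par u = v}"

text \<open>For \<open>b = q powr (- N)\<close> and \<open>lev\<close> the distance from the base
  point, \<open>sp b\<close> is the decaying space and \<open>sp (1 / b)\<close> the growing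
  one.\<close>

definition wt :: "real \<Rightarrow> 'v \<Rightarrow> real" where
  "wt b v = (b ^ lev v)\<^sup>2 * S v"

abbreviation sp :: "real \<Rightarrow> 'v fun_space" where
  "sp b \<equiv> wsp V (wt b)"

definition up :: "'v operator" where
  "up f v = (if v \<in> V - L then \<Sum>u\<in>ch v. of_real (S v / s u) * f u else 0)"

text \<open>Cut off where the parent lies in the core, so that \<open>up\<close> and
  \<open>down\<close> act within the ends; the omitted entries couple an end to the core.\<close>

definition down :: "'v operator" where
  "down f v = (if v \<in> V - L \<and> par v \<in> V - L then of_real (S v / s v) * f (par v) else 0)"

definition ends :: "'v operator" where
  "ends f v = (if v \<in> V - L then f v else 0)"

definition adj :: "'v operator" where
  "adj f v =
    (if v \<in> L then (\<Sum>w\<in>L. of_real (a v w) * f w) + (\<Sum>u\<in>ch v. of_real (S v / s u) * f u)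
     else if v \<in> V then (\<Sum>u\<in>ch v. of_real (S v / s u) * f u) + of_real (S v / s v) * f (par v)
     else 0)"

lemma ch_finite: "v \<in> V \<Longrightarrow> finite (ch v)"
  using finite_children by (simp add: ch_def)

lemma ch_regular: "v \<in> V - L \<Longrightarrow> (\<Sum>u\<in>ch v. S v * S u / (s u)\<^sup>2) = real q"
  using regular by (simp add: ch_def)

lemma chD: "u \<in> ch v \<Longrightarrow> u \<in> V - L \<and> par u = v \<and> lev u = Suc (lev v)"
  using lev_par by (auto simp: ch_def)

lemma wt_pos: "0 < b \<Longrightarrow> v \<in> V \<Longrightarrow> 0 < wt b v"
  using S_pos by (simp add: wt_def)

lemma wt_Suc: "lev u = Suc (lev v) \<Longrightarrow> wt b u = b\<^sup>2 * ((b ^ lev v)\<^sup>2 * S u)"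
  by (simp add: wt_def power_mult_distrib mult_ac)

lemma weighted_space: "0 < b \<Longrightarrow> weighted_space V (wt b)"
  by unfold_locales (rule wt_pos)

text \<open>Cauchy-Schwarz with the coefficient \<open>S v / s u\<close> split into
  \<open>sqrt (S v * S u) / s u\<close> and \<open>sqrt (S v / S u)\<close>: the squares of the
  first factors add up to \<open>q\<close> by \<open>regular\<close>, the second factors turn the
  weight of \<open>u\<close> into that of \<open>v\<close>. The step of one level gives
  \<open>b\<^sup>2\<close>.\<close>

lemma up_term_le:
  assumes b: "0 < b" and v: "v \<in> V - L"
  shows "(cmod (up f v))\<^sup>2 / wt b v \<le> (\<Sum>u\<in>ch v. real q * b\<^sup>2 * ((cmod (f u))\<^sup>2 / wt b u))"
proof -
  have Sv: "0 < S v" using v S_pos by simp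
  have Su: "u \<in> ch v \<Longrightarrow> 0 < S u \<and> 0 < s u" for u using chD S_pos s_pos by blast
  have "cmod (up f v) \<le> (\<Sum>u\<in>ch v. cmod (of_real (S v / s u) * f u))"
    unfolding up_def using v by (simp add: norm_sum)
  also have "\<dots> = (\<Sum>u\<in>ch v. S v / s u * cmod (f u))"
  proof (rule sum.cong[OF refl])
    fix u assume "u \<in> ch v"
    then have "0 < s u" using Su by blast
    then show "cmod (of_real (S v / s u) * f u) = S v / s u * cmod (f u)"
      using Sv by (simp add: norm_mult norm_divide)
  qed
  also have "\<dots> = (\<Sum>u\<in>ch v. (sqrt (S v * S u) / s u) * (sqrt (S v / S u) * cmod (f u)))"
  proof (rule sum.cong[OF refl])
    fix u assume "u \<in> ch v"
    then have "0 < S u" "0 < s u" using Su by blast+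
    then show "S v / s u * cmod (f u) = (sqrt (S v * S u) / s u) * (sqrt (S v / S u) * cmod (f u))"
      using Sv by (simp add: real_sqrt_mult real_sqrt_divide field_simps)
  qed
  finally have "(cmod (up f v))\<^sup>2 \<le> (\<Sum>u\<in>ch v. (sqrt (S v * S u) / s u) * (sqrt (S v / S u) * cmod (f u)))\<^sup>2"
    by (rule power_mono) simp
  also have "\<dots> \<le> (\<Sum>u\<in>ch v. (sqrt (S v * S u) / s u)\<^sup>2) * (\<Sum>u\<in>ch v. (sqrt (S v / S u) * cmod (f u))\<^sup>2)"
    by (rule Cauchy_Schwarz_ineq_sum)
  also have "(\<Sum>u\<in>ch v. (sqrt (S v * S u) / s u)\<^sup>2) = (\<Sum>u\<in>ch v. S v * S u / (s u)\<^sup>2)"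
    using Sv Su by (intro sum.cong) (auto simp: power_divide less_imp_le)
  also have "\<dots> = real q" by (rule ch_regular[OF v])
  also have "(\<Sum>u\<in>ch v. (sqrt (S v / S u) * cmod (f u))\<^sup>2) = (\<Sum>u\<in>ch v. S v * ((cmod (f u))\<^sup>2 / S u))"
    using Sv Su by (intro sum.cong) (auto simp: power_mult_distrib less_imp_le)
  finally have "(cmod (up f v))\<^sup>2 / wt b v \<le> real q * (\<Sum>u\<in>ch v. S v * ((cmod (f u))\<^sup>2 / S u)) / wt b v"
    using wt_pos[OF b, of v] v by (intro divide_right_mono) auto
  also have "\<dots> = (\<Sum>u\<in>ch v. real q * b\<^sup>2 * ((cmod (f u))\<^sup>2 / wt b u))"
    unfolding sum_distrib_left sum_divide_distrib
  proof (rule sum.cong[OF refl])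
    fix u assume u: "u \<in> ch v"
    have "wt b u = b\<^sup>2 * ((b ^ lev v)\<^sup>2 * S u)" using chD[OF u] by (intro wt_Suc) simp
    then show "real q * (S v * ((cmod (f u))\<^sup>2 / S u)) / wt b v = real q * b\<^sup>2 * ((cmod (f u))\<^sup>2 / wt b u)"
      unfolding wt_def[of b v] using b Sv by (simp add: field_simps)
  qed
  finally show ?thesis .
qed

lemma bopI:
  assumes b: "0 < b" "0 < b'" and C: "0 \<le> C"
    and add: "\<And>f g v. T (\<lambda>v. f v + g v) v = T f v + T g v"
    and scale: "\<And>f c v. T (\<lambda>v. c * f v) v = c * T f v"
    and off: "\<And>f v. f \<in> elems (sp b) \<Longrightarrow> v \<notin> V \<Longrightarrow> T f v = 0"
    and bd: "\<And>f F. f \<in> elems (sp b) \<Longrightarrow> finite F \<Longrightarrow> F \<subseteq> V \<Longrightarrow>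
      (\<Sum>v\<in>F. (cmod (T f v))\<^sup>2 / wt b' v) \<le> C\<^sup>2 * (fnorm (sp b) f)\<^sup>2"
  shows "bop (sp b) (sp b') T C"
proof -
  interpret X: weighted_space V "wt b" by (rule weighted_space[OF b(1)])
  interpret Y: weighted_space V "wt b'" by (rule weighted_space[OF b(2)])
  have l: "lnorm (wt b') F (T f) \<le> C * fnorm (sp b) f"
    if "f \<in> elems (sp b)" "finite F" "F \<subseteq> V" for F f
  proof -
    have "(lnorm (wt b') F (T f))\<^sup>2 \<le> (C * fnorm (sp b) f)\<^sup>2"
      using bd[OF that] Y.lnorm_square[OF that(3)] by (simp add: power_mult_distrib)
    then show ?thesis using C X.fnorm_nonneg by (meson mult_nonneg_nonneg power2_le_imp_le)
  qed
  show ?thesis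
    unfolding bop_def using Y.elems_bound[OF off l] add scale by (auto simp: fun_eq_iff)
qed

text \<open>Every vertex has one parent, so sets of children are disjoint and the local estimates
  add up without overlap.\<close>

lemma up_bop:
  assumes b: "0 < b"
  shows "bop (sp b) (sp b) up (sqrt (real q) * b)"
proof (rule bopI[OF b b])
  interpret X: weighted_space V "wt b" by (rule weighted_space[OF b])
  show "0 \<le> sqrt (real q) * b" using b by simp
  show "up (\<lambda>v. f v + g v) v = up f v + up g v" for f g v
    by (simp add: up_def distrib_left sum.distrib)
  show "up (\<lambda>v. c * f v) v = c * up f v" for f c v
    by (simp add: up_def sum_distrib_left mult_ac)
  show "up f v = 0" if "v \<notin> V" for f v using that by (simp add: up_def)
  fix f F assume f: "f \<in> elems (sp b)" and F: "finite F" "F \<subseteq> V"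
  define G where "G = (\<Union>v\<in>F - L. ch v)"
  have G: "finite G" "G \<subseteq> V" using F ch_finite chD by (auto simp: G_def)
  have "(\<Sum>v\<in>F. (cmod (up f v))\<^sup>2 / wt b v) = (\<Sum>v\<in>F - L. (cmod (up f v))\<^sup>2 / wt b v)"
    using F by (intro sum.mono_neutral_right) (auto simp: up_def)
  also have "\<dots> \<le> (\<Sum>v\<in>F - L. \<Sum>u\<in>ch v. real q * b\<^sup>2 * ((cmod (f u))\<^sup>2 / wt b u))"
    using F by (intro sum_mono up_term_le[OF b]) auto
  also have "\<dots> = (\<Sum>u\<in>G. real q * b\<^sup>2 * ((cmod (f u))\<^sup>2 / wt b u))"
    unfolding G_def
  proof (rule sum.UNION_disjoint[symmetric])
    show "\<forall>v\<in>F - L. finite (ch v)" using F ch_finite by blast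
    show "\<forall>v\<in>F - L. \<forall>v'\<in>F - L. v \<noteq> v' \<longrightarrow> ch v \<inter> ch v' = {}" by (auto simp: ch_def)
  qed (use F in simp)
  also have "\<dots> = real q * b\<^sup>2 * (lnorm (wt b) G f)\<^sup>2"
    by (simp add: X.lnorm_square[OF G(2)] sum_distrib_left)
  also have "\<dots> \<le> real q * b\<^sup>2 * (fnorm (sp b) f)\<^sup>2"
    using X.lnorm_le_fnorm[OF f G] by (intro mult_left_mono power_mono) (auto simp: lnorm_nonneg)
  finally show "(\<Sum>v\<in>F. (cmod (up f v))\<^sup>2 / wt b v) \<le> (sqrt (real q) * b)\<^sup>2 * (fnorm (sp b) f)\<^sup>2"
    by (simp add: power_mult_distrib)
qed

text \<open>\<open>down\<close> passes multiples of the value at \<open>v\<close> to the children of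
  \<open>v\<close>. By \<open>regular\<close> their squared contributions sum to
  \<open>q / b\<^sup>2\<close> times the term of \<open>v\<close>, so Cauchy-Schwarz is not
  involved. Moving outwards costs \<open>1 / b\<close>, whence the interest in
  \<open>sp (1 / b)\<close>.\<close>

lemma down_bop:
  assumes b: "0 < b"
  shows "bop (sp b) (sp b) down (sqrt (real q) / b)"
proof (rule bopI[OF b b])
  interpret X: weighted_space V "wt b" by (rule weighted_space[OF b])
  show "0 \<le> sqrt (real q) / b" using b by simp
  show "down (\<lambda>v. f v + g v) v = down f v + down g v" for f g v
    by (simp add: down_def distrib_left)
  show "down (\<lambda>v. c * f v) v = c * down f v" for f c v
    by (simp add: down_def)
  show "down f v = 0" if "v \<notin> V" for f v using that by (simp add: down_def)
  fix f F assume f: "f \<in> elems (sp b)" and F: "finite F" "F \<subseteq> V"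
  define F' where "F' = {u \<in> F. u \<in> V - L \<and> par u \<in> V - L}"
  define G where "G = par ` F'"
  have F': "finite F'" "F' \<subseteq> V" using F by (auto simp: F'_def)
  have G: "finite G" "G \<subseteq> V - L" using F' by (auto simp: G_def F'_def)
  define t where "t = (\<lambda>u. S (par u) * S u / (s u)\<^sup>2 * ((cmod (f (par u)))\<^sup>2 / wt b (par u) / b\<^sup>2))"
  have t: "(cmod (down f u))\<^sup>2 / wt b u = t u" if "u \<in> F'" for u
  proof -
    have u: "u \<in> V - L" "par u \<in> V - L" using that by (auto simp: F'_def)
    have "wt b u = b\<^sup>2 * ((b ^ lev (par u))\<^sup>2 * S u)" using lev_par[OF u(1)] by (rule wt_Suc)
    then show ?thesis
      using u S_pos[of u] S_pos[of "par u"] s_pos[of u] b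
      by (simp add: t_def down_def wt_def norm_mult norm_divide power_mult_distrib power_divide
        power2_eq_square field_simps)
  qed
  have t0: "0 \<le> t u" if "u \<in> V - L" "par u \<in> V - L" for u
    unfolding t_def using that S_pos[of u] S_pos[of "par u"] wt_pos[OF b, of "par u"]
    by (intro mult_nonneg_nonneg divide_nonneg_nonneg) (auto simp: less_imp_le)
  have "(\<Sum>v\<in>F. (cmod (down f v))\<^sup>2 / wt b v) = (\<Sum>v\<in>F'. (cmod (down f v))\<^sup>2 / wt b v)"
    using F by (intro sum.mono_neutral_right) (auto simp: down_def F'_def)
  also have "\<dots> = (\<Sum>v\<in>F'. t v)" by (rule sum.cong[OF refl t])
  also have "\<dots> = (\<Sum>v\<in>G. \<Sum>u\<in>{u\<in>F'. par u = v}. t u)"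
    unfolding G_def by (rule sum.image_gen[OF F'(1)])
  \<comment> \<open>The sum is enlarged from the children lying in \<open>F\<close> to all children,
    since \<open>regular\<close> speaks of the complete sum.\<close>
  also have "\<dots> \<le> (\<Sum>v\<in>G. \<Sum>u\<in>ch v. t u)"
    using G ch_finite t0 by (intro sum_mono sum_mono2) (auto simp: ch_def F'_def)
  also have "\<dots> = (\<Sum>v\<in>G. \<Sum>u\<in>ch v. S v * S u / (s u)\<^sup>2 * ((cmod (f v))\<^sup>2 / wt b v / b\<^sup>2))"
    unfolding t_def using chD by (intro sum.cong) auto
  also have "\<dots> = (\<Sum>v\<in>G. real q / b\<^sup>2 * ((cmod (f v))\<^sup>2 / wt b v))"
  proof (rule sum.cong[OF refl])
    fix v assume "v \<in> G"
    then show "(\<Sum>u\<in>ch v. S v * S u / (s u)\<^sup>2 * ((cmod (f v))\<^sup>2 / wt b v / b\<^sup>2)) = real q / b\<^sup>2 * ((cmod (f v))\<^sup>2 / wt b v)"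
      unfolding sum_distrib_right[symmetric] using G ch_regular[of v] by (auto simp: mult_ac)
  qed
  also have "\<dots> = real q / b\<^sup>2 * (lnorm (wt b) G f)\<^sup>2"
    using X.lnorm_square[OF subset_trans[OF G(2) Diff_subset], of f] by (simp add: sum_distrib_left)
  also have "\<dots> \<le> real q / b\<^sup>2 * (fnorm (sp b) f)\<^sup>2"
    using X.lnorm_le_fnorm[OF f G(1)] G(2) by (intro mult_left_mono power_mono) (auto simp: lnorm_nonneg)
  finally show "(\<Sum>v\<in>F. (cmod (down f v))\<^sup>2 / wt b v) \<le> (sqrt (real q) / b)\<^sup>2 * (fnorm (sp b) f)\<^sup>2"
    by (simp add: power_divide)
qed

lemma ends_bop:
  assumes b: "0 < b"
  shows "bop (sp b) (sp b) ends 1"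
proof (rule bopI[OF b b])
  interpret X: weighted_space V "wt b" by (rule weighted_space[OF b])
  fix f F assume f: "f \<in> elems (sp b)" and F: "finite F" "F \<subseteq> V"
  have "(\<Sum>v\<in>F. (cmod (ends f v))\<^sup>2 / wt b v) \<le> (\<Sum>v\<in>F. (cmod (f v))\<^sup>2 / wt b v)"
    using F X.term_nonneg by (intro sum_mono) (auto simp: ends_def)
  also have "\<dots> = (lnorm (wt b) F f)\<^sup>2" by (simp add: X.lnorm_square[OF F(2)])
  also have "\<dots> \<le> (fnorm (sp b) f)\<^sup>2"
    using X.lnorm_le_fnorm[OF f F] by (intro power_mono) (auto simp: lnorm_nonneg)
  finally show "(\<Sum>v\<in>F. (cmod (ends f v))\<^sup>2 / wt b v) \<le> 1\<^sup>2 * (fnorm (sp b) f)\<^sup>2" by simp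
qed (auto simp: ends_def)

lemma inclusion_bop:
  assumes b: "0 < b" "b \<le> b'"
  shows "bop (sp b) (sp b') (\<lambda>f. f) 1"
proof (rule bopI)
  show "0 < b" "0 < b'" using b by auto
  interpret X: weighted_space V "wt b" by (rule weighted_space[OF b(1)])
  show "f v = 0" if "f \<in> elems (sp b)" "v \<notin> V" for f v using X.elems_off that by blast
  fix f F assume f: "f \<in> elems (sp b)" and F: "finite F" "F \<subseteq> V"
  have "wt b v \<le> wt b' v" if "v \<in> V" for v
    unfolding wt_def using S_pos[OF that] b by (intro mult_right_mono power_mono) auto
  then have "(\<Sum>v\<in>F. (cmod (f v))\<^sup>2 / wt b' v) \<le> (\<Sum>v\<in>F. (cmod (f v))\<^sup>2 / wt b v)"
    using F b wt_pos[of b] wt_pos[of b'] by (intro sum_mono divide_left_mono mult_pos_pos) auto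
  also have "\<dots> = (lnorm (wt b) F f)\<^sup>2" by (simp add: X.lnorm_square[OF F(2)])
  also have "\<dots> \<le> (fnorm (sp b) f)\<^sup>2"
    using X.lnorm_le_fnorm[OF f F] by (intro power_mono) (auto simp: lnorm_nonneg)
  finally show "(\<Sum>v\<in>F. (cmod (f v))\<^sup>2 / wt b' v) \<le> 1\<^sup>2 * (fnorm (sp b) f)\<^sup>2" by simp
qed auto

definition roots :: "'v set" where
  "roots = {u \<in> V - L. par u \<in> L}"

lemma roots_finite: "finite roots"
proof -
  have "roots = (\<Union>l\<in>L. ch l)" by (auto simp: roots_def ch_def)
  then show ?thesis using finite_core core ch_finite by auto
qed

lemma adj_bop: "\<exists>B\<ge>0. bop (sp 1) (sp 1) adj B"
proof -
  interpret weighted_spaces V "wt 1" "wt 1" by (simp add: weighted_spaces_def weighted_space)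
  \<comment> \<open>Besides \<open>up\<close> and \<open>down\<close> the operator consists of three
    finite kernels: within the core, from the roots of the ends into the core, and from the core to
    those roots.\<close>
  obtain B1 where B1: "bop X X (\<lambda>f v. if v \<in> L then \<Sum>x\<in>L. of_real (a v x) * f x else 0) B1"
    using bop_finite_kernel[of L "\<lambda>_. L" "\<lambda>v x. of_real (a v x)"] finite_core core by blast
  obtain B2 where B2: "bop X X (\<lambda>f v. if v \<in> L then \<Sum>u\<in>ch v. of_real (S v / s u) * f u else 0) B2"
    using bop_finite_kernel[of L ch "\<lambda>v u. of_real (S v / s u)"] finite_core core ch_finite chD by blast
  obtain B3 where B3: "bop X X (\<lambda>f v. if v \<in> roots then \<Sum>u\<in>{par v}. of_real (S v / s v) * f u else 0) B3"
    using bop_finite_kernel[of roots "\<lambda>v. {par v}" "\<lambda>v u. of_real (S v / s v)"] roots_finite core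
    by (auto simp: roots_def)
  have "bop X X (\<lambda>f v. up f v + down f v
      + ((if v \<in> L then \<Sum>x\<in>L. of_real (a v x) * f x else 0)
      + ((if v \<in> L then \<Sum>u\<in>ch v. of_real (S v / s u) * f u else 0)
      + (if v \<in> roots then \<Sum>u\<in>{par v}. of_real (S v / s v) * f u else 0))))
      (sqrt (real q) * 1 + sqrt (real q) / 1 + (B1 + (B2 + B3)))"
    by (intro bop_add up_bop down_bop B1 B2 B3) auto
  moreover have "(\<lambda>f v. up f v + down f v
      + ((if v \<in> L then \<Sum>x\<in>L. of_real (a v x) * f x else 0)
      + ((if v \<in> L then \<Sum>u\<in>ch v. of_real (S v / s u) * f u else 0)
      + (if v \<in> roots then \<Sum>u\<in>{par v}. of_real (S v / s v) * f u else 0)))) = adj"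
    using core par_in by (auto simp: fun_eq_iff adj_def up_def down_def roots_def)
  ultimately show ?thesis using bop_nonneg by (metis abs_ge_zero)
qed

lemma adj_pointwise_continuous:
  assumes "\<And>v. (\<lambda>n. g n v) \<longlonglongrightarrow> f v"
  shows "(\<lambda>n. adj (g n) v) \<longlonglongrightarrow> adj f v"
  unfolding adj_def by (cases "v \<in> L"; cases "v \<in> V") (auto intro!: tendsto_intros assms simp del: of_real_divide)

lemma up_neumann: "0 < b \<Longrightarrow> neumann_operator V (wt b) up (sqrt (real q) * b)"
  by (intro neumann_operator.intro weighted_space neumann_operator_axioms.intro up_bop)
    (auto simp: up_def simp del: of_real_divide intro!: tendsto_intros)

text \<open>On the reciprocal weight \<open>down\<close> has the same bound as \<open>up\<close> on
  the original one, so both Neumann series converge under one condition on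
  \<open>\<mu>\<close>.\<close>

lemma down_neumann: "0 < b \<Longrightarrow> neumann_operator V (wt (1 / b)) down (sqrt (real q) * b)"
  using down_bop[of "1 / b"]
  by (intro neumann_operator.intro weighted_space neumann_operator_axioms.intro)
    (auto simp: down_def simp del: of_real_divide intro!: tendsto_intros)

lemma adj_add: "adj (\<lambda>v. f v + g v) v = adj f v + adj g v"
  by (simp add: adj_def distrib_left sum.distrib)

lemma adj_scale: "adj (\<lambda>v. c * f v) v = c * adj f v"
  by (simp add: adj_def sum_distrib_left distrib_left mult_ac)

lemma adj_sum: "finite I \<Longrightarrow> adj (\<lambda>v. \<Sum>i\<in>I. f i v) v = (\<Sum>i\<in>I. adj (f i) v)"
proof (induction I rule: finite_induct)
  case empty
  show ?case by (simp add: adj_def)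
next
  case (insert i I)
  then show ?case by (simp add: adj_add)
qed

lemma up_add: "up (\<lambda>v. f v + c * g v) v = up f v + c * up g v"
  by (simp add: up_def distrib_left sum.distrib sum_distrib_left mult_ac add_divide_distrib)

text \<open>On the children of \<open>v\<close>, \<open>down f\<close> involves no value of
  \<open>f\<close> other than \<open>f v\<close>; the coefficients \<open>S v / s u\<close> and
  \<open>S u / s u\<close> multiply to the summands of \<open>regular\<close>. The cut-off in
  \<open>down\<close> does no harm here, because \<open>v\<close> itself lies in an end.\<close>

lemma up_down: "v \<in> V - L \<Longrightarrow> up (down f) v = of_nat q * f v"
proof -
  assume v: "v \<in> V - L"
  have "up (down f) v = (\<Sum>u\<in>ch v. of_real (S v * S u / (s u)\<^sup>2) * f v)"
    using v chD by (auto simp: up_def down_def power2_eq_square intro!: sum.cong)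
  also have "\<dots> = of_real (\<Sum>u\<in>ch v. S v * S u / (s u)\<^sup>2) * f v"
    by (simp add: sum_distrib_right)
  finally show ?thesis using ch_regular[OF v] by simp
qed

lemma adj_ends:
  assumes "\<And>v. v \<notin> V - L \<Longrightarrow> f v = 0"
  shows "v \<in> V - L \<Longrightarrow> adj f v = up f v + down f v"
    and "v \<in> L \<Longrightarrow> adj f v = (\<Sum>u\<in>ch v. of_real (S v / s u) * f u)"
  using assms by (auto simp: adj_def up_def down_def)

text \<open>A power of \<open>down\<close> looks at a single ancestor. The constant does not depend
  on \<open>g\<close>, so holomorphy passes through even when \<open>g\<close> varies with the
  parameter.\<close>

lemma down_power_kernel: "\<exists>c. \<forall>g. (down ^^ n) g v = c * g ((par ^^ n) v)"
proof (induction n arbitrary: v)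
  case 0
  show ?case by (intro exI[of _ 1]) simp
next
  case (Suc n)
  obtain c where c: "\<forall>g. (down ^^ n) g (par v) = c * g ((par ^^ n) (par v))" using Suc by blast
  have "(down ^^ Suc n) g v = (if v \<in> V - L \<and> par v \<in> V - L then of_real (S v / s v) else 0) * (down ^^ n) g (par v)" for g
    by (simp add: down_def[of "(down ^^ n) g"])
  then show ?case
    by (intro exI[of _ "(if v \<in> V - L \<and> par v \<in> V - L then of_real (S v / s v) else 0) * c"])
      (simp only: c[rule_format] funpow_Suc_right[of n par] o_apply mult.assoc, blast)
qed

text \<open>Each application climbs to a parent and lowers \<open>lev\<close> by one, so after more
  than \<open>lev v\<close> steps the ends have been left.\<close>

lemma down_power_zero: "lev v < n \<Longrightarrow> (down ^^ n) g v = 0"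
proof (induction n arbitrary: v)
  case (Suc n)
  then show ?case using lev_par[of v] by (auto simp: down_def)
qed simp

text \<open>At each vertex the series is a finite sum, hence it makes sense for every
  \<open>c\<close> and every \<open>g\<close>; norms only matter for boundedness.\<close>

lemma neumann_down: "neumann down c g v = (\<Sum>n\<le>lev v. c ^ n * (down ^^ n) g v)"
  unfolding neumann_def by (rule suminf_finite) (auto simp: down_power_zero)

lemma neumann_down_holomorphic:
  assumes "h holomorphic_on A" "\<And>v. (\<lambda>\<mu>. g \<mu> v) holomorphic_on A"
  shows "(\<lambda>\<mu>. neumann down (h \<mu>) (g \<mu>) v) holomorphic_on A"
proof -
  have "(\<lambda>\<mu>. (down ^^ n) (g \<mu>) v) holomorphic_on A" for n
  proof -
    obtain c where "\<forall>g. (down ^^ n) g v = c * g ((par ^^ n) v)" using down_power_kernel by blast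
    then show ?thesis using assms(2) by (auto intro!: holomorphic_intros)
  qed
  then show ?thesis unfolding neumann_down by (intro holomorphic_intros assms(1))
qed

lemma neumann_down_eq: "neumann down c g v = g v + c * down (neumann down c g) v"
proof -
  have "down (\<lambda>v. \<Sum>n\<le>lev v. c ^ n * (down ^^ n) g v) v = (\<Sum>n<lev v. c ^ n * (down ^^ Suc n) g v)"
  proof (cases "v \<in> V - L \<and> par v \<in> V - L")
    case True
    \<comment> \<open>The finite sum at the parent stops one term earlier, which matches the shift
      of the power of \<open>down\<close>.\<close>
    then have "{..<lev v} = {..lev (par v)}" using lev_par[of v] by auto
    then show ?thesis using True by (simp add: down_def sum_distrib_left mult_ac)
  next
    case False
    then show ?thesis by (auto simp: down_def intro!: sum.neutral[symmetric])
  qed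
  then have "c * down (neumann down c g) v = (\<Sum>n<lev v. c ^ Suc n * (down ^^ Suc n) g v)"
    by (simp add: neumann_down[abs_def] sum_distrib_left mult.assoc)
  then show ?thesis
    unfolding neumann_down by (simp add: sum.atMost_shift)
qed

end


section \<open>Elimination of the ends\<close>

context ended_space
begin

text \<open>The parameter \<open>t\<close> of the factorisation.\<close>

definition sc :: "complex \<Rightarrow> complex" where
  "sc \<mu> = inverse (of_real (sqrt (real q)) * \<mu>)"

definition cc :: real where
  "cc = 1 / (2 * sqrt (real q))"

definition shifted :: "complex \<Rightarrow> 'v operator" where
  "shifted \<mu> f v = of_real cc * adj f v - z \<mu> * f v"

definition up_res :: "complex \<Rightarrow> 'v operator" where
  "up_res \<mu> f = neumann up (sc \<mu>) (ends f)"

text \<open>Inverse of the end block. The factors come in reverse order, so that each Neumann series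
  receives a function from a space on which it converges.\<close>

definition ends_res :: "complex \<Rightarrow> 'v operator" where
  "ends_res \<mu> f v = - (2 / \<mu>) * neumann down (sc \<mu>) (up_res \<mu> f) v"

definition root_edge :: "'v \<Rightarrow> 'v \<Rightarrow> complex" where
  "root_edge k v = (if v \<in> ch k then of_real (S v / s v) else 0)"

text \<open>Extension of the delta function at \<open>k\<close> solving the equation on the ends.
  The coupling \<open>root_edge k\<close> lives on roots and is annihilated by \<open>up\<close>, so
  the first factor acts trivially; what is left is a finite sum at each vertex, meaningful for all
  \<open>\<mu> \<noteq> 0\<close>.\<close>

definition core_fun :: "'v \<Rightarrow> complex \<Rightarrow> 'v \<Rightarrow> complex" where
  "core_fun k \<mu> v = (if v = k then 1 else 0) + sc \<mu> * neumann down (sc \<mu>) (root_edge k) v"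

text \<open>Right-hand side left on the core once the ends are solved. On the roots the inverse of
  the \<open>down\<close> factor is the identity, hence only \<open>up_res\<close> occurs.\<close>

definition core_val :: "'v \<Rightarrow> complex \<Rightarrow> ('v \<Rightarrow> complex) \<Rightarrow> complex" where
  "core_val l \<mu> f = f l + sc \<mu> * (\<Sum>u\<in>ch l. of_real (S l / s u) * up_res \<mu> f u)"

definition root_weight :: "'v \<Rightarrow> real" where
  "root_weight l = (\<Sum>u\<in>ch l. S l * S u / (s u)\<^sup>2)"

text \<open>Schur complement of the end block. Every root has its only parent in the core, so the
  ends add just a diagonal multiple of \<open>1 / \<mu>\<close>.\<close>

definition core_matrix :: "complex \<Rightarrow> 'v \<Rightarrow> 'v \<Rightarrow> complex" where
  "core_matrix \<mu> l k = of_real (cc * a l k)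
    + (if l = k then of_real (root_weight l) / (2 * of_nat q * \<mu>) - z \<mu> else 0)"

definition core_poly :: "'v \<Rightarrow> 'v \<Rightarrow> complex poly" where
  "core_poly l k = [:0, of_real (cc * a l k):]
    + (if l = k then [:of_real (root_weight l) / (2 * of_nat q) - 1 / 2, 0, - 1 / 2:] else 0)"

lemma core_poly_eq: "\<mu> \<noteq> 0 \<Longrightarrow> poly (core_poly l k) \<mu> = \<mu> * core_matrix \<mu> l k"
  using q_pos by (simp add: core_poly_def core_matrix_def z_def field_simps)

lemma sc_cc:
  assumes "\<mu> \<noteq> 0"
  shows "sc \<mu> * sc \<mu> * of_nat q = 1 / \<mu>\<^sup>2" and "of_real cc = sc \<mu> * \<mu> / 2"
    and "of_real cc * sc \<mu> = 1 / (2 * of_nat q * \<mu>)"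
proof -
  define r where "r = complex_of_real (sqrt (real q))"
  have r: "r * r = of_nat q" "r \<noteq> 0"
  proof -
    have "r * r = of_real (sqrt (real q) * sqrt (real q))" unfolding r_def by (rule of_real_mult[symmetric])
    then show "r * r = of_nat q" by simp
    show "r \<noteq> 0" using q_pos by (simp add: r_def)
  qed
  have sc: "sc \<mu> = 1 / (r * \<mu>)" unfolding sc_def r_def by (rule inverse_eq_divide)
  have cc: "of_real cc = 1 / (2 * r)" by (simp add: cc_def r_def)
  have "1 / (r * \<mu>) * (1 / (r * \<mu>)) * (r * r) = 1 / \<mu>\<^sup>2"
    using r(2) assms by (simp add: power2_eq_square)
  then show "sc \<mu> * sc \<mu> * of_nat q = 1 / \<mu>\<^sup>2" by (simp only: sc r(1))
  show "of_real cc = sc \<mu> * \<mu> / 2" unfolding sc cc using r(2) assms by simp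
  have "1 / (2 * r) * (1 / (r * \<mu>)) = 1 / (2 * (r * r) * \<mu>)" by (simp add: mult_ac)
  then show "of_real cc * sc \<mu> = 1 / (2 * of_nat q * \<mu>)" by (simp only: sc cc r(1))
qed

lemma sc_holomorphic: "0 \<notin> A \<Longrightarrow> sc holomorphic_on A"
  unfolding sc_def[abs_def] using q_pos by (intro holomorphic_intros) auto

lemma sc_norm:
  assumes "0 < \<beta>" "\<beta> \<le> cmod \<mu>" "0 \<le> b"
  shows "cmod (sc \<mu>) * (sqrt (real q) * b) \<le> b / \<beta>"
proof -
  have "cmod (sc \<mu>) * (sqrt (real q) * b) = b / cmod \<mu>"
    using q_pos by (simp add: sc_def inverse_eq_divide norm_divide norm_mult)
  also have "\<dots> \<le> b / \<beta>" using assms by (intro divide_left_mono mult_pos_pos) auto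
  finally show ?thesis .
qed

lemma sc_small: "0 < b \<Longrightarrow> b < cmod \<mu> \<Longrightarrow> cmod (sc \<mu>) * (sqrt (real q) * b) < 1"
proof -
  assume *: "0 < b" "b < cmod \<mu>"
  have "cmod (sc \<mu>) * (sqrt (real q) * b) \<le> b / cmod \<mu>" using * by (intro sc_norm) auto
  also have "\<dots> < 1" using * by (subst divide_less_eq_1_pos) linarith+
  finally show ?thesis .
qed

lemma neumann_down_off: "(\<And>v. v \<notin> V - L \<Longrightarrow> g v = 0) \<Longrightarrow> v \<notin> V - L \<Longrightarrow> neumann down c g v = 0"
  using neumann_down_eq[of c g v] by (auto simp: down_def)

lemma neumann_down_root: "v \<in> roots \<Longrightarrow> neumann down c g v = g v"
  using neumann_down_eq[of c g v] by (auto simp: down_def roots_def)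

lemma shifted_add_sum:
  assumes "finite I"
  shows "shifted \<mu> (\<lambda>v. f v + (\<Sum>i\<in>I. c i * g i v)) v = shifted \<mu> f v + (\<Sum>i\<in>I. c i * shifted \<mu> (g i) v)"
  unfolding shifted_def adj_add adj_sum[OF assms] adj_scale
  by (simp add: algebra_simps sum_distrib_left sum_subtractf)

text \<open>Applying \<open>up\<close> to the fixed point equation of \<open>n\<close> turns
  \<open>up n\<close> into \<open>sc \<mu> * q * n\<close>. Hence on the ends the adjacency operator
  multiplies \<open>core_fun k \<mu>\<close> by a scalar, while on the core only the values of
  \<open>n\<close> at roots are felt.\<close>

lemma core_fun_shifted:
  assumes k: "k \<in> L" and \<mu>: "\<mu> \<noteq> 0"
  shows "v \<in> V - L \<Longrightarrow> shifted \<mu> (core_fun k \<mu>) v = 0"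
    and "v \<in> L \<Longrightarrow> shifted \<mu> (core_fun k \<mu>) v = core_matrix \<mu> v k"
    and "v \<in> L \<Longrightarrow> core_fun k \<mu> v = (if v = k then 1 else 0)"
proof -
  define \<beta> where "\<beta> = root_edge k"
  define n where "n = neumann down (sc \<mu>) \<beta>"
  have \<beta>0: "\<beta> v = 0" if "v \<notin> V - L" for v using that by (auto simp: \<beta>_def root_edge_def ch_def)
  have n0: "n v = 0" if "v \<notin> V - L" for v unfolding n_def by (rule neumann_down_off[OF \<beta>0 that])
  have n: "n v = \<beta> v + sc \<mu> * down n v" for v unfolding n_def by (rule neumann_down_eq)
  have cf: "core_fun k \<mu> = (\<lambda>v. (if v = k then 1 else 0) + sc \<mu> * n v)"
    by (simp add: core_fun_def n_def \<beta>_def fun_eq_iff)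
  have adjcf: "adj (core_fun k \<mu>) v = adj (\<lambda>v. if v = k then 1 else 0) v + sc \<mu> * adj n v" for v
    unfolding cf by (simp add: adj_add adj_scale)
  show "core_fun k \<mu> v = (if v = k then 1 else 0)" if "v \<in> L"
    unfolding cf using n0[of v] that by auto
  show "shifted \<mu> (core_fun k \<mu>) v = 0" if v: "v \<in> V - L"
  proof -
    have "(\<Sum>u\<in>ch v. of_real (S v / s u) * (if u = k then 1 else 0)) = (0 :: complex)"
      using k chD by (intro sum.neutral) auto
    then have d: "adj (\<lambda>v. if v = k then 1 else 0) v = \<beta> v"
      using v by (auto simp: adj_def \<beta>_def root_edge_def ch_def)
    \<comment> \<open>\<open>\<beta>\<close> is supported on children of the core vertex
      \<open>k\<close>, and none of these is a child of an end vertex.\<close>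
    have "up \<beta> v = 0"
      using v k by (auto simp: up_def \<beta>_def root_edge_def ch_def intro!: sum.neutral)
    moreover have "up n v = up (\<lambda>v. \<beta> v + sc \<mu> * down n v) v"
      by (rule arg_cong[where f = "\<lambda>h. up h v"]) (rule ext, rule n)
    ultimately have "up n v = sc \<mu> * (of_nat q * n v)"
      by (simp only: up_add up_down[OF v] add_0)
    with d have "adj (core_fun k \<mu>) v = \<beta> v + sc \<mu> * (sc \<mu> * (of_nat q * n v) + down n v)"
      unfolding adjcf using adj_ends(1)[of n v] n0 v by simp
    also have "\<dots> = (1 + sc \<mu> * sc \<mu> * of_nat q) * n v"
      using n[of v] by (simp add: algebra_simps)
    finally have "adj (core_fun k \<mu>) v = (1 + 1 / \<mu>\<^sup>2) * n v" by (simp add: sc_cc(1)[OF \<mu>])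
    moreover have "core_fun k \<mu> v = sc \<mu> * n v" using v k by (auto simp: cf)
    ultimately have "shifted \<mu> (core_fun k \<mu>) v = sc \<mu> * n v * (\<mu> / 2 * (1 + 1 / \<mu>\<^sup>2) - z \<mu>)"
    proof -
      define w where "w = 1 + 1 / \<mu>\<^sup>2"
      assume "adj (core_fun k \<mu>) v = (1 + 1 / \<mu>\<^sup>2) * n v" "core_fun k \<mu> v = sc \<mu> * n v"
      then show ?thesis
        unfolding shifted_def sc_cc(2)[OF \<mu>] w_def[symmetric] by (simp add: algebra_simps)
    qed
    \<comment> \<open>This is the purpose of the parametrisation: the scalar produced by the ends is
      exactly \<open>z \<mu>\<close>.\<close>
    moreover have "\<mu> / 2 * (1 + 1 / \<mu>\<^sup>2) - z \<mu> = 0"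
      using \<mu> by (simp add: z_def field_simps power2_eq_square)
    ultimately show ?thesis by simp
  qed
  show "shifted \<mu> (core_fun k \<mu>) v = core_matrix \<mu> v k" if v: "v \<in> L"
  proof -
    have "k \<notin> ch u" for u using k chD by blast
    then have "(\<Sum>u\<in>ch v. of_real (S v / s u) * (if u = k then 1 else 0)) = (0 :: complex)"
      by (intro sum.neutral) auto
    then have "adj (\<lambda>v. if v = k then 1 else 0) v = of_real (a v k)"
      using v k finite_core by (simp add: adj_def if_distrib[where f = "(*) _"] cong: if_cong)
    moreover have "adj n v = (\<Sum>u\<in>ch v. of_real (S v / s u) * n u)"
      using adj_ends(2)[of n v] n0 v by simp
    moreover have "\<dots> = (if v = k then of_real (root_weight v) else 0)"
    proof -
      have "n u = (if v = k then of_real (S u / s u) else 0)" if u: "u \<in> ch v" for u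
      proof -
        have "u \<in> roots" using u v by (auto simp: ch_def roots_def)
        then show ?thesis using neumann_down_root[of u "sc \<mu>" \<beta>] u
          by (auto simp: n_def \<beta>_def root_edge_def ch_def)
      qed
      then show ?thesis
        by (auto simp: root_weight_def power2_eq_square intro!: sum.cong sum.neutral)
    qed
    ultimately have "adj (core_fun k \<mu>) v = of_real (a v k) + sc \<mu> * (if v = k then of_real (root_weight v) else 0)"
      unfolding adjcf by simp
    moreover have "core_fun k \<mu> v = (if v = k then 1 else 0)"
      unfolding cf using n0[of v] v by auto
    ultimately have "shifted \<mu> (core_fun k \<mu>) v = of_real cc * of_real (a v k)
        + of_real cc * sc \<mu> * (if v = k then of_real (root_weight v) else 0) - z \<mu> * (if v = k then 1 else 0)"
      by (simp add: shifted_def algebra_simps)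
    then show ?thesis by (auto simp: sc_cc(3)[OF \<mu>] core_matrix_def)
  qed
qed

context
  fixes b :: real
  assumes b: "0 < b"
begin

text \<open>The gap between \<open>b\<close> and \<open>\<beta>\<close> makes the bound uniform in
  \<open>\<mu>\<close>: the ratio of the geometric series is at most
  \<open>b / \<beta>\<close>.\<close>

lemma up_res_bop:
  assumes "b < \<beta>" "\<beta> \<le> cmod \<mu>"
  shows "bop (sp b) (sp b) (up_res \<mu>) (1 / (1 - b / \<beta>))"
proof -
  interpret U: neumann_operator V "wt b" up "sqrt (real q) * b" by (rule up_neumann[OF b])
  have le: "cmod (sc \<mu>) * (sqrt (real q) * b) \<le> b / \<beta>" using assms b by (intro sc_norm) auto
  have lt: "b / \<beta> < 1" using assms b by simp
  have N: "bop U.X U.X (neumann up (sc \<mu>)) (1 / (1 - b / \<beta>))"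
    by (rule U.bop_mono[OF U.neumann_bop]) (use le lt in \<open>auto intro!: divide_left_mono mult_pos_pos\<close>)
  note E = ends_bop[OF b]
  show ?thesis
    unfolding bop_def up_res_def
  proof (intro conjI ballI allI)
    fix f assume f: "f \<in> elems U.X"
    show "neumann up (sc \<mu>) (ends f) \<in> elems U.X" by (rule bopD(1)[OF N bopD(1)[OF E f]])
    have "fnorm U.X (neumann up (sc \<mu>) (ends f)) \<le> 1 / (1 - b / \<beta>) * fnorm U.X (ends f)"
      by (rule bopD(2)[OF N bopD(1)[OF E f]])
    also have "\<dots> \<le> 1 / (1 - b / \<beta>) * fnorm U.X f"
      using bopD(2)[OF E f] lt by (intro mult_left_mono) auto
    finally show "fnorm U.X (neumann up (sc \<mu>) (ends f)) \<le> 1 / (1 - b / \<beta>) * fnorm U.X f" .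
    show "neumann up (sc \<mu>) (ends (\<lambda>v. c * f v)) = (\<lambda>v. c * neumann up (sc \<mu>) (ends f) v)" for c
      by (simp only: bopD(4)[OF E f] bopD(4)[OF N bopD(1)[OF E f]])
    fix g assume g: "g \<in> elems U.X"
    show "neumann up (sc \<mu>) (ends (\<lambda>v. f v + g v)) = (\<lambda>v. neumann up (sc \<mu>) (ends f) v + neumann up (sc \<mu>) (ends g) v)"
      by (simp only: bopD(3)[OF E f g] bopD(3)[OF N bopD(1)[OF E f] bopD(1)[OF E g]])
  qed
qed

lemma up_res_off:
  assumes "b < cmod \<mu>" "f \<in> elems (sp b)" "v \<notin> V - L"
  shows "up_res \<mu> f v = 0"
proof -
  interpret U: neumann_operator V "wt b" up "sqrt (real q) * b" by (rule up_neumann[OF b])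
  have "cmod (sc \<mu>) * (sqrt (real q) * b) < 1"
    by (rule sc_small[OF b assms(1)])
  then show ?thesis
    using U.neumann_left[OF bopD(1)[OF ends_bop[OF b] assms(2)], of "sc \<mu>" v] assms(3)
    by (auto simp: up_res_def ends_def up_def)
qed

text \<open>The factorisation multiplied out: \<open>up\<close> is applied to
  \<open>y = h + sc \<mu> * down y\<close>, \<open>up_down\<close> supplies the cross term, and
  \<open>h = ends f + sc \<mu> * up h\<close> returns \<open>f\<close>. On the core \<open>y\<close>
  vanishes, and its values at the roots, which agree with those of \<open>h\<close>, leave the
  defect \<open>core_val\<close>.\<close>

lemma ends_res_shifted:
  assumes \<mu>: "b < cmod \<mu>" and f: "f \<in> elems (sp b)"
  shows "v \<in> V - L \<Longrightarrow> shifted \<mu> (ends_res \<mu> f) v = f v"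
    and "v \<in> L \<Longrightarrow> shifted \<mu> (ends_res \<mu> f) v = f v - core_val v \<mu> f"
proof -
  interpret U: neumann_operator V "wt b" up "sqrt (real q) * b" by (rule up_neumann[OF b])
  have small: "cmod (sc \<mu>) * (sqrt (real q) * b) < 1"
    by (rule sc_small[OF b \<mu>])
  have \<mu>0: "\<mu> \<noteq> 0" using \<mu> b by auto
  define h where "h = up_res \<mu> f"
  define y where "y = neumann down (sc \<mu>) h"
  have h: "h v = ends f v + sc \<mu> * up h v" for v
    unfolding h_def up_res_def by (rule U.neumann_left[OF bopD(1)[OF ends_bop[OF b] f] small])
  have h0: "h v = 0" if "v \<notin> V - L" for v unfolding h_def by (rule up_res_off[OF \<mu> f that])
  have y: "y v = h v + sc \<mu> * down y v" for v unfolding y_def by (rule neumann_down_eq)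
  have y0: "y v = 0" if "v \<notin> V - L" for v unfolding y_def by (rule neumann_down_off[OF h0 that])
  have er: "ends_res \<mu> f = (\<lambda>v. - (2 / \<mu>) * y v)" by (simp add: ends_res_def y_def h_def fun_eq_iff)
  show "shifted \<mu> (ends_res \<mu> f) v = f v" if v: "v \<in> V - L"
  proof -
    have "up y v = up (\<lambda>v. h v + sc \<mu> * down y v) v"
      by (rule arg_cong[where f = "\<lambda>h. up h v"]) (rule ext, rule y)
    then have "up y v = up h v + sc \<mu> * (of_nat q * y v)"
      by (simp only: up_add up_down[OF v])
    moreover have "adj y v = up y v + down y v" using adj_ends(1)[of y v] y0 v by simp
    ultimately have "sc \<mu> * adj y v = sc \<mu> * up h v + sc \<mu> * sc \<mu> * of_nat q * y v + sc \<mu> * down y v"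
      by (simp add: algebra_simps)
    also have "\<dots> = (1 + 1 / \<mu>\<^sup>2) * y v - f v"
      unfolding sc_cc(1)[OF \<mu>0] using h[of v] y[of v] v by (simp add: ends_def algebra_simps)
    finally have *: "sc \<mu> * adj y v = (1 + 1 / \<mu>\<^sup>2) * y v - f v" .
    have "shifted \<mu> (ends_res \<mu> f) v = - (2 / \<mu>) * (\<mu> / 2 * (sc \<mu> * adj y v) - z \<mu> * y v)"
      unfolding shifted_def er adj_scale sc_cc(2)[OF \<mu>0] by (simp add: algebra_simps)
    also have "\<dots> = f v" unfolding * using \<mu>0 by (simp add: z_def field_simps power2_eq_square)
    finally show ?thesis .
  qed
  show "shifted \<mu> (ends_res \<mu> f) v = f v - core_val v \<mu> f" if v: "v \<in> L"
  proof -
    have yh: "y u = h u" if "u \<in> ch v" for u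
      unfolding y_def by (rule neumann_down_root) (use that v in \<open>auto simp: ch_def roots_def\<close>)
    have "adj y v = (\<Sum>u\<in>ch v. of_real (S v / s u) * y u)" using adj_ends(2)[of y v] y0 v by simp
    also have "\<dots> = (\<Sum>u\<in>ch v. of_real (S v / s u) * h u)" using yh by (intro sum.cong) auto
    finally have *: "adj y v = (\<Sum>u\<in>ch v. of_real (S v / s u) * h u)" .
    have "shifted \<mu> (ends_res \<mu> f) v = - (2 / \<mu>) * (sc \<mu> * \<mu> / 2 * adj y v)"
      unfolding shifted_def er adj_scale sc_cc(2)[OF \<mu>0] using y0[of v] v by simp
    also have "\<dots> = f v - core_val v \<mu> f"
      unfolding * core_val_def h_def using \<mu>0 by simp
    finally show ?thesis .
  qed
qed

lemma core_val_linear: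
  assumes "b < cmod \<mu>" "f \<in> elems (sp b)"
  shows "core_val l \<mu> (\<lambda>v. c * f v) = c * core_val l \<mu> f"
    and "g \<in> elems (sp b) \<Longrightarrow> core_val l \<mu> (\<lambda>v. f v + g v) = core_val l \<mu> f + core_val l \<mu> g"
proof -
  note N = up_res_bop[OF assms(1) order_refl]
  show "core_val l \<mu> (\<lambda>v. c * f v) = c * core_val l \<mu> f"
    by (simp add: core_val_def bopD(4)[OF N assms(2)] distrib_left sum_distrib_left mult_ac)
  show "core_val l \<mu> (\<lambda>v. f v + g v) = core_val l \<mu> f + core_val l \<mu> g" if "g \<in> elems (sp b)"
    by (simp add: core_val_def bopD(3)[OF N assms(2) that] distrib_left sum.distrib)
qed

lemma core_val_bound:
  assumes \<beta>: "b < \<beta>" and l: "l \<in> L"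
  shows "\<exists>C\<ge>0. \<forall>\<mu>. \<beta> \<le> cmod \<mu> \<longrightarrow> (\<forall>f\<in>elems (sp b). cmod (core_val l \<mu> f) \<le> C * fnorm (sp b) f)"
proof -
  interpret X: weighted_space V "wt b" by (rule weighted_space[OF b])
  have lV: "l \<in> V" using l core by blast
  define K where "K = 1 / (1 - b / \<beta>)"
  have K: "0 \<le> K" using b \<beta> by (simp add: K_def)
  define P where "P = (\<Sum>u\<in>ch l. \<bar>S l / s u\<bar> * (sqrt (wt b u) * K))"
  define C where "C = sqrt (wt b l) + 1 / (sqrt (real q) * \<beta>) * P"
  have P: "0 \<le> P" unfolding P_def using K chD wt_pos[OF b] by (intro sum_nonneg mult_nonneg_nonneg) (auto simp: less_imp_le)
  have C: "0 \<le> C" using P wt_pos[OF b lV] b \<beta> by (simp add: C_def)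
  have "cmod (core_val l \<mu> f) \<le> C * fnorm (sp b) f" if \<mu>: "\<beta> \<le> cmod \<mu>" and f: "f \<in> elems (sp b)" for \<mu> f
  proof -
    note N = up_res_bop[OF \<beta> \<mu>]
    have "cmod (\<Sum>u\<in>ch l. of_real (S l / s u) * up_res \<mu> f u)
      \<le> (\<Sum>u\<in>ch l. \<bar>S l / s u\<bar> * (sqrt (wt b u) * (K * fnorm (sp b) f)))"
    proof (rule sum_norm_le)
      fix u assume "u \<in> ch l"
      then have u: "u \<in> V" using chD by blast
      have "cmod (up_res \<mu> f u) \<le> sqrt (wt b u) * fnorm (sp b) (up_res \<mu> f)"
        by (rule X.cmod_le_fnorm[OF bopD(1)[OF N f] u])
      also have "\<dots> \<le> sqrt (wt b u) * (K * fnorm (sp b) f)"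
        using bopD(2)[OF N f] wt_pos[OF b u] by (intro mult_left_mono) (auto simp: K_def)
      finally have "\<bar>S l / s u\<bar> * cmod (up_res \<mu> f u) \<le> \<bar>S l / s u\<bar> * (sqrt (wt b u) * (K * fnorm (sp b) f))"
        by (rule mult_left_mono) simp
      then show "cmod (of_real (S l / s u) * up_res \<mu> f u) \<le> \<bar>S l / s u\<bar> * (sqrt (wt b u) * (K * fnorm (sp b) f))"
        by (simp only: norm_mult norm_of_real)
    qed
    then have 1: "cmod (\<Sum>u\<in>ch l. of_real (S l / s u) * up_res \<mu> f u) \<le> P * fnorm (sp b) f"
      unfolding P_def sum_distrib_right by (simp only: mult.assoc)
    have 2: "cmod (sc \<mu>) \<le> 1 / (sqrt (real q) * \<beta>)"
      using sc_norm[of \<beta> \<mu> 1] b \<beta> \<mu> q_pos by (simp add: field_simps)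
    have "cmod (core_val l \<mu> f) \<le> cmod (f l) + cmod (sc \<mu>) * cmod (\<Sum>u\<in>ch l. of_real (S l / s u) * up_res \<mu> f u)"
      unfolding core_val_def by (rule order_trans[OF norm_triangle_ineq]) (simp add: norm_mult)
    also have "\<dots> \<le> sqrt (wt b l) * fnorm (sp b) f + 1 / (sqrt (real q) * \<beta>) * (P * fnorm (sp b) f)"
      by (intro add_mono mult_mono X.cmod_le_fnorm f lV 1 2) (use b \<beta> in auto)
    finally show ?thesis by (simp only: C_def distrib_right mult.assoc)
  qed
  then show ?thesis using C by blast
qed

lemma up_res_holomorphic:
  assumes "f \<in> elems (sp b)" "\<And>\<mu>. \<mu> \<in> A \<Longrightarrow> b < cmod \<mu>"
  shows "(\<lambda>\<mu>. up_res \<mu> f v) holomorphic_on A"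
proof -
  interpret U: neumann_operator V "wt b" up "sqrt (real q) * b" by (rule up_neumann[OF b])
  show ?thesis
    unfolding up_res_def
  proof (rule U.neumann_compose_holomorphic[OF bopD(1)[OF ends_bop[OF b] assms(1)]])
    show "sc holomorphic_on A" using assms(2) b by (intro sc_holomorphic) force
    show "cmod (sc \<mu>) * (sqrt (real q) * b) < 1" if "\<mu> \<in> A" for \<mu>
      by (rule sc_small[OF b assms(2)[OF that]])
  qed
qed

lemma ends_res_holomorphic:
  assumes "f \<in> elems (sp b)" "\<And>\<mu>. \<mu> \<in> A \<Longrightarrow> b < cmod \<mu>"
  shows "(\<lambda>\<mu>. ends_res \<mu> f v) holomorphic_on A"
proof -
  have A: "0 \<notin> A" using assms(2) b by force
  show ?thesis
    unfolding ends_res_def using A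
    by (intro holomorphic_intros neumann_down_holomorphic sc_holomorphic up_res_holomorphic assms) auto
qed

lemma core_val_holomorphic:
  assumes "f \<in> elems (sp b)" "\<And>\<mu>. \<mu> \<in> A \<Longrightarrow> b < cmod \<mu>"
  shows "(\<lambda>\<mu>. core_val l \<mu> f) holomorphic_on A"
proof -
  have A: "0 \<notin> A" using assms(2) b by force
  show ?thesis
    unfolding core_val_def
    by (intro holomorphic_intros sc_holomorphic up_res_holomorphic assms A)
qed

end

lemma core_fun_holomorphic: "0 \<notin> A \<Longrightarrow> (\<lambda>\<mu>. core_fun k \<mu> v) holomorphic_on A"
  unfolding core_fun_def by (intro holomorphic_intros neumann_down_holomorphic sc_holomorphic) auto

lemma neumann_down_bop:
  assumes b: "0 < b" "b < \<beta>" "\<beta> \<le> cmod \<mu>"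
  shows "bop (sp (1 / b)) (sp (1 / b)) (neumann down (sc \<mu>)) (1 / (1 - b / \<beta>))"
proof -
  interpret D: neumann_operator V "wt (1 / b)" down "sqrt (real q) * b" by (rule down_neumann[OF b(1)])
  have le: "cmod (sc \<mu>) * (sqrt (real q) * b) \<le> b / \<beta>" using assms b by (intro sc_norm) auto
  have lt: "b / \<beta> < 1" using assms b by simp
  show ?thesis
    by (rule D.bop_mono[OF D.neumann_bop]) (use le lt in \<open>auto intro!: divide_left_mono mult_pos_pos\<close>)
qed

lemma ends_res_bop:
  assumes b: "0 < b" "b \<le> 1" "b < \<beta>" "\<beta> \<le> cmod \<mu>"
  shows "bop (sp b) (sp (1 / b)) (ends_res \<mu>)
    (2 / \<beta> * (1 / (1 - b / \<beta>) * (1 / (1 - b / \<beta>))))"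
proof -
  define K where "K = 1 / (1 - b / \<beta>)"
  have K: "0 \<le> K" using b by (simp add: K_def)
  \<comment> \<open>For \<open>b \<le> 1\<close> the decaying space is contained in the growing one;
    the inclusion is inserted between the two inverses.\<close>
  have "b \<le> 1 / b" using b by (meson le_divide_eq_1_pos order_trans divide_le_eq_1)
  note U = up_res_bop[OF b(1,3,4), folded K_def] and D = neumann_down_bop[OF b(1,3,4), folded K_def]
    and I = inclusion_bop[OF b(1) \<open>b \<le> 1 / b\<close>]
  interpret weighted_spaces V "wt b" "wt (1 / b)"
    using weighted_space[of b] weighted_space[of "1 / b"] b by (simp add: weighted_spaces_def)
  have "bop X Y (\<lambda>f. neumann down (sc \<mu>) (up_res \<mu> f)) (K * K)"
    unfolding bop_def
  proof (intro conjI ballI allI)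
    fix f assume f: "f \<in> elems X"
    note Uf = bopD(1)[OF U f] note UfY = bopD(1)[OF I Uf]
    show "neumann down (sc \<mu>) (up_res \<mu> f) \<in> elems Y" by (rule bopD(1)[OF D UfY])
    have "fnorm Y (neumann down (sc \<mu>) (up_res \<mu> f)) \<le> K * fnorm Y (up_res \<mu> f)" by (rule bopD(2)[OF D UfY])
    also have "\<dots> \<le> K * fnorm X (up_res \<mu> f)" using bopD(2)[OF I Uf] K by (intro mult_left_mono) auto
    also have "\<dots> \<le> K * (K * fnorm X f)" using bopD(2)[OF U f] K by (intro mult_left_mono) auto
    finally show "fnorm Y (neumann down (sc \<mu>) (up_res \<mu> f)) \<le> K * K * fnorm X f" by (simp add: mult.assoc)
    show "neumann down (sc \<mu>) (up_res \<mu> (\<lambda>v. c * f v)) = (\<lambda>v. c * neumann down (sc \<mu>) (up_res \<mu> f) v)" for c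
      by (simp only: bopD(4)[OF U f] bopD(4)[OF D UfY])
    fix g assume g: "g \<in> elems X"
    show "neumann down (sc \<mu>) (up_res \<mu> (\<lambda>v. f v + g v)) = (\<lambda>v. neumann down (sc \<mu>) (up_res \<mu> f) v + neumann down (sc \<mu>) (up_res \<mu> g) v)"
      by (simp only: bopD(3)[OF U f g] bopD(3)[OF D UfY bopD(1)[OF I bopD(1)[OF U g]]])
  qed
  from bop_scale[OF this, of "- (2 / \<mu>)"]
  have "bop X Y (ends_res \<mu>) (cmod (- (2 / \<mu>)) * (K * K))" unfolding ends_res_def[abs_def] .
  moreover have "cmod (- (2 / \<mu>)) * (K * K) \<le> 2 / \<beta> * (K * K)"
    using b K by (intro mult_right_mono) (auto simp: norm_divide intro!: divide_left_mono mult_pos_pos)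
  ultimately show ?thesis unfolding K_def[symmetric] by (rule bop_mono)
qed

lemma core_fun_bound:
  assumes b: "0 < b" "b < \<beta>" and k: "k \<in> L"
  shows "\<exists>D\<ge>0. \<forall>\<mu>. \<beta> \<le> cmod \<mu> \<longrightarrow> core_fun k \<mu> \<in> elems (sp (1 / b))
    \<and> fnorm (sp (1 / b)) (core_fun k \<mu>) \<le> D"
proof -
  interpret Y: weighted_space V "wt (1 / b)" using weighted_space[of "1 / b"] b by simp
  define \<delta> where "\<delta> = (\<lambda>v. if v = k then 1 else (0 :: complex))"
  have kV: "k \<in> V" using k core by blast
  have \<delta>: "\<delta> \<in> elems (sp (1 / b))"
    using Y.finite_support_elems(1)[of "{k}" \<delta>] kV by (auto simp: \<delta>_def)
  have \<beta>: "root_edge k \<in> elems (sp (1 / b))"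
    using Y.finite_support_elems(1)[of "ch k" "root_edge k"] ch_finite[OF kV] chD by (auto simp: root_edge_def)
  define K where "K = 1 / (1 - b / \<beta>)"
  have K: "0 \<le> K" using b by (simp add: K_def)
  define D where "D = fnorm (sp (1 / b)) \<delta> + 1 / (sqrt (real q) * \<beta>) * (K * fnorm (sp (1 / b)) (root_edge k))"
  have "0 \<le> D" using K Y.fnorm_nonneg b by (simp add: D_def)
  moreover have "core_fun k \<mu> \<in> elems (sp (1 / b)) \<and> fnorm (sp (1 / b)) (core_fun k \<mu>) \<le> D"
    if \<mu>: "\<beta> \<le> cmod \<mu>" for \<mu>
  proof -
    note N = neumann_down_bop[OF b \<mu>]
    note n = bopD(1)[OF N \<beta>] note sn = Y.elems_scale[OF n, of "sc \<mu>"]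
    have cf: "core_fun k \<mu> = (\<lambda>v. \<delta> v + sc \<mu> * neumann down (sc \<mu>) (root_edge k) v)"
      by (simp add: core_fun_def \<delta>_def fun_eq_iff)
    have 2: "cmod (sc \<mu>) \<le> 1 / (sqrt (real q) * \<beta>)"
      using sc_norm[of \<beta> \<mu> 1] b \<mu> q_pos by (simp add: field_simps)
    have "fnorm (sp (1 / b)) (core_fun k \<mu>) \<le> fnorm (sp (1 / b)) \<delta>
      + cmod (sc \<mu>) * fnorm (sp (1 / b)) (neumann down (sc \<mu>) (root_edge k))"
      unfolding cf using Y.elems_add(2)[OF \<delta> sn(1)] sn(2) by simp
    also have "\<dots> \<le> D"
      unfolding D_def using bopD(2)[OF N \<beta>] 2 b Y.fnorm_nonneg
      by (intro add_left_mono mult_mono) (auto simp: K_def)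
    finally show ?thesis unfolding cf using Y.elems_add(1)[OF \<delta> sn(1)] by simp
  qed
  ultimately show ?thesis by blast
qed

end

lemma higher_deriv_finite_sum:
  assumes "finite I" "open S" "\<xi> \<in> S" "\<And>i. i \<in> I \<Longrightarrow> f i holomorphic_on S"
  shows "(deriv ^^ j) (\<lambda>\<mu>. \<Sum>i\<in>I. f i \<mu>) \<xi> = (\<Sum>i\<in>I. (deriv ^^ j) (f i) \<xi>)"
  using assms(1,4)
proof (induction I rule: finite_induct)
  case (insert x I)
  have "(deriv ^^ j) (\<lambda>\<mu>. f x \<mu> + (\<Sum>i\<in>I. f i \<mu>)) \<xi>
    = (deriv ^^ j) (f x) \<xi> + (deriv ^^ j) (\<lambda>\<mu>. \<Sum>i\<in>I. f i \<mu>) \<xi>"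
    by (rule higher_deriv_add[OF _ _ assms(2,3)]) (intro holomorphic_intros insert.prems; simp)+
  then show ?case using insert by simp
qed simp

section \<open>The inverse by blocks and its singularities\<close>

context ended_space
begin

text \<open>Block inversion with \<open>W\<close> as inverse of the Schur complement and
  \<open>e = 1\<close>. The factor \<open>e\<close> allows the whole expression to be multiplied by
  a power of \<open>\<mu> - \<xi>\<close> that clears the poles of \<open>W\<close>.\<close>

definition block_inverse ::
    "('v \<Rightarrow> 'v \<Rightarrow> complex) \<Rightarrow> complex \<Rightarrow> complex \<Rightarrow> 'v operator" where
  "block_inverse W e \<mu> f v =
     e * ends_res \<mu> f v + (\<Sum>k\<in>L. (\<Sum>l\<in>L. W k l * core_val l \<mu> f) * core_fun k \<mu> v)"

lemma block_inverse_scale: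
  "block_inverse (\<lambda>k l. c * W k l) (c * e) \<mu> f v = c * block_inverse W e \<mu> f v"
proof -
  define h where "h = (\<lambda>k. \<Sum>l\<in>L. W k l * core_val l \<mu> f)"
  have "(\<Sum>l\<in>L. c * W k l * core_val l \<mu> f) = c * h k" for k
    by (simp add: h_def sum_distrib_left mult.assoc)
  moreover have "(\<Sum>l\<in>L. W k l * core_val l \<mu> f) = h k" for k by (simp add: h_def)
  ultimately show ?thesis
    unfolding block_inverse_def by (simp add: distrib_left sum_distrib_left mult.assoc)
qed

lemma block_inverse_off:
  assumes "0 < b" "b < cmod \<mu>" "f \<in> elems (sp b)" "v \<notin> V"
  shows "block_inverse W e \<mu> f v = 0"
proof -
  have "ends_res \<mu> f v = 0"
    using neumann_down_off[of "up_res \<mu> f" v "sc \<mu>"] up_res_off[OF assms(1-3)] assms(4)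
    by (simp add: ends_res_def)
  moreover have "core_fun k \<mu> v = 0" if "k \<in> L" for k
  proof -
    have "root_edge k u = 0" if "u \<notin> V - L" for u using that chD[of u k] by (auto simp: root_edge_def)
    then have "neumann down (sc \<mu>) (root_edge k) v = 0" using assms(4) by (intro neumann_down_off) auto
    moreover have "v \<noteq> k" using assms(4) core that by auto
    ultimately show ?thesis by (simp add: core_fun_def)
  qed
  ultimately show ?thesis by (simp add: block_inverse_def)
qed

text \<open>\<open>ends_res\<close> solves the equation on the ends and misses it by
  \<open>core_val\<close> on the core. The core functions repair this defect without disturbing the
  ends, their coefficients being given by \<open>W\<close>.\<close>

lemma block_inverse_shifted:
  assumes b: "0 < b" "b < cmod \<mu>" and f: "f \<in> elems (sp b)"
    and W: "\<And>i j. i \<in> L \<Longrightarrow> j \<in> L \<Longrightarrow> (\<Sum>k\<in>L. core_matrix \<mu> i k * W k j) = (if i = j then 1 else 0)"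
  shows "shifted \<mu> (block_inverse W 1 \<mu> f) = f"
proof
  fix v
  define c where "c = (\<lambda>k. \<Sum>l\<in>L. W k l * core_val l \<mu> f)"
  have \<mu>: "\<mu> \<noteq> 0" using b by auto
  have bi: "block_inverse W 1 \<mu> f = (\<lambda>v. ends_res \<mu> f v + (\<Sum>k\<in>L. c k * core_fun k \<mu> v))"
    by (simp add: block_inverse_def c_def fun_eq_iff)
  have sh: "shifted \<mu> (block_inverse W 1 \<mu> f) v
    = shifted \<mu> (ends_res \<mu> f) v + (\<Sum>k\<in>L. c k * shifted \<mu> (core_fun k \<mu>) v)"
    unfolding bi by (rule shifted_add_sum[OF finite_core])
  show "shifted \<mu> (block_inverse W 1 \<mu> f) v = f v"
  proof (cases "v \<in> V")
    case False
    interpret X: weighted_space V "wt b" by (rule weighted_space[OF b(1)])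
    show ?thesis
      using block_inverse_off[OF b f False] X.elems_off[OF f False] False core
      by (auto simp: shifted_def adj_def)
  next
    case True
    show ?thesis
    proof (cases "v \<in> L")
      case False
      then show ?thesis
        unfolding sh using ends_res_shifted(1)[OF b f, of v] core_fun_shifted(1)[OF _ \<mu>, of _ v] True by simp
    next
      case v: True
      have "(\<Sum>k\<in>L. c k * shifted \<mu> (core_fun k \<mu>) v) = (\<Sum>k\<in>L. \<Sum>l\<in>L. core_matrix \<mu> v k * W k l * core_val l \<mu> f)"
        using core_fun_shifted(2)[OF _ \<mu> v] by (simp add: c_def sum_distrib_left mult_ac)
      also have "\<dots> = (\<Sum>l\<in>L. (\<Sum>k\<in>L. core_matrix \<mu> v k * W k l) * core_val l \<mu> f)"
        by (subst sum.swap) (simp add: sum_distrib_right)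
      also have "\<dots> = (\<Sum>l\<in>L. (if v = l then 1 else 0) * core_val l \<mu> f)"
        using W[OF v] by (intro sum.cong) auto
      also have "\<dots> = core_val v \<mu> f"
        using v finite_core by (simp add: if_distrib[where f = "\<lambda>x. x * _"] cong: if_cong)
      finally show ?thesis unfolding sh using ends_res_shifted(2)[OF b f v] by simp
    qed
  qed
qed

lemma core_term_bop:
  assumes b: "0 < b" "b < \<beta>" and k: "k \<in> L"
    and G: "\<And>l. l \<in> L \<Longrightarrow> 0 \<le> G l"
  shows "\<exists>B. \<forall>\<mu> W. \<beta> \<le> cmod \<mu> \<longrightarrow> (\<forall>l\<in>L. cmod (W l) \<le> G l) \<longrightarrow>
    bop (sp b) (sp (1 / b)) (\<lambda>f v. (\<Sum>l\<in>L. W l * core_val l \<mu> f) * core_fun k \<mu> v) B"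
proof -
  interpret weighted_spaces V "wt b" "wt (1 / b)"
    using weighted_space[of b] weighted_space[of "1 / b"] b by (simp add: weighted_spaces_def)
  obtain C where C: "\<forall>l\<in>L. 0 \<le> C l \<and>
      (\<forall>\<mu>. \<beta> \<le> cmod \<mu> \<longrightarrow> (\<forall>f\<in>elems X. cmod (core_val l \<mu> f) \<le> C l * fnorm X f))"
    using bchoice[of L "\<lambda>l C. 0 \<le> C \<and> (\<forall>\<mu>. \<beta> \<le> cmod \<mu> \<longrightarrow> (\<forall>f\<in>elems X. cmod (core_val l \<mu> f) \<le> C * fnorm X f))"]
      core_val_bound[OF b] by blast
  obtain D where D: "0 \<le> D" "\<And>\<mu>. \<beta> \<le> cmod \<mu> \<Longrightarrow> core_fun k \<mu> \<in> elems Y \<and> fnorm Y (core_fun k \<mu>) \<le> D"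
    using core_fun_bound[OF b k] by blast
  define P where "P = (\<Sum>l\<in>L. G l * C l)"
  have P: "0 \<le> P" unfolding P_def using G C by (intro sum_nonneg mult_nonneg_nonneg) auto
  have "bop X Y (\<lambda>f v. (\<Sum>l\<in>L. W l * core_val l \<mu> f) * core_fun k \<mu> v) (P * D)"
    if \<mu>: "\<beta> \<le> cmod \<mu>" and W: "\<forall>l\<in>L. cmod (W l) \<le> G l" for \<mu> W
  proof (rule bop_rank_one[OF _ P])
    have \<mu>b: "b < cmod \<mu>" using \<mu> b by simp
    fix f assume f: "f \<in> elems X"
    have "cmod (\<Sum>l\<in>L. W l * core_val l \<mu> f) \<le> (\<Sum>l\<in>L. G l * (C l * fnorm X f))"
    proof (rule sum_norm_le)
      fix l assume "l \<in> L"
      then show "cmod (W l * core_val l \<mu> f) \<le> G l * (C l * fnorm X f)"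
        unfolding norm_mult using W C G \<mu> f by (intro mult_mono) auto
    qed
    then show "cmod (\<Sum>l\<in>L. W l * core_val l \<mu> f) \<le> P * fnorm X f"
      unfolding P_def sum_distrib_right by (simp only: mult.assoc)
    show "(\<Sum>l\<in>L. W l * core_val l \<mu> (\<lambda>v. c * f v)) = c * (\<Sum>l\<in>L. W l * core_val l \<mu> f)" for c
      by (simp add: core_val_linear(1)[OF b(1) \<mu>b f] sum_distrib_left mult_ac)
    fix g assume g: "g \<in> elems X"
    show "(\<Sum>l\<in>L. W l * core_val l \<mu> (\<lambda>v. f v + g v)) = (\<Sum>l\<in>L. W l * core_val l \<mu> f) + (\<Sum>l\<in>L. W l * core_val l \<mu> g)"
      by (simp add: core_val_linear(2)[OF b(1) \<mu>b f g] distrib_left sum.distrib)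
  qed (use D(2)[OF \<mu>] in auto)
  then show ?thesis by blast
qed

text \<open>The bound is chosen before \<open>\<mu>\<close>, \<open>W\<close> and \<open>e\<close>,
  so it covers a full neighbourhood of a singularity once the poles have been cleared.\<close>

lemma block_inverse_bop:
  assumes b: "0 < b" "b \<le> 1" "b < \<beta>" and G: "\<And>k l. k \<in> L \<Longrightarrow> l \<in> L \<Longrightarrow> 0 \<le> G k l" and G': "0 \<le> G'"
  shows "\<exists>B. \<forall>\<mu> W e. \<beta> \<le> cmod \<mu> \<longrightarrow> cmod e \<le> G' \<longrightarrow> (\<forall>k\<in>L. \<forall>l\<in>L. cmod (W k l) \<le> G k l) \<longrightarrow>
    bop (sp b) (sp (1 / b)) (block_inverse W e \<mu>) B"
proof -
  interpret weighted_spaces V "wt b" "wt (1 / b)"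
    using weighted_space[of b] weighted_space[of "1 / b"] b by (simp add: weighted_spaces_def)
  define E where "E = 2 / \<beta> * (1 / (1 - b / \<beta>) * (1 / (1 - b / \<beta>)))"
  have E: "0 \<le> E" using b by (simp add: E_def)
  obtain B where B: "\<forall>k\<in>L. \<forall>\<mu> W. \<beta> \<le> cmod \<mu> \<longrightarrow> (\<forall>l\<in>L. cmod (W l) \<le> G k l) \<longrightarrow>
    bop X Y (\<lambda>f v. (\<Sum>l\<in>L. W l * core_val l \<mu> f) * core_fun k \<mu> v) (B k)"
    using bchoice[of L "\<lambda>k B. \<forall>\<mu> W. \<beta> \<le> cmod \<mu> \<longrightarrow> (\<forall>l\<in>L. cmod (W l) \<le> G k l) \<longrightarrow>
      bop X Y (\<lambda>f v. (\<Sum>l\<in>L. W l * core_val l \<mu> f) * core_fun k \<mu> v) B"]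
      core_term_bop[OF b(1,3)] G by blast
  have "bop X Y (block_inverse W e \<mu>) (G' * E + (\<Sum>k\<in>L. B k))"
    if \<mu>: "\<beta> \<le> cmod \<mu>" and e: "cmod e \<le> G'" and W: "\<forall>k\<in>L. \<forall>l\<in>L. cmod (W k l) \<le> G k l" for \<mu> W e
    unfolding block_inverse_def[abs_def]
  proof (rule bop_add)
    have "bop X Y (\<lambda>f v. e * ends_res \<mu> f v) (cmod e * E)"
      unfolding E_def by (rule bop_scale[OF ends_res_bop[OF b \<mu>]])
    then show "bop X Y (\<lambda>f v. e * ends_res \<mu> f v) (G' * E)"
      using e E by (rule bop_mono[OF _ mult_right_mono])
    show "bop X Y (\<lambda>f v. \<Sum>k\<in>L. (\<Sum>l\<in>L. W k l * core_val l \<mu> f) * core_fun k \<mu> v) (\<Sum>k\<in>L. B k)"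
      by (rule bop_sum[OF finite_core]) (use B \<mu> W in blast)
  qed
  then show ?thesis by blast
qed

lemma block_inverse_holomorphic:
  assumes b: "0 < b" "\<And>\<mu>. \<mu> \<in> A \<Longrightarrow> b < cmod \<mu>" and f: "f \<in> elems (sp b)"
    and "e holomorphic_on A" "\<And>k l. k \<in> L \<Longrightarrow> l \<in> L \<Longrightarrow> W k l holomorphic_on A"
  shows "(\<lambda>\<mu>. block_inverse (\<lambda>k l. W k l \<mu>) (e \<mu>) \<mu> f v) holomorphic_on A"
proof -
  have A: "0 \<notin> A" using b by force
  show ?thesis
    unfolding block_inverse_def
    by (intro holomorphic_intros assms(4,5) ends_res_holomorphic[OF b(1) f] core_val_holomorphic[OF b(1) f]
      core_fun_holomorphic A) (use b in auto)
qed

text \<open>A kernel vector of the core matrix yields a combination of core functions annihilated by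
  \<open>shifted \<mu>\<close>. For \<open>cmod \<mu> > 1\<close> these functions lie in
  \<open>sp 1\<close>, so the combination is zero, and its values on the core are the
  coefficients.\<close>

lemma core_injective:
  assumes \<mu>: "1 < cmod \<mu>" and inj: "\<And>f. f \<in> elems (sp 1) \<Longrightarrow> shifted \<mu> f = (\<lambda>_. 0) \<Longrightarrow> f = (\<lambda>_. 0)"
    and c: "\<And>i. i \<in> L \<Longrightarrow> (\<Sum>k\<in>L. core_matrix \<mu> i k * c k) = 0"
  shows "\<forall>k\<in>L. c k = 0"
proof -
  interpret X: weighted_space V "wt 1" by (rule weighted_space) simp
  have \<mu>0: "\<mu> \<noteq> 0" using \<mu> by auto
  define f where "f = (\<lambda>v. \<Sum>k\<in>L. c k * core_fun k \<mu> v)"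
  have cf: "core_fun k \<mu> \<in> elems (sp 1)" if "k \<in> L" for k
    using core_fun_bound[of 1 "cmod \<mu>" k] \<mu> that by auto
  have f: "f \<in> elems (sp 1)"
    unfolding f_def by (intro X.elems_sum(1) X.elems_scale(1) cf finite_core)
  have "shifted \<mu> f v = 0" for v
  proof -
    have *: "shifted \<mu> f v = (\<Sum>k\<in>L. c k * shifted \<mu> (core_fun k \<mu>) v)"
      using shifted_add_sum[OF finite_core, of \<mu> "\<lambda>_. 0" c "\<lambda>k. core_fun k \<mu>" v]
      by (simp add: f_def shifted_def[of \<mu> "\<lambda>_. 0"] adj_def)
    show ?thesis
    proof (cases "v \<in> V")
      case False
      then show ?thesis using X.elems_off[OF f False] core by (auto simp: shifted_def adj_def)
    next
      case True
      show ?thesis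
      proof (cases "v \<in> L")
        case v: True
        have "(\<Sum>k\<in>L. c k * shifted \<mu> (core_fun k \<mu>) v) = (\<Sum>k\<in>L. core_matrix \<mu> v k * c k)"
          using core_fun_shifted(2)[OF _ \<mu>0 v] by (intro sum.cong) auto
        then show ?thesis using c[OF v] * by simp
      next
        case False
        then show ?thesis
          unfolding * using core_fun_shifted(1)[OF _ \<mu>0, of _ v] True by simp
      qed
    qed
  qed
  then have "shifted \<mu> f = (\<lambda>_. 0)" by (simp add: fun_eq_iff)
  then have f0: "f = (\<lambda>_. 0)" by (rule inj[OF f])
  have "(\<Sum>k\<in>L. c k * core_fun k \<mu> l) = 0" for l using fun_cong[OF f0, of l] by (simp add: f_def)
  moreover have "(\<Sum>k\<in>L. c k * core_fun k \<mu> l) = (\<Sum>k\<in>L. c k * (if l = k then 1 else 0))" if "l \<in> L" for l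
    using core_fun_shifted(3)[OF _ \<mu>0 that] by (intro sum.cong) auto
  ultimately have "(\<Sum>k\<in>L. c k * (if l = k then 1 else 0)) = 0" if "l \<in> L" for l
    using that by metis
  then show ?thesis using finite_core by (simp add: if_distrib[where f = "(*) _"] cong: if_cong)
qed

theorem meromorphic_inverse:
  assumes b: "0 < b" "b \<le> 1" and \<Omega>: "\<And>\<mu>. \<mu> \<in> \<Omega> \<Longrightarrow> b < cmod \<mu>"
    and inj: "\<exists>\<mu>. 1 < cmod \<mu> \<and>
      (\<forall>f \<in> elems (sp 1). shifted \<mu> f = (\<lambda>_. 0) \<longrightarrow> f = (\<lambda>_. 0))"
  shows "\<exists>R. finitely_meromorphic (sp b) (sp (1 / b)) \<Omega> R \<and>
    (\<forall>\<^sub>F \<mu> in at_infinity. \<forall>f \<in> elems (sp b).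
      R \<mu> f \<in> elems (sp 1) \<and> shifted \<mu> (R \<mu> f) = f)"
proof -
  obtain D d where
    D: "\<And>i j. i \<in> L \<Longrightarrow> j \<in> L \<Longrightarrow> (\<Sum>k\<in>L. core_poly i k * D k j) = (if i = j then d else 0)" and
    d: "\<And>x. (\<And>c. (\<And>i. i \<in> L \<Longrightarrow> (\<Sum>k\<in>L. poly (core_poly i k) x * c k) = 0) \<Longrightarrow> \<forall>k\<in>L. c k = 0) \<Longrightarrow>
      poly d x \<noteq> 0"
    using adjugate_on_finite_set[OF finite_core, where M = core_poly] by blast
  \<comment> \<open>One point at which the full operator is injective suffices to exclude the zero
    polynomial.\<close>
  have d0: "d \<noteq> 0"
  proof -
    obtain \<mu> where \<mu>: "1 < cmod \<mu>"
      and inj: "\<And>f. f \<in> elems (sp 1) \<Longrightarrow> shifted \<mu> f = (\<lambda>_. 0) \<Longrightarrow> f = (\<lambda>_. 0)"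
      using inj by blast
    have \<mu>0: "\<mu> \<noteq> 0" using \<mu> by auto
    have "poly d \<mu> \<noteq> 0"
    proof (rule d)
      fix c assume c: "\<And>i. i \<in> L \<Longrightarrow> (\<Sum>k\<in>L. poly (core_poly i k) \<mu> * c k) = 0"
      show "\<forall>k\<in>L. c k = 0"
      proof (rule core_injective[OF \<mu> inj])
        fix i assume "i \<in> L"
        from c[OF this] show "(\<Sum>k\<in>L. core_matrix \<mu> i k * c k) = 0"
          using \<mu>0 by (simp add: core_poly_eq mult.assoc sum_distrib_left[symmetric])
      qed
    qed
    then show ?thesis by auto
  qed
  \<comment> \<open>The factor \<open>\<mu>\<close> compensates the one by which
    \<open>core_poly\<close> differs from \<open>core_matrix\<close>.\<close>
  define W where "W = (\<lambda>\<mu> k l. \<mu> * poly (D k l) \<mu> / poly d \<mu>)"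
  have W: "(\<Sum>k\<in>L. core_matrix \<mu> i k * W \<mu> k j) = (if i = j then 1 else 0)"
    if "\<mu> \<noteq> 0" "poly d \<mu> \<noteq> 0" "i \<in> L" "j \<in> L" for \<mu> i j
  proof -
    have "(\<Sum>k\<in>L. core_matrix \<mu> i k * W \<mu> k j) = poly (\<Sum>k\<in>L. core_poly i k * D k j) \<mu> / poly d \<mu>"
      using that by (simp add: W_def poly_sum core_poly_eq sum_divide_distrib mult_ac)
    then show ?thesis using D that by simp
  qed
  \<comment> \<open>At a zero of \<open>d\<close> the coordinatewise limit supplies the right value
    if the singularity is removable; at a genuine pole the value is unconstrained.\<close>
  define R where "R = (\<lambda>\<mu> f v. if poly d \<mu> \<noteq> 0 then block_inverse (W \<mu>) 1 \<mu> f v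
    else Lim (at \<mu>) (\<lambda>\<nu>. block_inverse (W \<nu>) 1 \<nu> f v))"
  interpret weighted_spaces V "wt b" "wt (1 / b)"
    using weighted_space[of b] weighted_space[of "1 / b"] b by (simp add: weighted_spaces_def)
  have "finitely_meromorphic X Y \<Omega> R"
    unfolding finitely_meromorphic_def
  proof
    fix \<xi> assume \<xi>: "\<xi> \<in> \<Omega>"
    \<comment> \<open>\<open>m\<close> is only an upper bound for the pole order, as zeros of the
      determinant may cancel against the adjugate; \<open>laurent\<close> finds the exact
      order.\<close>
    define m where "m = Polynomial.order \<xi> d"
    obtain d1 where d1: "d = [:- \<xi>, 1:] ^ m * d1" "\<not> [:- \<xi>, 1:] dvd d1"
      using order_decomp[OF d0] unfolding m_def by blast
    have d1\<xi>: "poly d1 \<xi> \<noteq> 0" using d1(2) by (simp add: poly_eq_0_iff_dvd)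
    have pd: "poly d \<mu> = (\<mu> - \<xi>) ^ m * poly d1 \<mu>" for \<mu> by (simp add: d1(1))
    obtain \<beta> where \<beta>: "b < \<beta>" "\<beta> < cmod \<xi>" using dense[OF \<Omega>[OF \<xi>]] by blast
    have "open ({\<mu>. \<beta> < cmod \<mu>} \<inter> {\<mu>. poly d1 \<mu> \<noteq> 0})"
      by (intro open_Int open_Collect_less open_Collect_neq continuous_intros)
    moreover have "\<xi> \<in> {\<mu>. \<beta> < cmod \<mu>} \<inter> {\<mu>. poly d1 \<mu> \<noteq> 0}" using \<beta> d1\<xi> by simp
    ultimately obtain r0 where r0: "0 < r0" "cball \<xi> r0 \<subseteq> {\<mu>. \<beta> < cmod \<mu>} \<inter> {\<mu>. poly d1 \<mu> \<noteq> 0}"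
      using open_contains_cball by blast
    define S where "S = ball \<xi> r0"
    have S: "open S" "\<xi> \<in> S" "S \<subseteq> cball \<xi> r0" using r0 by (auto simp: S_def)
    have S': "\<beta> < cmod \<mu>" "poly d1 \<mu> \<noteq> 0" if "\<mu> \<in> S" for \<mu> using that S(3) r0(2) by auto
    have Sb: "b < cmod \<mu>" if "\<mu> \<in> S" for \<mu> using S'(1)[OF that] \<beta> by simp
    \<comment> \<open>This is \<open>(\<mu> - \<xi>) ^ m\<close> times \<open>W\<close>, with the
      zero of \<open>d\<close> at \<open>\<xi>\<close> divided out, hence holomorphic near
      \<open>\<xi>\<close>.\<close>
    define W1 where "W1 = (\<lambda>\<mu> k l. \<mu> * poly (D k l) \<mu> / poly d1 \<mu>)"
    have W1h: "(\<lambda>\<mu>. W1 \<mu> k l) holomorphic_on S" for k l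
      unfolding W1_def using S'(2) by (intro holomorphic_intros) auto
    have "\<exists>G\<ge>0. \<forall>\<mu>\<in>S. cmod (W1 \<mu> k l) \<le> G" for k l
    proof -
      have "continuous_on (cball \<xi> r0) (\<lambda>\<mu>. W1 \<mu> k l)"
        unfolding W1_def using r0(2) by (intro continuous_intros) auto
      then have "bounded ((\<lambda>\<mu>. W1 \<mu> k l) ` cball \<xi> r0)"
        by (intro compact_imp_bounded compact_continuous_image compact_cball)
      then obtain G where "\<forall>x\<in>(\<lambda>\<mu>. W1 \<mu> k l) ` cball \<xi> r0. cmod x \<le> G" unfolding bounded_iff by blast
      then have "\<forall>\<mu>\<in>S. cmod (W1 \<mu> k l) \<le> G" using S(3) by auto
      moreover from this have "0 \<le> G" using S(2) norm_ge_zero order_trans by blast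
      ultimately show ?thesis by blast
    qed
    then obtain G where G: "\<And>k l. 0 \<le> G k l" "\<And>k l \<mu>. \<mu> \<in> S \<Longrightarrow> cmod (W1 \<mu> k l) \<le> G k l"
      by metis
    define F where "F = (\<lambda>\<mu>. block_inverse (W1 \<mu>) ((\<mu> - \<xi>) ^ m) \<mu>)"
    obtain B where B: "\<And>\<mu> W e. \<beta> \<le> cmod \<mu> \<Longrightarrow> cmod e \<le> r0 ^ m \<Longrightarrow>
        \<forall>k\<in>L. \<forall>l\<in>L. cmod (W k l) \<le> G k l \<Longrightarrow> bop X Y (block_inverse W e \<mu>) B"
      using block_inverse_bop[of b \<beta> G "r0 ^ m"] b \<beta>(1) G(1) r0(1)
      by (metis less_imp_le zero_le_power)
    \<comment> \<open>The halved radius makes the closed ball fit into the open ball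
      \<open>S\<close>.\<close>
    interpret H: holomorphic_operators V "wt b" "wt (1 / b)" F S B \<xi> "r0 / 2"
    proof unfold_locales
      show "bop X Y (F \<mu>) B" if "\<mu> \<in> S" for \<mu>
        unfolding F_def
      proof (rule B)
        have "cmod (\<mu> - \<xi>) \<le> r0" using that by (simp add: S_def dist_norm norm_minus_commute)
        then show "cmod ((\<mu> - \<xi>) ^ m) \<le> r0 ^ m" by (simp add: norm_power power_mono)
      qed (use S'(1)[OF that] G(2)[OF that] in auto)
      show "(\<lambda>\<mu>. F \<mu> f v) holomorphic_on S" if "f \<in> elems X" for f v
        unfolding F_def
        by (rule block_inverse_holomorphic[OF b(1) Sb that, where W = "\<lambda>k l \<mu>. W1 \<mu> k l"])
          (auto intro!: holomorphic_intros W1h)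
    qed (use S r0 in \<open>auto simp: S_def\<close>)
    have FR: "F \<mu> f v = (\<mu> - \<xi>) ^ m * R \<mu> f v" if "\<mu> \<in> S" "\<mu> \<noteq> \<xi>" for \<mu> f v
    proof -
      have "poly d \<mu> \<noteq> 0" using pd S'(2) that by simp
      moreover have "W1 \<mu> = (\<lambda>k l. (\<mu> - \<xi>) ^ m * W \<mu> k l)"
        using that S'(2) by (simp add: W1_def W_def pd fun_eq_iff)
      ultimately show ?thesis
        using block_inverse_scale[of "(\<mu> - \<xi>) ^ m" "W \<mu>" 1 \<mu> f v] by (simp add: F_def R_def)
    qed
    show "\<exists>J A r. r > 0 \<and>
        (\<forall>j \<ge> - int J. bounded_operator X Y (A j)) \<and>
        (\<forall>j. - int J \<le> j \<and> j < 0 \<longrightarrow> finite_rank X (A j)) \<and>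
        (J = 0 \<or> (\<exists>f \<in> elems X. A (- int J) f \<noteq> (\<lambda>_. 0))) \<and>
        (\<forall>\<mu>\<in>\<Omega>. dist \<mu> \<xi> < r \<and> (\<mu> \<noteq> \<xi> \<or> J = 0) \<longrightarrow>
           bounded_operator X Y (R \<mu>) \<and>
           (\<lambda>n. opnorm X Y (\<lambda>f v. R \<mu> f v -
              (\<Sum>j\<in>{- int J..int n}. (\<mu> - \<xi>) powi j * A j f v))) \<longlonglongrightarrow> 0)"
    proof (rule H.laurent[where k = m])
      fix \<mu> f assume "dist \<mu> \<xi> < r0 / 2" "\<mu> \<noteq> \<xi>"
      then show "F \<mu> f = (\<lambda>v. (\<mu> - \<xi>) ^ m * R \<mu> f v)"
        using FR r0(1) by (auto simp: S_def dist_commute fun_eq_iff)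
    next
      fix j assume j: "j < m"
      \<comment> \<open>Below order \<open>m\<close> the end term has no Taylor coefficient.
        Leibniz' rule leaves derivatives at \<open>\<xi>\<close> of core functions as vectors; they
        do not depend on \<open>f\<close>, which enters the scalar coefficients only.\<close>
      show "finite_rank X (H.coeff j)"
      proof (rule finite_rankI[where I = "L \<times> {0..j}" and b = "\<lambda>(k, i) v. (deriv ^^ i) (\<lambda>\<mu>. core_fun k \<mu> v) \<xi>"])
        fix f assume f: "f \<in> elems X"
        define h where "h = (\<lambda>k \<mu>. \<Sum>l\<in>L. W1 \<mu> k l * core_val l \<mu> f)"
        have hh: "h k holomorphic_on S" for k
          unfolding h_def by (intro holomorphic_intros W1h core_val_holomorphic[OF b(1) f] Sb)
        have ch: "(\<lambda>\<mu>. core_fun k \<mu> v) holomorphic_on S" for k v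
          by (rule core_fun_holomorphic) (use Sb b(1) in force)
        have eh: "(\<lambda>\<mu>. ends_res \<mu> f v) holomorphic_on S" for v
          by (rule ends_res_holomorphic[OF b(1) f Sb])
        define c where "c = (\<lambda>(k, i). of_nat (j choose i) * (deriv ^^ (j - i)) (h k) \<xi> / fact j)"
        have "H.coeff j f v = (\<Sum>x\<in>L \<times> {0..j}. c x * (case x of (k, i) \<Rightarrow> \<lambda>v. (deriv ^^ i) (\<lambda>\<mu>. core_fun k \<mu> v) \<xi>) v)" for v
        proof -
          have "(deriv ^^ j) (\<lambda>\<mu>. F \<mu> f v) \<xi>
            = (deriv ^^ j) (\<lambda>\<mu>. (\<mu> - \<xi>) ^ m * ends_res \<mu> f v + (\<Sum>k\<in>L. core_fun k \<mu> v * h k \<mu>)) \<xi>"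
            by (simp add: F_def block_inverse_def h_def mult.commute)
          also have "\<dots> = (deriv ^^ j) (\<lambda>\<mu>. (\<mu> - \<xi>) ^ m * ends_res \<mu> f v) \<xi>
            + (deriv ^^ j) (\<lambda>\<mu>. \<Sum>k\<in>L. core_fun k \<mu> v * h k \<mu>) \<xi>"
            by (rule higher_deriv_add[OF _ _ S(1,2)]) (intro holomorphic_intros hh ch eh)+
          also have "(deriv ^^ j) (\<lambda>\<mu>. (\<mu> - \<xi>) ^ m * ends_res \<mu> f v) \<xi> = 0"
            by (rule higher_deriv_power_mult_zero[OF S(1,2) eh j])
          also have "(deriv ^^ j) (\<lambda>\<mu>. \<Sum>k\<in>L. core_fun k \<mu> v * h k \<mu>) \<xi>
            = (\<Sum>k\<in>L. (deriv ^^ j) (\<lambda>\<mu>. core_fun k \<mu> v * h k \<mu>) \<xi>)"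
            by (rule higher_deriv_finite_sum[OF finite_core S(1,2)]) (intro holomorphic_intros hh ch)
          also have "\<dots> = (\<Sum>k\<in>L. \<Sum>i = 0..j. of_nat (j choose i) * (deriv ^^ i) (\<lambda>\<mu>. core_fun k \<mu> v) \<xi>
              * (deriv ^^ (j - i)) (h k) \<xi>)"
            by (intro sum.cong refl higher_deriv_mult[OF ch hh S(1,2)])
          finally show ?thesis
            unfolding sum.cartesian_product' H.coeff_def c_def
            by (simp add: sum_divide_distrib mult_ac)
        qed
        then show "\<exists>c. H.coeff j f = (\<lambda>v. \<Sum>x\<in>L \<times> {0..j}. c x * (case x of (k, i) \<Rightarrow> \<lambda>v. (deriv ^^ i) (\<lambda>\<mu>. core_fun k \<mu> v) \<xi>) v)"
          by blast
      qed (simp add: finite_core)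
    next
      fix f
      assume zero: "\<And>j g. j < m \<Longrightarrow> g \<in> elems X \<Longrightarrow> H.coeff j g = (\<lambda>_. 0)" and f: "f \<in> elems X"
      show "R \<xi> f = H.coeff m f"
      proof (cases "m = 0")
        case True
        then have "R \<xi> f = F \<xi> f"
          using d1\<xi> by (simp add: R_def F_def pd W_def W1_def fun_eq_iff)
        then show ?thesis using True by (simp add: H.coeff_0)
      next
        case False
        show ?thesis
        proof
          fix v
          have "(deriv ^^ j) (\<lambda>\<mu>. F \<mu> f v) \<xi> = 0" if "j < m" for j
            using fun_cong[OF zero[OF that f], of v] by (simp add: H.coeff_def)
          then have "((\<lambda>\<mu>. F \<mu> f v / (\<mu> - \<xi>) ^ m) \<longlongrightarrow> H.coeff m f v) (at \<xi>)"
            unfolding H.coeff_def by (intro taylor_quotient_limit[OF S(1,2) H.hol[OF f]])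
          moreover have "\<forall>\<^sub>F \<mu> in at \<xi>. F \<mu> f v / (\<mu> - \<xi>) ^ m = block_inverse (W \<mu>) 1 \<mu> f v"
          proof -
            have "\<forall>\<^sub>F \<mu> in at \<xi>. \<mu> \<in> S \<and> \<mu> \<noteq> \<xi>"
              using S(1,2) eventually_at_topological by blast
            then show ?thesis
            proof (rule eventually_mono)
              fix \<mu> assume *: "\<mu> \<in> S \<and> \<mu> \<noteq> \<xi>"
              then have "poly d \<mu> \<noteq> 0" using pd S'(2) by simp
              then show "F \<mu> f v / (\<mu> - \<xi>) ^ m = block_inverse (W \<mu>) 1 \<mu> f v"
                using FR[of \<mu> f v] * by (simp add: R_def)
            qed
          qed
          ultimately have "((\<lambda>\<mu>. block_inverse (W \<mu>) 1 \<mu> f v) \<longlongrightarrow> H.coeff m f v) (at \<xi>)"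
            by (rule Lim_transform_eventually)
          then have "Lim (at \<xi>) (\<lambda>\<mu>. block_inverse (W \<mu>) 1 \<mu> f v) = H.coeff m f v"
            by (intro tendsto_Lim) simp
          moreover have "poly d \<xi> = 0" using False by (simp add: pd)
          ultimately show "R \<xi> f v = H.coeff m f v" by (simp add: R_def)
        qed
      qed
    qed
  qed
  moreover have "\<forall>\<^sub>F \<mu> in at_infinity. \<forall>f \<in> elems X. R \<mu> f \<in> elems (sp 1) \<and> shifted \<mu> (R \<mu> f) = f"
  proof -
    have "bounded {\<mu>. poly d \<mu> = 0}" using poly_roots_finite[OF d0] by (rule finite_imp_bounded)
    then obtain K where K: "\<And>\<mu>. poly d \<mu> = 0 \<Longrightarrow> cmod \<mu> \<le> K" unfolding bounded_iff by blast
    show ?thesis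
      unfolding eventually_at_infinity
    \<comment> \<open>Beyond \<open>K\<close> there are no zeros of \<open>d\<close>, so
      \<open>R\<close> is the plain block inverse; beyond one the estimates hold with
      \<open>b = 1\<close> as well.\<close>
    proof (intro exI[of _ "max K 1 + 1"] allI impI ballI)
      fix \<mu> f assume \<mu>: "max K 1 + 1 \<le> cmod \<mu>" and f: "f \<in> elems X"
      have d\<mu>: "poly d \<mu> \<noteq> 0" using K[of \<mu>] \<mu> by auto
      have \<mu>1: "1 < cmod \<mu>" "b < cmod \<mu>" "\<mu> \<noteq> 0" using \<mu> b by auto
      have R\<mu>: "R \<mu> f = block_inverse (W \<mu>) 1 \<mu> f" using d\<mu> by (simp add: R_def fun_eq_iff)
      \<comment> \<open>For \<open>b = 1\<close> both weights coincide. This places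
        \<open>R \<mu> f\<close> in \<open>sp 1\<close>, as is necessary for comparing it with the
        resolvent.\<close>
      have "\<exists>B. \<forall>\<mu>' W' e. cmod \<mu> \<le> cmod \<mu>' \<longrightarrow> cmod e \<le> 1 \<longrightarrow>
          (\<forall>k\<in>L. \<forall>l\<in>L. cmod (W' k l) \<le> cmod (W \<mu> k l)) \<longrightarrow>
          bop (sp 1) (sp (1 / 1)) (block_inverse W' e \<mu>') B"
        by (rule block_inverse_bop) (use \<mu>1(1) in auto)
      then obtain B where "\<forall>\<mu>' W' e. cmod \<mu> \<le> cmod \<mu>' \<longrightarrow> cmod e \<le> 1 \<longrightarrow>
          (\<forall>k\<in>L. \<forall>l\<in>L. cmod (W' k l) \<le> cmod (W \<mu> k l)) \<longrightarrow>
          bop (sp 1) (sp (1 / 1)) (block_inverse W' e \<mu>') B" by (rule exE)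
      then have "bop (sp 1) (sp (1 / 1)) (block_inverse (W \<mu>) 1 \<mu>) B" by simp
      moreover have "f \<in> elems (sp 1)" using bopD(1)[OF inclusion_bop[OF b] f] .
      ultimately have "R \<mu> f \<in> elems (sp 1)" unfolding R\<mu> using bopD(1) by fastforce
      moreover have "shifted \<mu> (R \<mu> f) = f"
        unfolding R\<mu> by (rule block_inverse_shifted[OF b(1) \<mu>1(2) f W[OF \<mu>1(3) d\<mu>]])
      ultimately show "R \<mu> f \<in> elems (sp 1) \<and> shifted \<mu> (R \<mu> f) = f" by blast
    qed
  qed
  ultimately show ?thesis by blast
qed

end


section \<open>Funnels, cusps and the pieces of a decomposition\<close>

context graph_of_groups_with_boundary
begin

sublocale B: bidirected_digraph "ugraph G" "erev G"
  by (rule bidirected)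

lemma oedge_ends: "e \<in> oedges G \<Longrightarrow> org G e \<in> vertices G \<and> ter G e \<in> vertices G"
  by (simp add: oedges_def vertices_def org_def ter_def)

lemma erev_oedge:
  assumes "e \<in> oedges G"
  shows "erev G e \<in> oedges G" "org G (erev G e) = ter G e" "ter G (erev G e) = org G e"
    "erev G (erev G e) = e" "erev G e \<noteq> e"
  using assms B.arev_neq by (simp_all add: oedges_def org_def ter_def)

lemma Sv_pos: "v \<in> vertices G \<Longrightarrow> 0 < Sv G v"
proof -
  assume v: "v \<in> vertices G"
  interpret group "vgroup G v" by (rule vgroup_group[OF v])
  show ?thesis using vgroup_finite[OF v] order_gt_0_iff_finite by (simp add: Sv_def)
qed

lemma Se_pos: "e \<in> oedges G \<union> prongs G \<Longrightarrow> 0 < Se G e"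
proof -
  assume e: "e \<in> oedges G \<union> prongs G"
  interpret group "egroup G e" by (rule egroup_group[OF e])
  show ?thesis using egroup_finite[OF e] order_gt_0_iff_finite by (simp add: Se_def)
qed

lemma Se_erev: "e \<in> oedges G \<Longrightarrow> Se G (erev G e) = Se G e"
  by (simp add: Se_def egroup_erev)

lemma Se_iso: "emb G e \<in> iso (egroup G e) (vgroup G (ter G e)) \<Longrightarrow> Se G e = Sv G (ter G e)"
  unfolding iso_def by (auto simp: Se_def Sv_def order_def dest: bij_betw_same_card)

section \<open>Distances and circuits in trees\<close>

lemma gdist_walk:
  assumes "u \<in> vertices G" "v \<in> vertices G"
  obtains p where "B.awalk u p v" "length p = gdist G u v"
proof -
  have "strongly_connected (ugraph G)"
    by (rule B.symmetric_connected_imp_strongly_connected[OF B.sym_arcs connected])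
  then have "u \<rightarrow>\<^sup>*\<^bsub>ugraph G\<^esub> v"
    using assms by (simp add: strongly_connected_def vertices_def)
  then have "\<exists>n p. B.awalk u p v \<and> length p = n" by (auto simp: B.reachable_awalk)
  then have "\<exists>p. B.awalk u p v \<and> length p = gdist G u v" unfolding gdist_def by (rule LeastI_ex)
  then show thesis using that by blast
qed

lemma gdist_le: "B.awalk u p v \<Longrightarrow> gdist G u v \<le> length p"
  unfolding gdist_def by (rule Least_le) blast

lemma gdist_self: "u \<in> vertices G \<Longrightarrow> gdist G u u = 0"
  using gdist_le[of u "[]" u] by (simp add: B.awalk_Nil_iff vertices_def)

lemma gdist_step:
  assumes "u \<in> vertices G" "e \<in> oedges G"
  shows "gdist G u (ter G e) \<le> Suc (gdist G u (org G e))"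
proof -
  obtain p where p: "B.awalk u p (org G e)" "length p = gdist G u (org G e)"
    using gdist_walk[OF assms(1)] oedge_ends[OF assms(2)] by blast
  have w: "B.awalk u (p @ [e]) (ter G e)"
    using B.awalk_appendI[OF p(1)[unfolded org_def]] B.arc_implies_awalk[of e] assms(2)
    by (simp add: oedges_def ter_def)
  show ?thesis using gdist_le[OF w] p(2) by simp
qed

lemma gdist_pred:
  assumes u: "u \<in> vertices G" and v: "v \<in> vertices G" "v \<noteq> u"
  obtains e where "e \<in> oedges G" "ter G e = v" "gdist G u v = Suc (gdist G u (org G e))"
proof -
  obtain p where p: "B.awalk u p v" "length p = gdist G u v" using gdist_walk[OF u v(1)] .
  have "p \<noteq> []" using p(1) v(2) by (auto simp: B.awalk_Nil_iff)
  then obtain p' e where pe: "p = p' @ [e]" by (metis rev_exhaust)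
  have e: "e \<in> oedges G" "B.awalk u p' (org G e)" "ter G e = v"
    using p(1) by (auto simp: pe B.awalk_Cons_iff B.awalk_Nil_iff oedges_def org_def ter_def)
  have "Suc (gdist G u (org G e)) \<le> gdist G u v" using gdist_le[OF e(2)] p(2) pe by simp
  moreover have "gdist G u v \<le> Suc (gdist G u (org G e))" using gdist_step[OF u e(1)] e(3) by simp
  ultimately show thesis using that e by simp
qed

text \<open>Two different vertices at the same distance from \<open>u\<close> are joined by a path inside the ball,
  running through their geodesics; together with an edge or two it becomes a circuit.\<close>

lemma level_path:
  assumes u: "u \<in> vertices G"
  shows "a \<in> vertices G \<Longrightarrow> b \<in> vertices G \<Longrightarrow> a \<noteq> b \<Longrightarrow> gdist G u a = n \<Longrightarrow> gdist G u b = n \<Longrightarrow>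
    \<exists>p. B.awalk a p b \<and> distinct (B.awalk_verts a p) \<and> (\<forall>x \<in> set (B.awalk_verts a p). gdist G u x \<le> n) \<and>
      2 \<le> length p"
proof (induction n arbitrary: a b)
  case 0
  \<comment> \<open>At level zero there is only \<open>u\<close>, so two different vertices cannot
    occur.\<close>
  have "a = u" if "a \<in> vertices G" "gdist G u a = 0" for a
    using gdist_walk[OF u that(1)] that(2) by (metis B.awalk_Nil_iff length_0_conv)
  then show ?case using 0 by blast
next
  case (Suc n)
  have nu: "a \<noteq> u" "b \<noteq> u" using Suc.prems gdist_self[OF u] by auto
  obtain e where e: "e \<in> oedges G" "ter G e = a" "gdist G u a = Suc (gdist G u (org G e))"
    using gdist_pred[OF u Suc.prems(1) nu(1)] .
  obtain e' where e': "e' \<in> oedges G" "ter G e' = b" "gdist G u b = Suc (gdist G u (org G e'))"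
    using gdist_pred[OF u Suc.prems(2) nu(2)] .
  note r = erev_oedge[OF e(1)]
  have d: "gdist G u (org G e) = n" "gdist G u (org G e') = n" using e e' Suc.prems by auto
  have ne: "org G e \<noteq> a" "org G e \<noteq> b" "org G e' \<noteq> b" using d Suc.prems by auto
  show ?case
  proof (cases "org G e = org G e'")
    case True
    have "B.awalk a [erev G e, e'] b"
      using r e e' True Suc.prems(2)
      by (simp add: B.awalk_Cons_iff B.awalk_Nil_iff oedges_def org_def ter_def vertices_def)
    moreover have "B.awalk_verts a [erev G e, e'] = [a, org G e, b]"
      using r e e' True by (simp add: org_def ter_def)
    ultimately show ?thesis using ne Suc.prems d by (intro exI[of _ "[erev G e, e']"]) auto
  next
    case False
    obtain p where p: "B.awalk (org G e) p (org G e')" "distinct (B.awalk_verts (org G e) p)"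
      "\<forall>x \<in> set (B.awalk_verts (org G e) p). gdist G u x \<le> n"
      using Suc.IH[OF _ _ False d] oedge_ends[OF e(1)] oedge_ends[OF e'(1)] by blast
    have w1: "B.awalk (org G e) (p @ [e']) b"
      using B.awalk_appendI[OF p(1)[unfolded org_def]] B.arc_implies_awalk[of e'] e'
      by (simp add: oedges_def ter_def org_def del: B.awalk_append_iff)
    have w: "B.awalk a (erev G e # p @ [e']) b"
      using w1 r e by (simp add: B.awalk_Cons_iff oedges_def org_def ter_def del: B.awalk_append_iff)
    have la: "B.awlast (org G e) p = org G e'" using p(1) by auto
    have "B.awalk_verts a (erev G e # p @ [e']) = a # (B.awalk_verts (org G e) p @ [b])"
      using B.awalk_verts_append[OF w1] la r e e' by (simp add: org_def ter_def)
    moreover have "a \<notin> set (B.awalk_verts (org G e) p)" "b \<notin> set (B.awalk_verts (org G e) p)"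
      using p(3) Suc.prems by fastforce+
    ultimately have "distinct (B.awalk_verts a (erev G e # p @ [e']))"
      "\<forall>x \<in> set (B.awalk_verts a (erev G e # p @ [e'])). gdist G u x \<le> Suc n"
      using p(2,3) Suc.prems by (auto simp: le_SucI)
    then show ?thesis using w by (intro exI[of _ "erev G e # p @ [e']"]) auto
  qed
qed

text \<open>\<open>cycle\<close> asks for distinct vertices after dropping the head of the list, so
  the start \<open>a\<close> may reappear once, at the end.\<close>

lemma circuit_from_path:
  assumes p: "B.awalk a p b" "distinct (B.awalk_verts a p)" and q: "B.awalk b q a" "q \<noteq> []"
    and vs: "B.awalk_verts b q = b # ys @ [a]" "distinct ys" "set ys \<inter> set (B.awalk_verts a p) = {}"
  shows "B.cycle (p @ q)"
proof -
  have w: "B.awalk a (p @ q) a" by (rule B.awalk_appendI[OF p(1) q(1)])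
  have la: "B.awlast a p = b" using p(1) by auto
  have "hd (B.awalk_verts a p) = a" using p(1) by auto
  then obtain zs where zs: "B.awalk_verts a p = a # zs" using B.awalk_verts_non_Nil by (metis list.collapse)
  have "B.awalk_verts a (p @ q) = a # (zs @ ys @ [a])"
    unfolding B.awalk_verts_append[OF w] la by (simp add: vs(1) zs)
  moreover have "distinct (zs @ ys @ [a])" using p(2) vs zs by auto
  ultimately show ?thesis unfolding B.cycle_def using w q(2) by (intro exI[of _ a]) auto
qed

text \<open>Closing a level path of length at least two by the edge gives a circuit with three or
  more arcs, while the cycles of a tree are mere backtracks with two arcs. A loop would be a cycle
  with a single arc.\<close>

lemma tree_no_level_edge:
  assumes tree: "is_tree G" and u: "u \<in> vertices G" and e: "e \<in> oedges G"
  shows "gdist G u (org G e) \<noteq> gdist G u (ter G e)"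
proof
  assume eq: "gdist G u (org G e) = gdist G u (ter G e)"
  have two: "length p = 2" if "B.cycle p" for p
    using tree that unfolding is_tree_def by fastforce
  have w: "B.awalk (org G e) [e] (ter G e)"
    using e by (simp add: B.awalk_Cons_iff B.awalk_Nil_iff oedges_def org_def ter_def)
  show False
  proof (cases "org G e = ter G e")
    case True
    then have "B.cycle [e]" unfolding B.cycle_def using w by (intro exI[of _ "org G e"]) auto
    then show False using two by fastforce
  next
    case False
    obtain p where p: "B.awalk (ter G e) p (org G e)" "distinct (B.awalk_verts (ter G e) p)" "2 \<le> length p"
      using level_path[OF u, of "ter G e" "org G e" "gdist G u (org G e)"] eq oedge_ends[OF e] False by metis
    have "B.cycle (p @ [e])"
      by (rule circuit_from_path[OF p(1,2) w, where ys = "[]"]) (simp_all add: org_def ter_def)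
    then show False using two p(3) by fastforce
  qed
qed

text \<open>Two arcs descending from the previous level to one vertex either are parallel and form a
  two-arc cycle that is no backtrack, or close a level path between their origins to a circuit
  through the common terminus.\<close>

lemma tree_parent_unique:
  assumes tree: "is_tree G" and u: "u \<in> vertices G"
    and e: "e \<in> oedges G" "gdist G u (org G e) < gdist G u (ter G e)"
    and e': "e' \<in> oedges G" "gdist G u (org G e') < gdist G u (ter G e')" and ter: "ter G e = ter G e'"
  shows "e = e'"
proof (rule ccontr)
  assume ne: "e \<noteq> e'"
  have cyc: "\<exists>e \<in> oedges G. p = [e, erev G e]" if "B.cycle p" for p
    using tree that unfolding is_tree_def by blast
  note r = erev_oedge[OF e(1)]
  have d: "gdist G u (org G e) = gdist G u (org G e')"
    using gdist_step[OF u e(1)] gdist_step[OF u e'(1)] e(2) e'(2) ter by simp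
  have w: "B.awalk (org G e') [e', erev G e] (org G e)"
    using r e' e ter by (simp add: B.awalk_Cons_iff B.awalk_Nil_iff oedges_def org_def ter_def)
  have vs: "B.awalk_verts (org G e') [e', erev G e] = [org G e', ter G e, org G e]"
    using r ter by (simp add: org_def ter_def)
  show False
  proof (cases "org G e = org G e'")
    case True
    then have "B.cycle [e', erev G e]"
      unfolding B.cycle_def using w vs e(2) by (intro exI[of _ "org G e'"]) auto
    then have "erev G e = erev G e'" using cyc by fastforce
    then show False using ne r(4) erev_oedge(4)[OF e'(1)] by metis
  next
    case False
    obtain p where p: "B.awalk (org G e) p (org G e')" "distinct (B.awalk_verts (org G e) p)"
      "\<forall>x \<in> set (B.awalk_verts (org G e) p). gdist G u x \<le> gdist G u (org G e)" "2 \<le> length p"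
      using level_path[OF u _ _ False refl d[symmetric]] oedge_ends[OF e(1)] oedge_ends[OF e'(1)] by blast
    have "B.cycle (p @ [e', erev G e])"
      by (rule circuit_from_path[OF p(1,2) w, where ys = "[ter G e]"]) (use vs p(3) e(2) in auto)
    then show False using cyc p(4) by fastforce
  qed
qed

end

text \<open>\<open>inn v\<close> is the arc or prong through which one enters the end when walking to \<open>v\<close> from the core;
  the sum is the diagonal of \<open>U P\<close>.\<close>

definition end_arcs :: "nat \<Rightarrow> ('v, 'e, 'g, 'h) gog \<Rightarrow> ('v \<Rightarrow> 'e) \<Rightarrow> bool" where
  "end_arcs q P inn \<longleftrightarrow> (\<forall>v \<in> vertices P.
     inn v \<in> oedges P \<union> prongs P \<and> ter P (inn v) = v \<and>
     (\<forall>e \<in> oedges P \<union> prongs P. ter P e = v \<and> e \<noteq> inn v \<longrightarrow>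
        e \<in> oedges P \<and> inn (org P e) = erev P e) \<and>
     (\<Sum>e | e \<in> oedges P \<union> prongs P \<and> ter P e = v \<and> e \<noteq> inn v.
        Sv P v / Se P e * (Sv P (org P e) / Se P e)) = real q)"

section \<open>Funnels and cusps as ends of the same kind\<close>

text \<open>The arc or prong coming from the root side carries the full group of its terminus and
  contributes one to the degree. On every other arc into \<open>v\<close> the edge group is that of
  the farther vertex, so the second factor of each summand is one and the sum is the remaining
  degree \<open>q\<close>.\<close>

lemma funnel_end_arcs:
  assumes "orbifold_funnel P" and deg: "\<And>v. v \<in> vertices P \<Longrightarrow> deg P v = real q + 1"
  shows "\<exists>inn. end_arcs q P inn"
proof -
  interpret graph_of_groups_with_boundary P using assms(1) by (simp add: orbifold_funnel_def)
  have tree: "is_tree P" using assms(1) by (simp add: orbifold_funnel_def)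
  obtain root h where root: "root \<in> vertices P" and h: "prongs P = {h}" "ter P h = root"
    and hiso: "emb P h \<in> iso (egroup P h) (vgroup P root)"
    and iso: "\<And>e. e \<in> oedges P \<Longrightarrow> gdist P root (org P e) < gdist P root (ter P e) \<Longrightarrow>
          emb P e \<in> iso (egroup P e) (vgroup P (ter P e))"
    using assms(1) unfolding orbifold_funnel_def by blast
  \<comment> \<open>The root has no arc from a lower level; its prong takes that place.\<close>
  define inn where "inn = (\<lambda>v. if v = root then h
    else THE e. e \<in> oedges P \<and> ter P e = v \<and> gdist P root (org P e) < gdist P root (ter P e))"
  have inn_eq: "inn (ter P e) = e"
    if e: "e \<in> oedges P" "gdist P root (org P e) < gdist P root (ter P e)" for e
  proof -
    have "ter P e \<noteq> root" using that gdist_self[OF root] by auto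
    moreover have "(THE e'. e' \<in> oedges P \<and> ter P e' = ter P e \<and> gdist P root (org P e') < gdist P root (ter P e')) = e"
    proof (rule the_equality)
      fix e' assume "e' \<in> oedges P \<and> ter P e' = ter P e \<and> gdist P root (org P e') < gdist P root (ter P e')"
      then show "e' = e" using tree_parent_unique[OF tree root _ _ e] by blast
    qed (use e in simp)
    ultimately show ?thesis by (simp add: inn_def)
  qed
  have innP: "inn v \<in> oedges P \<union> prongs P \<and> ter P (inn v) = v \<and> Se P (inn v) = Sv P v" if v: "v \<in> vertices P" for v
  proof (cases "v = root")
    case True
    then show ?thesis using h hiso Se_iso[of h] by (simp add: inn_def)
  next
    case False
    obtain e where e: "e \<in> oedges P" "ter P e = v" "gdist P root v = Suc (gdist P root (org P e))"
      using gdist_pred[OF root v False] .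
    have lt: "gdist P root (org P e) < gdist P root (ter P e)" using e by simp
    then have "inn v = e" using inn_eq[OF e(1) lt] e(2) by simp
    then show ?thesis using e Se_iso[OF iso[OF e(1) lt]] by simp
  qed
  have other: "e \<in> oedges P \<and> inn (org P e) = erev P e \<and> Sv P (org P e) = Se P e"
    if e: "e \<in> oedges P \<union> prongs P" "ter P e = v" "e \<noteq> inn v" "v \<in> vertices P" for e v
  proof -
    have eo: "e \<in> oedges P" using e h by (auto simp: inn_def)
    note r = erev_oedge[OF eo]
    have "\<not> gdist P root (org P e) < gdist P root (ter P e)" using inn_eq[OF eo] e by auto
    then have lt: "gdist P root (org P (erev P e)) < gdist P root (ter P (erev P e))"
      using tree_no_level_edge[OF tree root eo] r by simp
    then show ?thesis
      using inn_eq[OF r(1) lt] Se_iso[OF iso[OF r(1) lt]] Se_erev[OF eo] r eo by simp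
  qed
  have "end_arcs q P inn"
    unfolding end_arcs_def
  proof (intro ballI conjI)
    fix v assume v: "v \<in> vertices P"
    let ?A = "{e. e \<in> oedges P \<union> prongs P \<and> ter P e = v}"
    have A: "finite ?A" using locally_finite[OF v] .
    have "(\<Sum>e | e \<in> oedges P \<union> prongs P \<and> ter P e = v \<and> e \<noteq> inn v.
        Sv P v / Se P e * (Sv P (org P e) / Se P e))
      = (\<Sum>e\<in>?A - {inn v}. Sv P v / Se P e)"
    proof (rule sum.cong)
      fix e assume e: "e \<in> ?A - {inn v}"
      then have "Sv P (org P e) = Se P e" "0 < Se P e" using other[of e v] v Se_pos[of e] by auto
      then show "Sv P v / Se P e * (Sv P (org P e) / Se P e) = Sv P v / Se P e" by simp
    qed auto
    also have "\<dots> = deg P v - Sv P v / Se P (inn v)"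
      using A innP[OF v] by (simp add: deg_def sum_diff1)
    also have "\<dots> = real q" using deg[OF v] innP[OF v] Sv_pos[OF v] by simp
    finally show "(\<Sum>e | e \<in> oedges P \<union> prongs P \<and> ter P e = v \<and> e \<noteq> inn v.
        Sv P v / Se P e * (Sv P (org P e) / Se P e)) = real q" .
  qed (use innP other in blast)+
  then show ?thesis by blast
qed

text \<open>An edge of the ray carries the group of its inner vertex, so the sum at
  \<open>x n\<close> is \<open>Sv P (x (Suc n)) / Sv P (x n)\<close>. This ratio is read off from
  the degree of the next vertex \<open>x (Suc n)\<close>, whose outward arc contributes one.\<close>

lemma cusp_end_arcs:
  assumes "cusp P" and deg: "\<And>v. v \<in> vertices P \<Longrightarrow> deg P v = real q + 1"
  shows "\<exists>inn. end_arcs q P inn"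
proof -
  interpret graph_of_groups_with_boundary P using assms(1) by (simp add: cusp_def)
  obtain x \<epsilon> h where x: "bij_betw x (UNIV :: nat set) (vertices P)"
    and oe: "oedges P = range \<epsilon> \<union> erev P ` range \<epsilon>"
    and \<epsilon>: "\<And>i. org P (\<epsilon> i) = x i" "\<And>i. ter P (\<epsilon> i) = x (Suc i)"
    and h: "prongs P = {h}" "ter P h = x 0"
    and iso: "\<And>i. emb P (erev P (\<epsilon> i)) \<in> iso (egroup P (erev P (\<epsilon> i))) (vgroup P (x i))"
    using assms(1) unfolding cusp_def by blast
  have xi: "x i = x j \<longleftrightarrow> i = j" for i j using x by (auto simp: bij_betw_def inj_def)
  have xv: "x i \<in> vertices P" for i using x by (auto simp: bij_betw_def)
  have \<epsilon>o: "\<epsilon> i \<in> oedges P" for i using oe by blast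
  note r = erev_oedge[OF \<epsilon>o]
  have hno: "h \<notin> oedges P" using prongs_not_edges h by blast
  define inn where "inn = (\<lambda>v. case inv_into UNIV x v of 0 \<Rightarrow> h | Suc i \<Rightarrow> \<epsilon> i)"
  have ix: "inv_into UNIV x (x i) = i" for i using x by (simp add: bij_betw_def)
  have inn: "inn (x 0) = h" "inn (x (Suc i)) = \<epsilon> i" for i by (simp_all add: inn_def ix)
  have into: "{e. e \<in> oedges P \<union> prongs P \<and> ter P e = x n} = {inn (x n), erev P (\<epsilon> n)}"
    and ne: "inn (x n) \<noteq> erev P (\<epsilon> n)" for n
  proof -
    show "{e. e \<in> oedges P \<union> prongs P \<and> ter P e = x n} = {inn (x n), erev P (\<epsilon> n)}"
      using r \<epsilon> h \<epsilon>o by (cases n) (auto simp: oe xi inn)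
    show "inn (x n) \<noteq> erev P (\<epsilon> n)"
    proof (cases n)
      case 0
      then show ?thesis using hno r(1) by (auto simp: inn)
    next
      case (Suc i)
      have "org P (\<epsilon> i) \<noteq> org P (erev P (\<epsilon> n))" using r(2)[of n] \<epsilon> Suc by (simp add: xi)
      then show ?thesis using Suc by (auto simp: inn)
    qed
  qed
  have Se: "Se P (erev P (\<epsilon> i)) = Sv P (x i)" "Se P (\<epsilon> i) = Sv P (x i)" for i
    using Se_iso[of "erev P (\<epsilon> i)"] iso[of i] r(3)[of i] \<epsilon> Se_erev[OF \<epsilon>o, of i] by auto
  have Spos: "0 < Sv P (x i)" for i by (rule Sv_pos[OF xv])
  have "end_arcs q P inn"
    unfolding end_arcs_def
  proof
    fix v assume "v \<in> vertices P"
    then obtain n where n: "v = x n" using x by (auto simp: bij_betw_def)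
    have rest: "{e. e \<in> oedges P \<union> prongs P \<and> ter P e = v \<and> e \<noteq> inn v} = {erev P (\<epsilon> n)}"
    proof -
      have "{e. e \<in> oedges P \<union> prongs P \<and> ter P e = v \<and> e \<noteq> inn v}
        = {e. e \<in> oedges P \<union> prongs P \<and> ter P e = x n} - {inn (x n)}" by (auto simp: n)
      then show ?thesis unfolding into using ne[of n] by auto
    qed
    have "deg P (x (Suc n)) = Sv P (x (Suc n)) / Se P (\<epsilon> n) + Sv P (x (Suc n)) / Se P (erev P (\<epsilon> (Suc n)))"
      unfolding deg_def into using ne[of "Suc n"] by (simp add: inn)
    then have "Sv P (x (Suc n)) / Sv P (x n) = real q"
      using deg[OF xv, of "Suc n"] Spos[of "Suc n"] by (simp add: Se)
    then have "(\<Sum>e | e \<in> oedges P \<union> prongs P \<and> ter P e = v \<and> e \<noteq> inn v.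
        Sv P v / Se P e * (Sv P (org P e) / Se P e)) = real q"
      unfolding rest using Spos[of n] r(2)[of n] \<epsilon> by (simp add: Se n)
    moreover have "inn v \<in> oedges P \<union> prongs P \<and> ter P (inn v) = v" using into[of n] n by blast
    moreover have "e \<in> oedges P \<and> inn (org P e) = erev P e"
      if "e \<in> oedges P \<union> prongs P" "ter P e = v \<and> e \<noteq> inn v" for e
    proof -
      have "e = erev P (\<epsilon> n)" using rest that by blast
      then show ?thesis using r[of n] \<epsilon> by (simp add: inn)
    qed
    ultimately show "inn v \<in> oedges P \<union> prongs P \<and> ter P (inn v) = v \<and>
     (\<forall>e \<in> oedges P \<union> prongs P. ter P e = v \<and> e \<noteq> inn v \<longrightarrow>
        e \<in> oedges P \<and> inn (org P e) = erev P e) \<and>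
     (\<Sum>e | e \<in> oedges P \<union> prongs P \<and> ter P e = v \<and> e \<noteq> inn v.
        Sv P v / Se P e * (Sv P (org P e) / Se P e)) = real q" by blast
  qed
  then show ?thesis by blast
qed

section \<open>From the pieces back to the whole graph\<close>

context graph_of_groups
begin

context
  fixes C :: "'b set"
  assumes C: "C \<subseteq> oedges G" "erev G ` C = C"
begin

text \<open>\<open>C\<close> is closed under reversal, so the cut graph stays symmetric and its
  strongly connected components are the ordinary ones.\<close>

lemma cut_sym: "sym_digraph (ugraph (cut_along G C))"
proof -
  have fields: "ugraph (cut_along G C) = \<lparr>verts = vertices G, arcs = oedges G - C, tail = org G, head = ter G\<rparr>"
    by (simp add: cut_along_def)
  interpret wf_digraph "ugraph (cut_along G C)"
    by unfold_locales (auto simp: fields oedge_ends)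
  have "sym (arcs_ends (ugraph (cut_along G C)))"
  proof (rule symI)
    fix u v assume "(u, v) \<in> arcs_ends (ugraph (cut_along G C))"
    then obtain e where e: "e \<in> oedges G - C" "org G e = u" "ter G e = v"
      by (auto simp: arcs_ends_def arc_to_ends_def fields)
    have "erev G e \<notin> C"
    proof
      assume "erev G e \<in> C"
      then have "erev G (erev G e) \<in> C" using C(2) by blast
      then show False using e erev_oedge(4)[of e] by simp
    qed
    then show "(v, u) \<in> arcs_ends (ugraph (cut_along G C))"
      using e erev_oedge[of e] unfolding arcs_ends_def arc_to_ends_def fields
      by (intro image_eqI[of _ _ "erev G e"]) auto
  qed
  then show ?thesis by unfold_locales (simp add: symmetric_def)
qed

interpretation Q: sym_digraph "ugraph (cut_along G C)" by (rule cut_sym)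

lemma cut_fields:
  "verts (ugraph (cut_along G C)) = vertices G" "arcs (ugraph (cut_along G C)) = oedges G - C"
  "tail (ugraph (cut_along G C)) = org G" "head (ugraph (cut_along G C)) = ter G"
  by (simp_all add: cut_along_def)

text \<open>A component is closed under uncut arcs in both directions, and a cut arc survives as a
  prong at its terminus. Thus the arcs of \<open>G\<close> into a piece are precisely the arcs and
  prongs of the piece.\<close>

lemma piece_fields:
  assumes "P \<in> pieces G C"
  shows "vertices P \<subseteq> vertices G"
    and "oedges P = {e \<in> oedges G - C. ter G e \<in> vertices P}"
    and "\<And>e. e \<in> oedges G - C \<Longrightarrow> org G e \<in> vertices P \<longleftrightarrow> ter G e \<in> vertices P"
    and "prongs P = {h \<in> C. ter G h \<in> vertices P}"
    and "org P = org G" "ter P = ter G" "Sv P = Sv G" "Se P = Se G"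
    and "\<And>e. e \<in> oedges P \<Longrightarrow> erev P e = erev G e"
proof -
  obtain H where H: "H \<in> Q.sccs" "P = restrict_to (cut_along G C) H"
    using assms by (auto simp: pieces_def)
  have ind: "induced_subgraph H (ugraph (cut_along G C))" using H(1) by (auto simp: Q.sccs_def)
  have vP: "vertices P = verts H" by (simp add: H(2) restrict_to_def vertices_def)
  have oP: "oedges P = arcs H" by (simp add: H(2) restrict_to_def oedges_def)
  have compat: "tail H = org G" "head H = ter G"
    using ind by (simp_all add: induced_subgraph_def subgraph_def compatible_def cut_fields)
  have aH: "arcs H = {e \<in> oedges G - C. org G e \<in> verts H \<and> ter G e \<in> verts H}"
    using ind by (auto simp: induced_subgraph_def cut_fields)
  show "vertices P \<subseteq> vertices G"
    using ind by (auto simp: vP induced_subgraph_def subgraph_def cut_fields)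
  have S: "verts H \<in> Q.sccs_verts" using H(1) by (intro Q.in_sccs_vertsI_sccs) blast
  show iff: "org G e \<in> vertices P \<longleftrightarrow> ter G e \<in> vertices P" if e: "e \<in> oedges G - C" for e
  proof -
    have 1: "org G e \<rightarrow>\<^sup>*\<^bsub>ugraph (cut_along G C)\<^esub> ter G e"
      using Q.reachable_awalkI[OF Q.arc_implies_awalk[of e]] e by (simp add: cut_fields)
    then have 2: "ter G e \<rightarrow>\<^sup>*\<^bsub>ugraph (cut_along G C)\<^esub> org G e"
      by (rule symmetric_reachable[OF Q.sym_arcs])
    show ?thesis using 1 2 S unfolding Q.in_sccs_verts_conv_reachable vP by blast
  qed
  show "oedges P = {e \<in> oedges G - C. ter G e \<in> vertices P}"
    using iff unfolding oP aH vP by blast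
  show "prongs P = {h \<in> C. ter G h \<in> vertices P}"
    by (auto simp: vP H(2) restrict_to_def cut_along_def ter_def no_prongs vertices_def)
  show "org P = org G" "ter P = ter G"
    using compat by (simp_all add: H(2) restrict_to_def org_def ter_def)
  show "Sv P = Sv G" "Se P = Se G"
    by (simp_all add: H(2) restrict_to_def cut_along_def Sv_def Se_def fun_eq_iff)
  show "erev P e = erev G e" if "e \<in> oedges P" for e
    using that unfolding oP by (simp add: H(2) restrict_to_def cut_along_def aH)
qed

lemma piece_exists: "v \<in> vertices G \<Longrightarrow> \<exists>P \<in> pieces G C. v \<in> vertices P"
  using Q.scc_for_vert_ex[of v]
  by (auto simp: pieces_def cut_fields restrict_to_def vertices_def)

lemma piece_unique:
  assumes "P \<in> pieces G C" "P' \<in> pieces G C" "v \<in> vertices P" "v \<in> vertices P'"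
  shows "P = P'"
proof -
  obtain H H' where H: "H \<in> Q.sccs" "P = restrict_to (cut_along G C) H"
    "H' \<in> Q.sccs" "P' = restrict_to (cut_along G C) H'"
    using assms by (auto simp: pieces_def)
  then have "v \<in> verts H \<inter> verts H'" using assms by (simp add: restrict_to_def vertices_def)
  then have "H = H'" using Q.scc_disj[OF H(1,3)] by blast
  then show ?thesis using H by simp
qed

text \<open>The pieces partition the vertices, so entering arcs chosen piece by piece combine to one
  function on \<open>G\<close>; a prong through which a piece is entered becomes an arc of
  \<open>C\<close>. All other arcs into an end vertex stay inside the piece.\<close>

lemma ends_arcs:
  assumes L: "L \<in> pieces G C"
    and ends: "\<And>P. P \<in> pieces G C \<Longrightarrow> P \<noteq> L \<Longrightarrow> \<exists>inn. end_arcs q P inn"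
  obtains inn where
    "\<And>v. v \<in> vertices G - vertices L \<Longrightarrow> inn v \<in> oedges G \<and> ter G (inn v) = v"
    "\<And>e. e \<in> oedges G \<Longrightarrow> ter G e \<in> vertices G - vertices L \<Longrightarrow> e \<noteq> inn (ter G e) \<Longrightarrow>
       org G e \<in> vertices G - vertices L \<and> inn (org G e) = erev G e"
    "\<And>v. v \<in> vertices G - vertices L \<Longrightarrow>
      (\<Sum>e | e \<in> oedges G \<and> ter G e = v \<and> e \<noteq> inn v. Sv G v / Se G e * (Sv G (org G e) / Se G e)) = real q"
proof -
  define end_of :: "('a, 'b, 'c, 'd) gog \<Rightarrow> 'a \<Rightarrow> 'b" where "end_of = (\<lambda>P. SOME inn. end_arcs q P inn)"
  have end_of: "end_arcs q P (end_of P)" if "P \<in> pieces G C" "P \<noteq> L" for P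
    unfolding end_of_def by (rule someI_ex[OF ends[OF that]])
  define piece_of where "piece_of = (\<lambda>v. THE P. P \<in> pieces G C \<and> v \<in> vertices P)"
  have piece_of: "piece_of v = P" if "P \<in> pieces G C" "v \<in> vertices P" for P v
    unfolding piece_of_def by (rule the_equality) (use that piece_unique in blast)+
  define inn where "inn = (\<lambda>v. end_of (piece_of v) v)"
  have main: "inn v \<in> oedges G \<and> ter G (inn v) = v \<and>
      (\<forall>e \<in> oedges G. ter G e = v \<and> e \<noteq> inn v \<longrightarrow>
        org G e \<in> vertices G - vertices L \<and> inn (org G e) = erev G e) \<and>
      (\<Sum>e | e \<in> oedges G \<and> ter G e = v \<and> e \<noteq> inn v. Sv G v / Se G e * (Sv G (org G e) / Se G e)) = real q"
    if v: "v \<in> vertices G - vertices L" for v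
  proof -
    obtain P where P: "P \<in> pieces G C" "v \<in> vertices P" using piece_exists v by blast
    have PL: "P \<noteq> L" using P v by blast
    note f = piece_fields[OF P(1)]
    have inn: "inn u = end_of P u" if "u \<in> vertices P" for u using piece_of[OF P(1) that] by (simp add: inn_def)
    \<comment> \<open>Cut arcs reappear as prongs, so degree-like sums over the piece and over
      \<open>G\<close> have the same index set.\<close>
    have A: "e \<in> oedges P \<union> prongs P \<and> ter P e = v \<longleftrightarrow> e \<in> oedges G \<and> ter G e = v" for e
      using C(1) P(2) by (auto simp: f(2,4,6))
    note E = end_of[OF P(1) PL, unfolded end_arcs_def, rule_format, OF P(2)]
    have 1: "inn v \<in> oedges G" "ter G (inn v) = v"
      using E A[of "end_of P v"] inn[OF P(2)] by auto
    have 2: "org G e \<in> vertices G - vertices L \<and> inn (org G e) = erev G e"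
      if e: "e \<in> oedges G" "ter G e = v" "e \<noteq> inn v" for e
    proof -
      have "e \<in> oedges P \<union> prongs P" "ter P e = v" "e \<noteq> end_of P v" using A[of e] e inn[OF P(2)] by auto
      then have eP: "e \<in> oedges P" "end_of P (org P e) = erev P e" using E by blast+
      then have o: "org G e \<in> vertices P" using f(2) f(3)[of e] by blast
      moreover have "org G e \<notin> vertices L" using piece_unique[OF P(1) L o] PL by blast
      ultimately show ?thesis using eP f(1) inn[OF o] f(5) f(9)[OF eP(1)] by auto
    qed
    have "{e. e \<in> oedges G \<and> ter G e = v \<and> e \<noteq> inn v}
      = {e. e \<in> oedges P \<union> prongs P \<and> ter P e = v \<and> e \<noteq> end_of P v}"
      unfolding inn[OF P(2)] using A by (intro Collect_cong) metis
    then have "(\<Sum>e | e \<in> oedges G \<and> ter G e = v \<and> e \<noteq> inn v. Sv G v / Se G e * (Sv G (org G e) / Se G e)) = real q"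
      using E by (simp add: f(5,7,8))
    then show ?thesis using 1 2 by blast
  qed
  show thesis by (rule that[of inn]) (use main in blast)+
qed

end

end

section \<open>The adjacency operator in terms of parents and children\<close>

locale end_structure = graph_of_groups +
  fixes Lv :: "'a set" and inn :: "'a \<Rightarrow> 'b" and q :: nat and bp :: 'a
  assumes q: "0 < q" and core_finite: "finite Lv" and core_sub: "Lv \<subseteq> vertices G" and bp: "bp \<in> Lv"
    and inn: "\<And>v. v \<in> vertices G - Lv \<Longrightarrow> inn v \<in> oedges G \<and> ter G (inn v) = v"
    and other: "\<And>e. e \<in> oedges G \<Longrightarrow> ter G e \<in> vertices G - Lv \<Longrightarrow> e \<noteq> inn (ter G e) \<Longrightarrow>
       org G e \<in> vertices G - Lv \<and> inn (org G e) = erev G e"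
    and reg: "\<And>v. v \<in> vertices G - Lv \<Longrightarrow>
      (\<Sum>e | e \<in> oedges G \<and> ter G e = v \<and> e \<noteq> inn v. Sv G v / Se G e * (Sv G (org G e) / Se G e)) = real q"
begin

definition par :: "'a \<Rightarrow> 'a" where
  "par v = org G (inn v)"

text \<open>A geodesic from the core cannot reach \<open>u\<close> from a child of \<open>u\<close>, as it would have reached the
  child from \<open>u\<close>.\<close>

lemma level_par: "u \<in> vertices G - Lv \<Longrightarrow> gdist G bp u = Suc (gdist G bp (par u))"
proof (induction "gdist G bp u" arbitrary: u rule: less_induct)
  case less
  have bpV: "bp \<in> vertices G" using bp core_sub by blast
  have "u \<noteq> bp" using less.prems bp by blast
  then obtain e where e: "e \<in> oedges G" "ter G e = u" "gdist G bp u = Suc (gdist G bp (org G e))"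
    using gdist_pred[OF bpV] less.prems by blast
  show ?case
  proof (cases "e = inn u")
    case True
    then show ?thesis using e by (simp add: par_def)
  next
    case False
    then have o: "org G e \<in> vertices G - Lv" "inn (org G e) = erev G e" using other[OF e(1)] e less.prems by auto
    have "gdist G bp (org G e) = Suc (gdist G bp (par (org G e)))" using less.hyps[OF _ o(1)] e(3) by simp
    then show ?thesis using e o erev_oedge[OF e(1)] by (simp add: par_def)
  qed
qed

text \<open>If \<open>ter G e\<close> lies in the core and the reversed arc were not the entering
  arc of its terminus, \<open>other\<close> would put its origin outside the core.\<close>

lemma child_arc:
  assumes e: "e \<in> oedges G" and o: "org G e \<in> vertices G - Lv" and ne: "ter G e \<in> Lv \<or> e \<noteq> inn (ter G e)"
  shows "inn (org G e) = erev G e"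
proof (cases "ter G e \<in> Lv")
  case True
  note r = erev_oedge[OF e]
  show ?thesis
  proof (rule ccontr)
    assume "inn (org G e) \<noteq> erev G e"
    then show False using other[OF r(1)] r o True by auto
  qed
next
  case False
  then show ?thesis using other[OF e] oedge_ends[OF e] ne by blast
qed

text \<open>Parallel edges are possible in the core only, so children correspond to arcs.\<close>

lemma children_arcs:
  assumes v: "v \<in> vertices G"
  shows "bij_betw (\<lambda>u. erev G (inn u)) {u \<in> vertices G - Lv. par u = v}
    {e. e \<in> oedges G \<and> ter G e = v \<and> org G e \<in> vertices G - Lv \<and> (v \<in> Lv \<or> e \<noteq> inn v)}"
proof (rule bij_betw_byWitness[where f' = "org G"])
  show "\<forall>u\<in>{u \<in> vertices G - Lv. par u = v}. org G (erev G (inn u)) = u"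
    using inn erev_oedge by auto
  show "\<forall>e\<in>{e. e \<in> oedges G \<and> ter G e = v \<and> org G e \<in> vertices G - Lv \<and> (v \<in> Lv \<or> e \<noteq> inn v)}.
      erev G (inn (org G e)) = e"
    using child_arc erev_oedge by auto
  show "(\<lambda>u. erev G (inn u)) ` {u \<in> vertices G - Lv. par u = v}
    \<subseteq> {e. e \<in> oedges G \<and> ter G e = v \<and> org G e \<in> vertices G - Lv \<and> (v \<in> Lv \<or> e \<noteq> inn v)}"
  proof
    fix e assume "e \<in> (\<lambda>u. erev G (inn u)) ` {u \<in> vertices G - Lv. par u = v}"
    then obtain u where u: "u \<in> vertices G - Lv" "par u = v" "e = erev G (inn u)" by blast
    note i = inn[OF u(1)]
    have e: "e \<in> oedges G" "ter G e = v" "org G e = u"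
      using u i erev_oedge[of "inn u"] by (auto simp: par_def)
    \<comment> \<open>Otherwise \<open>u\<close> and \<open>v\<close> would be each other's parent,
      although a parent is one level closer to the base point.\<close>
    have "v \<in> Lv \<or> e \<noteq> inn v"
    proof (rule ccontr)
      assume "\<not> (v \<in> Lv \<or> e \<noteq> inn v)"
      then have "v \<in> vertices G - Lv" "par v = u" using v e by (auto simp: par_def)
      then show False using level_par[of v] level_par[OF u(1)] u(2) by simp
    qed
    then show "e \<in> {e. e \<in> oedges G \<and> ter G e = v \<and> org G e \<in> vertices G - Lv \<and> (v \<in> Lv \<or> e \<noteq> inn v)}"
      using e u by simp
  qed
  show "org G ` {e. e \<in> oedges G \<and> ter G e = v \<and> org G e \<in> vertices G - Lv \<and> (v \<in> Lv \<or> e \<noteq> inn v)}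
    \<subseteq> {u \<in> vertices G - Lv. par u = v}"
    using child_arc erev_oedge by (auto simp: par_def)
qed

lemma sum_children:
  fixes h :: "'b \<Rightarrow> 'x :: comm_monoid_add"
  assumes v: "v \<in> vertices G"
  shows "(\<Sum>u | u \<in> vertices G - Lv \<and> par u = v. h (erev G (inn u)))
    = (\<Sum>e | e \<in> oedges G \<and> ter G e = v \<and> org G e \<in> vertices G - Lv \<and> (v \<in> Lv \<or> e \<noteq> inn v). h e)"
  using sum.reindex_bij_betw[OF children_arcs[OF v], of h] by simp

lemma into_end: "v \<in> vertices G - Lv \<Longrightarrow>
    {e. e \<in> oedges G \<and> ter G e = v \<and> org G e \<in> vertices G - Lv \<and> (v \<in> Lv \<or> e \<noteq> inn v)}
    = {e. e \<in> oedges G \<and> ter G e = v \<and> e \<noteq> inn v}"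
  using other by auto

lemma finite_into: "v \<in> vertices G \<Longrightarrow> finite {e. e \<in> oedges G \<and> ter G e = v}"
  using locally_finite[of v] by (simp add: no_prongs)

lemma Se_inn: "u \<in> vertices G - Lv \<Longrightarrow> Se G (erev G (inn u)) = Se G (inn u) \<and> org G (erev G (inn u)) = u"
  using inn[of u] erev_oedge[of "inn u"] Se_erev[of "inn u"] by auto

text \<open>Loops and parallel edges within the core are merged into the coefficients
  \<open>a v w\<close>; on the ends each child has its own arc.\<close>

sublocale ES: ended_space "vertices G" Lv "Sv G" "\<lambda>v. Se G (inn v)" par "gdist G bp"
  "\<lambda>v w. \<Sum>e | e \<in> oedges G \<and> ter G e = v \<and> org G e = w. Sv G v / Se G e" q
proof unfold_locales
  show "0 < Se G (inn v)" if "v \<in> vertices G - Lv" for v using inn[OF that] Se_pos by blast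
  show "par v \<in> vertices G" if "v \<in> vertices G - Lv" for v
    using inn[OF that] oedge_ends by (simp add: par_def)
  show "finite {u \<in> vertices G - Lv. par u = v}" if v: "v \<in> vertices G" for v
    using bij_betw_finite[OF children_arcs[OF v]] finite_into[OF v] by (auto elim: rev_finite_subset)
  show "(\<Sum>u | u \<in> vertices G - Lv \<and> par u = v. Sv G v * Sv G u / (Se G (inn u))\<^sup>2) = real q"
    if v: "v \<in> vertices G - Lv" for v
  proof -
    have "(\<Sum>u | u \<in> vertices G - Lv \<and> par u = v. Sv G v * Sv G u / (Se G (inn u))\<^sup>2)
      = (\<Sum>u | u \<in> vertices G - Lv \<and> par u = v. Sv G v / Se G (erev G (inn u))
          * (Sv G (org G (erev G (inn u))) / Se G (erev G (inn u))))"
      by (intro sum.cong) (auto simp: Se_inn power2_eq_square)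
    also have "\<dots> = real q"
      using sum_children[of v "\<lambda>e. Sv G v / Se G e * (Sv G (org G e) / Se G e)"] v reg[OF v]
      by (simp only: into_end[OF v]) auto
    finally show ?thesis .
  qed
qed (use q core_finite core_sub Sv_pos level_par in auto)

lemma sum_children_adjacency:
  assumes v: "v \<in> vertices G"
  shows "(\<Sum>u\<in>ES.ch v. of_real (Sv G v / Se G (inn u)) * f u)
    = (\<Sum>e | e \<in> oedges G \<and> ter G e = v \<and> org G e \<in> vertices G - Lv \<and> (v \<in> Lv \<or> e \<noteq> inn v).
        of_real (Sv G v / Se G e) * f (org G e))"
proof -
  have "(\<Sum>u\<in>ES.ch v. of_real (Sv G v / Se G (inn u)) * f u)
    = (\<Sum>u | u \<in> vertices G - Lv \<and> par u = v. of_real (Sv G v / Se G (erev G (inn u))) * f (org G (erev G (inn u))))"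
    by (intro sum.cong) (auto simp: ES.ch_def Se_inn)
  then show ?thesis
    using sum_children[OF v, of "\<lambda>e. of_real (Sv G v / Se G e) * f (org G e)"] by simp
qed

text \<open>Arcs into \<open>v\<close> come from children or not. Those that do not start in the
  core if \<open>v\<close> is a core vertex, and reduce to the single arc \<open>inn v\<close>
  otherwise.\<close>

lemma adjacency_eq: "adjacency G = ES.adj"
proof (intro ext)
  fix f v
  show "adjacency G f v = ES.adj f v"
  proof (cases "v \<in> vertices G")
    case False
    then have none: "{e. e \<in> oedges G \<and> ter G e = v} = {}" using oedge_ends by blast
    show ?thesis unfolding adjacency_def none using False core_sub by (auto simp: ES.adj_def)
  next
    case v: True
    let ?g = "\<lambda>e. of_real (Sv G v / Se G e) * f (org G e) :: complex"
    let ?A = "{e. e \<in> oedges G \<and> ter G e = v}"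
    let ?K = "{e. e \<in> oedges G \<and> ter G e = v \<and> org G e \<in> vertices G - Lv \<and> (v \<in> Lv \<or> e \<noteq> inn v)}"
    have fA: "finite ?A" by (rule finite_into[OF v])
    have "adjacency G f v = (\<Sum>e\<in>?A. ?g e)" by (simp add: adjacency_def)
    also have "\<dots> = (\<Sum>e\<in>?A - ?K. ?g e) + (\<Sum>e\<in>?K. ?g e)"
      by (rule sum.subset_diff[OF _ fA]) auto
    also have "(\<Sum>e\<in>?K. ?g e) = (\<Sum>u\<in>ES.ch v. of_real (Sv G v / Se G (inn u)) * f u)"
      by (rule sum_children_adjacency[OF v, symmetric])
    finally have *: "adjacency G f v = (\<Sum>e\<in>?A - ?K. ?g e) + (\<Sum>u\<in>ES.ch v. of_real (Sv G v / Se G (inn u)) * f u)" .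
    show ?thesis
    proof (cases "v \<in> Lv")
      case True
      let ?B = "{e \<in> ?A. org G e \<in> Lv}"
      have "?A - ?K = ?B" using True oedge_ends core_sub by auto
      moreover have "(\<Sum>e\<in>?B. ?g e) = (\<Sum>w\<in>Lv. \<Sum>e\<in>{e \<in> ?B. org G e = w}. ?g e)"
        by (intro sum.group[symmetric] finite_subset[OF _ fA] core_finite) auto
      moreover have "(\<Sum>e\<in>{e \<in> ?B. org G e = w}. ?g e)
        = of_real (\<Sum>e | e \<in> oedges G \<and> ter G e = v \<and> org G e = w. Sv G v / Se G e) * f w" if "w \<in> Lv" for w
      proof -
        have "{e \<in> ?B. org G e = w} = {e. e \<in> oedges G \<and> ter G e = v \<and> org G e = w}" using that by auto
        then show ?thesis by (simp add: sum_distrib_right)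
      qed
      ultimately show ?thesis using * True by (simp add: ES.adj_def)
    next
      case False
      then have "?A - ?K = {inn v}" using v inn[of v] other by auto
      then show ?thesis using * False v by (simp add: ES.adj_def par_def)
    qed
  qed
qed

lemma wsp_powr:
  "weighted_l2 G (\<lambda>v. real q powr (c * real (gdist G bp v))) = ES.sp (real q powr c)"
  using q by (simp add: weighted_l2_eq_wsp ES.wt_def[abs_def] powr_powr[symmetric] powr_realpow)

lemma l2_wt: "l2 G = ES.sp 1"
  by (simp add: l2_eq_wsp ES.wt_def[abs_def])

lemma shifted_adjacency_eq: "shifted_adjacency q G \<mu> = (\<lambda>f v. of_real ES.cc * adjacency G f v - z \<mu> * f v)"
  by (simp add: shifted_adjacency_def ES.cc_def fun_eq_iff)

section \<open>The resolvent and its continuation\<close>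

theorem resolvent_continuation:
  defines "\<Omega>\<^sub>0 \<equiv> {\<mu>. \<mu> \<noteq> 0 \<and> cmod (z \<mu>) > opnorm (l2 G) (l2 G) (adjacency G) / (2 * sqrt (real q))}"
  shows "\<forall>\<mu>\<in>\<Omega>\<^sub>0. resolvent_defined q G \<mu>"
    and "holomorphic_family (l2 G) (l2 G) \<Omega>\<^sub>0 (resolvent q G)"
    and "0 \<le> N \<Longrightarrow> \<exists>R.
      finitely_meromorphic (weighted_l2 G (\<lambda>v. real q powr (- N * real (gdist G bp v))))
        (weighted_l2 G (\<lambda>v. real q powr (N * real (gdist G bp v))))
        {\<mu>. \<mu> \<noteq> 0 \<and> cmod \<mu> > real q powr (1/2 - N)} R \<and>
      (\<forall>\<^sub>F \<mu> in at_infinity. \<forall>f \<in> elems (weighted_l2 G (\<lambda>v. real q powr (- N * real (gdist G bp v)))).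
        R \<mu> f = resolvent q G \<mu> f)"
proof -
  define K where "K = opnorm (l2 G) (l2 G) (adjacency G)"
  interpret W: weighted_spaces "vertices G" "ES.wt 1" "ES.wt 1"
    by (simp add: weighted_spaces_def ES.weighted_space)
  obtain B where B: "bop W.X W.X (adjacency G) B" using ES.adj_bop unfolding adjacency_eq by blast
  \<comment> \<open>\<open>K\<close> is the operator norm itself rather than the constant from
    \<open>adj_bop\<close>, because the region of convergence is stated with it.\<close>
  interpret T: neumann_operator "vertices G" "ES.wt 1" "adjacency G" K
  proof unfold_locales
    show "bop W.X W.X (adjacency G) K" unfolding K_def l2_wt by (rule W.opnorm_bop_bound[OF B])
    show "0 \<le> K" unfolding K_def l2_wt by (rule W.opnorm_bop[OF B])
  qed (unfold adjacency_eq, rule ES.adj_pointwise_continuous)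
  have c: "0 \<le> ES.cc" by (simp add: ES.cc_def)
  have \<Omega>\<^sub>0: "\<Omega>\<^sub>0 = {\<mu>. \<mu> \<noteq> 0 \<and> ES.cc * K < cmod (z \<mu>)}"
    by (simp add: \<Omega>\<^sub>0_def K_def ES.cc_def)
  have res: "resolvent q G \<mu> f = T.outer_resolvent ES.cc (z \<mu>) f"
    if "ES.cc * K < cmod (z \<mu>)" "f \<in> elems (l2 G)" for \<mu> f
    using T.the_inv_into_shifted[OF c that(1)] that(2)
    unfolding resolvent_def shifted_adjacency_eq l2_wt by blast
  show "\<forall>\<mu>\<in>\<Omega>\<^sub>0. resolvent_defined q G \<mu>"
  proof
    fix \<mu> assume "\<mu> \<in> \<Omega>\<^sub>0"
    then have \<mu>: "ES.cc * K < cmod (z \<mu>)" by (simp add: \<Omega>\<^sub>0)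
    then obtain d where d: "ES.cc * K < d" "d < cmod (z \<mu>)" using dense by blast
    have "bop W.X W.X (resolvent q G \<mu>) (1 / d * (1 / (1 - ES.cc * K / d)))"
      by (rule W.bop_cong[OF T.outer_resolvent_bop[OF c d(2,1)]]) (use res[OF \<mu>] l2_wt in auto)
    then show "resolvent_defined q G \<mu>"
      unfolding resolvent_defined_def bounded_operator_iff_bop shifted_adjacency_eq l2_wt
      using T.shifted_bij[OF c \<mu>] by blast
  qed
  show "holomorphic_family (l2 G) (l2 G) \<Omega>\<^sub>0 (resolvent q G)"
    unfolding \<Omega>\<^sub>0 l2_wt by (rule T.outer_resolvent_holomorphic_family[OF c]) (use res l2_wt in auto)
  \<comment> \<open>A solution in \<open>l2\<close> is unique here; this is what identifies the
    constructed family with the resolvent.\<close>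
  have uniq: "g = resolvent q G \<mu> f"
    if "ES.cc * K < cmod (z \<mu>)" "g \<in> elems (l2 G)" "f \<in> elems (l2 G)" "shifted_adjacency q G \<mu> g = f" for g f \<mu>
    using res[OF that(1,3)] T.outer_resolvent_shifted(2)[OF c that(1)] that(2,4)
    unfolding shifted_adjacency_eq l2_wt by auto
  have shifted: "ES.shifted \<mu> f = shifted_adjacency q G \<mu> f" for \<mu> f
    by (simp add: shifted_adjacency_eq ES.shifted_def adjacency_eq fun_eq_iff)
  have large: "\<forall>\<^sub>F \<mu> in at_infinity. ES.cc * K < cmod (z \<mu>) \<and> 1 < cmod \<mu>"
    unfolding eventually_at_infinity
  \<comment> \<open>For \<open>cmod \<mu> > 1\<close> one has
    \<open>cmod (z \<mu>) \<ge> (cmod \<mu> - 1) / 2\<close>, so this radius gives at least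
    \<open>ES.cc * K + 1\<close>.\<close>
  proof (intro exI[of _ "2 * (ES.cc * K) + 3"] allI impI)
    fix \<mu> :: complex assume \<mu>: "2 * (ES.cc * K) + 3 \<le> cmod \<mu>"
    have "0 \<le> ES.cc * K" using c T.K_nonneg by simp
    then have \<mu>1: "1 < cmod \<mu>" using \<mu> by linarith
    then have "cmod (inverse \<mu>) \<le> 1" by (simp add: norm_inverse inverse_le_1_iff)
    moreover have "cmod \<mu> \<le> cmod (\<mu> + inverse \<mu>) + cmod (inverse \<mu>)"
      using norm_triangle_ineq4[of "\<mu> + inverse \<mu>" "inverse \<mu>"] by simp
    ultimately have "cmod \<mu> - 1 \<le> 2 * cmod (z \<mu>)" by (simp add: z_def norm_divide)
    then show "ES.cc * K < cmod (z \<mu>) \<and> 1 < cmod \<mu>" using \<mu> \<mu>1 by linarith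
  qed
  show "\<exists>R. finitely_meromorphic (weighted_l2 G (\<lambda>v. real q powr (- N * real (gdist G bp v))))
        (weighted_l2 G (\<lambda>v. real q powr (N * real (gdist G bp v))))
        {\<mu>. \<mu> \<noteq> 0 \<and> cmod \<mu> > real q powr (1/2 - N)} R \<and>
      (\<forall>\<^sub>F \<mu> in at_infinity. \<forall>f \<in> elems (weighted_l2 G (\<lambda>v. real q powr (- N * real (gdist G bp v)))).
        R \<mu> f = resolvent q G \<mu> f)"
    if N: "0 \<le> N"
  proof -
    define b where "b = real q powr (- N)"
    have q1: "1 \<le> real q" using q by simp
    have b: "0 < b" "b \<le> 1" using q N powr_mono[of "- N" 0 "real q"] q1 by (auto simp: b_def)
    have "1 / b = real q powr N" by (simp add: b_def powr_minus_divide)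
    then have sp: "weighted_l2 G (\<lambda>v. real q powr (- N * real (gdist G bp v))) = ES.sp b"
      "weighted_l2 G (\<lambda>v. real q powr (N * real (gdist G bp v))) = ES.sp (1 / b)"
      unfolding wsp_powr by (simp_all add: b_def)
    have "\<exists>R. finitely_meromorphic (ES.sp b) (ES.sp (1 / b))
        {\<mu>. \<mu> \<noteq> 0 \<and> cmod \<mu> > real q powr (1/2 - N)} R \<and>
      (\<forall>\<^sub>F \<mu> in at_infinity. \<forall>f \<in> elems (ES.sp b).
        R \<mu> f \<in> elems (ES.sp 1) \<and> ES.shifted \<mu> (R \<mu> f) = f)"
    proof (rule ES.meromorphic_inverse[OF b])
      fix \<mu> assume "\<mu> \<in> {\<mu>. \<mu> \<noteq> 0 \<and> cmod \<mu> > real q powr (1/2 - N)}"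
      \<comment> \<open>The domain in question lies inside \<open>cmod \<mu> > b\<close>, where both
        Neumann series converge.\<close>
      moreover have "b \<le> real q powr (1/2 - N)" unfolding b_def using q1 by (intro powr_mono) auto
      ultimately show "b < cmod \<mu>" by simp
    next
      obtain c where c: "\<And>\<mu>. c \<le> cmod \<mu> \<Longrightarrow> ES.cc * K < cmod (z \<mu>) \<and> 1 < cmod \<mu>"
        using large unfolding eventually_at_infinity by blast
      \<comment> \<open>Any sufficiently large positive number is a point of injectivity.\<close>
      have "c \<le> cmod (of_real \<bar>c\<bar>)" by simp
      from c[OF this] obtain \<mu> where \<mu>: "ES.cc * K < cmod (z \<mu>)" "1 < cmod \<mu>" by blast
      have "f = (\<lambda>_. 0)" if f: "f \<in> elems W.X" "ES.shifted \<mu> f = (\<lambda>_. 0)" for f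
      proof -
        have z0: "(\<lambda>_. 0) \<in> elems (l2 G)" unfolding l2_wt by (rule W.X.elems_zero)
        have "shifted_adjacency q G \<mu> (\<lambda>_. 0) = (\<lambda>_. 0)"
          by (simp add: shifted_adjacency_def adjacency_def fun_eq_iff)
        then show ?thesis
          using uniq[OF \<mu>(1) _ z0] z0 f by (metis l2_wt shifted)
      qed
      then show "\<exists>\<mu>. 1 < cmod \<mu> \<and> (\<forall>f\<in>elems W.X. ES.shifted \<mu> f = (\<lambda>_. 0) \<longrightarrow> f = (\<lambda>_. 0))"
        using \<mu>(2) by blast
    qed
    then obtain R where R: "finitely_meromorphic (ES.sp b) (ES.sp (1 / b))
        {\<mu>. \<mu> \<noteq> 0 \<and> cmod \<mu> > real q powr (1/2 - N)} R"
      "\<forall>\<^sub>F \<mu> in at_infinity. \<forall>f \<in> elems (ES.sp b).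
        R \<mu> f \<in> elems (ES.sp 1) \<and> ES.shifted \<mu> (R \<mu> f) = f" by blast
    have "\<forall>\<^sub>F \<mu> in at_infinity. \<forall>f \<in> elems (ES.sp b). R \<mu> f = resolvent q G \<mu> f"
      using R(2) large
    proof eventually_elim
      case (elim \<mu>)
      show ?case
      proof
        fix f assume f: "f \<in> elems (ES.sp b)"
        have "f \<in> elems (l2 G)" unfolding l2_wt by (rule bopD(1)[OF ES.inclusion_bop[OF b] f])
        then show "R \<mu> f = resolvent q G \<mu> f"
          using uniq[of \<mu> "R \<mu> f" f] elim f by (simp add: l2_wt shifted)
      qed
    qed
    then show ?thesis unfolding sp using R(1) by blast
  qed
qed

end

theorem theorem1p1:
  fixes G L :: "('v, 'e, 'g, 'h) gog" and C :: "'e set" and q :: nat and bp :: 'v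
  assumes "q \<ge> 2"
    and "graph_of_groups G"
    and "gf_decomposition q G C L"
    and "bp \<in> vertices L"
  defines "\<Omega>\<^sub>0 \<equiv> {\<mu>. \<mu> \<noteq> 0 \<and> cmod (z \<mu>) > opnorm (l2 G) (l2 G) (adjacency G) / (2 * sqrt (real q))}"
  shows "(\<forall>\<mu>\<in>\<Omega>\<^sub>0. resolvent_defined q G \<mu>) \<and>
    holomorphic_family (l2 G) (l2 G) \<Omega>\<^sub>0 (resolvent q G) \<and>
    (\<forall>N::real. N \<ge> 0 \<longrightarrow>
       (let X = weighted_l2 G (\<lambda>v. real q powr (- N * real (gdist G bp v)));
            Y = weighted_l2 G (\<lambda>v. real q powr (N * real (gdist G bp v)))
        in \<exists>R. finitely_meromorphic X Y {\<mu>. \<mu> \<noteq> 0 \<and> cmod \<mu> > real q powr (1/2 - N)} R \<and>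
             (\<forall>\<^sub>F \<mu> in at_infinity. \<forall>f \<in> elems X. R \<mu> f = resolvent q G \<mu> f)))"
proof -
  interpret graph_of_groups G by (rule assms(2))
  note gf = assms(3)[unfolded gf_decomposition_def]
  have C: "C \<subseteq> oedges G" "erev G ` C = C" and L: "L \<in> pieces G C" and fin: "finite (vertices L)"
    using gf by blast+
  have "\<exists>inn. end_arcs q P inn" if "P \<in> pieces G C" "P \<noteq> L" for P
    using gf that funnel_end_arcs[of P q] cusp_end_arcs[of P q] by blast
  from ends_arcs[OF C L this] obtain inn where inn:
    "\<And>v. v \<in> vertices G - vertices L \<Longrightarrow> inn v \<in> oedges G \<and> ter G (inn v) = v"
    "\<And>e. e \<in> oedges G \<Longrightarrow> ter G e \<in> vertices G - vertices L \<Longrightarrow> e \<noteq> inn (ter G e) \<Longrightarrow>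
       org G e \<in> vertices G - vertices L \<and> inn (org G e) = erev G e"
    "\<And>v. v \<in> vertices G - vertices L \<Longrightarrow>
      (\<Sum>e | e \<in> oedges G \<and> ter G e = v \<and> e \<noteq> inn v. Sv G v / Se G e * (Sv G (org G e) / Se G e)) = real q"
    by blast
  interpret end_structure G "vertices L" inn q bp
    by unfold_locales (use inn assms(1,4) fin piece_fields(1)[OF C L] in auto)
  show ?thesis
    unfolding \<Omega>\<^sub>0_def Let_def using resolvent_continuation by blast
qed

end
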